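(* Let $n\ge 2$, $T>0$, $G=(0,1)^n$, let $G_0\subset G$ be an arbitrary non-empty open set, let $c_0>0$ and let $\gamma_1,\dots,\gamma_n$ be positive coefficients with $\mathrm{reg}(\gamma)<c_0$. Let $n^{\ast}$ satisfy $n^\ast>2$ if $n=2$ and $n^\ast\ge n$ if $n\ge 3$. Let $a_{1i}\in L^\infty_{\mathcal F}(0,T;L^\infty_h(\mathcal M))$ for $i=1,\dots,n$ and $a_2\in L^\infty_{\mathcal F}(0,T;L_h^{n^\ast}(\mathcal M))$, with norms bounded by a number $R$ not depending on $h$. Let $C_0>0$. Then there exist a constant $C>0$, independent of $h$, and $N_0\in\mathbb N$ such that for every $N\ge N_0$, with $h=1/(N+1)$, the following holds. Let $g_1,g_2\in L^2_{\mathcal F}(0,T;H^1_h(\mathcal M))$ satisfy, for every $i=1,\dots,n$, $$|D_i(g_1-g_2)|\le C_0\,|A_i(g_1-g_2)|\quad\text{in } \mathcal M_i^\ast\times(0,T),\ \mathbb P\text{-a.s.}$$ For $k=1,2$ let $w_k$ be the solution of $$\begin{cases} dw-\sum_{i=1}^n D_i(\gamma_iD_iw)\,dt=\Big(\sum_{i=1}^n a_{1i}A_iD_iw+a_2w\Big)dt+g_k\,dB(t) & \text{in }\mathcal M\times(0,T),\\ w=0\ \text{ on }\partial\mathcal M\times(0,T),\qquad w|_{t=0}=w_0\ \text{ in }\mathcal M,\end{cases}$$ with the same initial datum $w_0$ for $k=1,2$. Let $$\Lambda_1(g_k):=\big(w_k|_{(G_0\cap\mathcal M)\times(0,T)},\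 w_k|_{t=T}\big).$$ Then $$\|g_1-g_2\|_{L^2_{\mathcal F}(0,T;L^2_h(\mathcal M))}\le C\,\|\Lambda_1(g_1)-\Lambda_1(g_2)\|_{X_1},$$ where $\|(f_1,f_2)\|_{X_1}=\|f_1\|_{L^2_{\mathcal F}(0,T;L^2_h(G_0\cap\mathcal M))}+\|f_2\|_{L^2_{\mathcal F_T}(\Omega;L^2_h(\mathcal M))}$.
   Context: Probability. $(\Omega,\mathcal F,\{\mathcal F_t\}_{t\ge0},\mathbb P)$ is a complete filtered probability space carrying a one-dimensional standard Brownian motion $B$; $\{\mathcal F_t\}$ is the natural filtration of $B$ augmented by the $\mathbb P$-null sets. For a Banach space $\mathcal X$: $L^2_{\mathcal F}(0,T;\mathcal X)$ is the space of $\mathcal X$-valued $\{\mathcal F_t\}$-adapted processes with $\mathbb E\int_0^T\|X\|_{\mathcal X}^2dt<\infty$ (with the corresponding norm); $L^\infty_{\mathcal F}(0,T;\mathcal X)$ is the space of $\mathcal X$-valued adapted bounded processes; $L^2_{\mathcal F_T}(\Omega;\mathcal X)$ is the space of $\mathcal F_T$-measurable square-integrable $\mathcal X$-valued random variables. Mesh. $N\in\mathbb N$ is sufficiently large, $h=1/(N+1)$, $\mathcal M=G\cap h\mathbb Z^n$, $\{e_k\}$ is the standard basis of $\mathbb R^n$. For a finite set $W$ of points, $W_k^\ast=\{x\pm\frac h2e_k: x\in W\}$. $\partial_k\mathcal M=(\mathcal M_k^\ast)_k^\ast\setminus\mathcal M$ and $\partial\mathcal M=\bigcup_k\partial_k\mathcal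 M$. Mesh functions are regarded as having values also at the boundary grid points whenever the operators below require them. Operators: $D_ku(x)=\frac{u(x+\frac h2e_k)-u(x-\frac h2e_k)}h$, $A_ku(x)=\frac{u(x+\frac h2e_k)+u(x-\frac h2e_k)}2$; they map functions on the primal mesh to functions on $\mathcal M_k^\ast$, and functions on $\mathcal M_k^\ast$ to functions on $\mathcal M$. Norms. For a set $W$ of mesh (primal or dual) points, $\int_Wu=h^n\sum_{x\in W}u(x)$. $\|u\|_{L^p_h(\mathcal M)}^p=\int_{\mathcal M}|u|^p$, $\|u\|_{L^\infty_h(\mathcal M)}=\max_{\mathcal M}|u|$, $\|u\|^2_{H^1_h(\mathcal M)}=\|u\|^2_{L^2_h(\mathcal M)}+\sum_i\int_{\mathcal M_i^\ast}|D_iu|^2$, and $\|u\|^2_{L^2_h(G_0\cap\mathcal M)}=\int_{G_0\cap\mathcal M}|u|^2$. Coefficients. $\gamma_i$ is the sampling on the primal and dual meshes of a function on $G$ (still denoted $\gamma_i$) with $\gamma_i>0$ and $\mathrm{reg}(\gamma):=\operatorname{ess\,sup}_{x\in G,\ i=1,\dots,n}\big(\gamma_i+\frac1{\gamma_i}+\sum_{j=1}^n|\partial_j\gamma_i|^2\big)<c_0$. The constants $C,N_0$ may depend on $n,T,G_0,c_0,n^\ast,R,C_0$ but not on $h,g_1,g_2,w_0$. *)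

theory Defs
  imports "HOL-Probability.Probability"
begin

section \<open>Mesh, difference operators and discrete norms\<close>

definition unit_cube :: "(real ^ 'n) set" where
  "unit_cube = {x. \<forall>i. 0 < x $ i \<and> x $ i < 1}"

definition primal_mesh :: "real \<Rightarrow> (real ^ 'n) set" where
  "primal_mesh h = unit_cube \<inter> {x. \<forall>i. \<exists>k::int. x $ i = h * of_int k}"

definition dual :: "real \<Rightarrow> 'n \<Rightarrow> (real ^ 'n) set \<Rightarrow> (real ^ 'n) set" where
  "dual h k W = (\<lambda>x. x + (h / 2) *\<^sub>R axis k 1) ` W \<union> (\<lambda>x. x - (h / 2) *\<^sub>R axis k 1) ` W"

definition mesh_boundary :: "real \<Rightarrow> (real ^ 'n) set" where
  "mesh_boundary h = (\<Union>k. dual h k (dual h k (primal_mesh h)) - primal_mesh h)"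

definition Dh :: "real \<Rightarrow> 'n \<Rightarrow> (real ^ 'n \<Rightarrow> real) \<Rightarrow> real ^ 'n \<Rightarrow> real" where
  "Dh h k u x = (u (x + (h / 2) *\<^sub>R axis k 1) - u (x - (h / 2) *\<^sub>R axis k 1)) / h"

definition Ah :: "real \<Rightarrow> 'n \<Rightarrow> (real ^ 'n \<Rightarrow> real) \<Rightarrow> real ^ 'n \<Rightarrow> real" where
  "Ah h k u x = (u (x + (h / 2) *\<^sub>R axis k 1) + u (x - (h / 2) *\<^sub>R axis k 1)) / 2"

definition mesh_integral :: "real \<Rightarrow> (real ^ 'n) set \<Rightarrow> (real ^ 'n \<Rightarrow> real) \<Rightarrow> real" where
  "mesh_integral h W u = h ^ CARD('n) * (\<Sum>x\<in>W. u x)"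

definition Lp_norm :: "real \<Rightarrow> real \<Rightarrow> (real ^ 'n) set \<Rightarrow> (real ^ 'n \<Rightarrow> real) \<Rightarrow> real" where
  "Lp_norm p h W u = mesh_integral h W (\<lambda>x. \<bar>u x\<bar> powr p) powr (1 / p)"

definition L2_norm :: "real \<Rightarrow> (real ^ 'n) set \<Rightarrow> (real ^ 'n \<Rightarrow> real) \<Rightarrow> real" where
  "L2_norm h W u = sqrt (mesh_integral h W (\<lambda>x. \<bar>u x\<bar>\<^sup>2))"

definition Linf_norm :: "(real ^ 'n) set \<Rightarrow> (real ^ 'n \<Rightarrow> real) \<Rightarrow> real" where
  "Linf_norm W u = Max ((\<lambda>x. \<bar>u x\<bar>) ` W)"

definition H1_norm :: "real \<Rightarrow> (real ^ 'n \<Rightarrow> real) \<Rightarrow> real" where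
  "H1_norm h u =
     sqrt ((L2_norm h (primal_mesh h) u)\<^sup>2
       + (\<Sum>i\<in>UNIV. mesh_integral h (dual h i (primal_mesh h)) (\<lambda>x. \<bar>Dh h i u x\<bar>\<^sup>2)))"

section \<open>Regularity of the diffusion coefficients\<close>

definition C1_compact_support :: "(real ^ 'n) set \<Rightarrow> (real ^ 'n \<Rightarrow> real) set" where
  "C1_compact_support S =
     {\<phi>. (\<forall>x. \<phi> differentiable (at x)) \<and>
          (\<forall>v. continuous_on UNIV (\<lambda>x. frechet_derivative \<phi> (at x) v)) \<and>
          (\<exists>K. compact K \<and> K \<subseteq> S \<and> (\<forall>x. x \<notin> K \<longrightarrow> \<phi> x = 0))}"

definition has_weak_partial ::
    "(real ^ 'n) set \<Rightarrow> 'n \<Rightarrow> (real ^ 'n \<Rightarrow> real) \<Rightarrow> (real ^ 'n \<Rightarrow> real) \<Rightarrow> bool" where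
  "has_weak_partial S j f g \<longleftrightarrow>
     (\<forall>K. compact K \<and> K \<subseteq> S \<longrightarrow> integrable (lebesgue_on K) f \<and> integrable (lebesgue_on K) g) \<and>
     (\<forall>\<phi>\<in>C1_compact_support S.
        integral\<^sup>L (lebesgue_on S) (\<lambda>x. f x * frechet_derivative \<phi> (at x) (axis j 1))
          = - integral\<^sup>L (lebesgue_on S) (\<lambda>x. g x * \<phi> x))"

definition weak_partial :: "(real ^ 'n) set \<Rightarrow> 'n \<Rightarrow> (real ^ 'n \<Rightarrow> real) \<Rightarrow> real ^ 'n \<Rightarrow> real" where
  "weak_partial S j f = (SOME g. has_weak_partial S j f g)"

text \<open>The coefficients are sampled at points, so the continuous representative is meant.
  All primal and dual mesh points lie in the open cube.\<close>

definition diffusion_coeffs :: "('n \<Rightarrow> real ^ 'n \<Rightarrow> real) \<Rightarrow> bool" where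
  "diffusion_coeffs \<gamma> \<longleftrightarrow>
     (\<forall>i. continuous_on unit_cube (\<gamma> i) \<and> (\<forall>x\<in>unit_cube. \<gamma> i x > 0) \<and>
          (\<forall>j. \<exists>g. has_weak_partial unit_cube j (\<gamma> i) g))"

definition reg :: "('n::finite \<Rightarrow> real ^ 'n \<Rightarrow> real) \<Rightarrow> ereal" where
  "reg \<gamma> = (SUP i. esssup (lebesgue_on unit_cube)
     (\<lambda>x. ereal (\<gamma> i x + 1 / \<gamma> i x + (\<Sum>j\<in>UNIV. \<bar>weak_partial unit_cube j (\<gamma> i) x\<bar>\<^sup>2))))"

section \<open>Brownian motion and its augmented filtration\<close>

definition brownian_motion :: "'w measure \<Rightarrow> (real \<Rightarrow> 'w \<Rightarrow> real) \<Rightarrow> bool" where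
  "brownian_motion M B \<longleftrightarrow>
     (\<forall>t\<ge>0. B t \<in> borel_measurable M) \<and>
     (AE \<omega> in M. B 0 \<omega> = 0) \<and>
     (AE \<omega> in M. continuous_on {0..} (\<lambda>t. B t \<omega>)) \<and>
     (\<forall>s t. 0 \<le> s \<and> s < t \<longrightarrow>
        distributed M lborel (\<lambda>\<omega>. B t \<omega> - B s \<omega>)
          (\<lambda>x. ennreal (normal_density 0 (sqrt (t - s)) x))) \<and>
     (\<forall>(m::nat) \<tau>. 0 \<le> \<tau> 0 \<and> (\<forall>j<m. \<tau> j < \<tau> (Suc j)) \<longrightarrow>
        prob_space.indep_vars M (\<lambda>_. borel) (\<lambda>j \<omega>. B (\<tau> (Suc j)) \<omega> - B (\<tau> j) \<omega>) {..<m})"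

definition aug_filtration :: "'w measure \<Rightarrow> (real \<Rightarrow> 'w \<Rightarrow> real) \<Rightarrow> real \<Rightarrow> 'w measure" where
  "aug_filtration M B t =
     sigma (space M)
       ({B s -` A \<inter> space M |s A. 0 \<le> s \<and> s \<le> t \<and> A \<in> sets borel} \<union> null_sets M)"

definition brownian_basis :: "'w measure \<Rightarrow> (real \<Rightarrow> 'w \<Rightarrow> real) \<Rightarrow> bool" where
  "brownian_basis M B \<longleftrightarrow> prob_space M \<and> complete_measure M \<and> brownian_motion M B"

section \<open>Spaces of adapted mesh-function-valued processes\<close>

text \<open>A process with values in the functions on a finite set \<open>P\<close> of grid points is a function
  \<open>u t \<omega> x\<close>, of which only the values at \<open>x \<in> P\<close> matter.\<close>

definition adapted_process ::
    "'w measure \<Rightarrow> (real \<Rightarrow> 'w measure) \<Rightarrow> real \<Rightarrow> (real ^ 'n) set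
      \<Rightarrow> (real \<Rightarrow> 'w \<Rightarrow> real ^ 'n \<Rightarrow> real) \<Rightarrow> bool" where
  "adapted_process M F T P u \<longleftrightarrow>
     (\<forall>x\<in>P. (\<lambda>(t, \<omega>). u t \<omega> x) \<in> borel_measurable (restrict_space lborel {0..T} \<Otimes>\<^sub>M M) \<and>
            (\<forall>t\<in>{0..T}. (\<lambda>\<omega>. u t \<omega> x) \<in> borel_measurable (F t)))"

definition L2F_sq ::
    "'w measure \<Rightarrow> real \<Rightarrow> ('v \<Rightarrow> real) \<Rightarrow> (real \<Rightarrow> 'w \<Rightarrow> 'v) \<Rightarrow> ennreal" where
  "L2F_sq M T nrm u = (\<integral>\<^sup>+\<omega>. (\<integral>\<^sup>+t\<in>{0..T}. ennreal ((nrm (u t \<omega>))\<^sup>2) \<partial>lborel) \<partial>M)"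

definition L2F_norm ::
    "'w measure \<Rightarrow> real \<Rightarrow> ('v \<Rightarrow> real) \<Rightarrow> (real \<Rightarrow> 'w \<Rightarrow> 'v) \<Rightarrow> real" where
  "L2F_norm M T nrm u = sqrt (enn2real (L2F_sq M T nrm u))"

definition L2F ::
    "'w measure \<Rightarrow> (real \<Rightarrow> 'w measure) \<Rightarrow> real \<Rightarrow> (real ^ 'n) set
      \<Rightarrow> ((real ^ 'n \<Rightarrow> real) \<Rightarrow> real) \<Rightarrow> (real \<Rightarrow> 'w \<Rightarrow> real ^ 'n \<Rightarrow> real) set" where
  "L2F M F T P nrm = {u. adapted_process M F T P u \<and> L2F_sq M T nrm u < \<infinity>}"

definition LinfF_norm ::
    "'w measure \<Rightarrow> real \<Rightarrow> ('v \<Rightarrow> real) \<Rightarrow> (real \<Rightarrow> 'w \<Rightarrow> 'v) \<Rightarrow> ereal" where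
  "LinfF_norm M T nrm u =
     esssup (restrict_space lborel {0..T} \<Otimes>\<^sub>M M) (\<lambda>(t, \<omega>). ereal (nrm (u t \<omega>)))"

definition LinfF ::
    "'w measure \<Rightarrow> (real \<Rightarrow> 'w measure) \<Rightarrow> real \<Rightarrow> (real ^ 'n) set
      \<Rightarrow> ((real ^ 'n \<Rightarrow> real) \<Rightarrow> real) \<Rightarrow> (real \<Rightarrow> 'w \<Rightarrow> real ^ 'n \<Rightarrow> real) set" where
  "LinfF M F T P nrm = {u. adapted_process M F T P u \<and> LinfF_norm M T nrm u < \<infinity>}"

definition L2Omega_sq :: "'w measure \<Rightarrow> ('v \<Rightarrow> real) \<Rightarrow> ('w \<Rightarrow> 'v) \<Rightarrow> ennreal" where
  "L2Omega_sq M nrm u = (\<integral>\<^sup>+\<omega>. ennreal ((nrm (u \<omega>))\<^sup>2) \<partial>M)"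

definition L2Omega_norm :: "'w measure \<Rightarrow> ('v \<Rightarrow> real) \<Rightarrow> ('w \<Rightarrow> 'v) \<Rightarrow> real" where
  "L2Omega_norm M nrm u = sqrt (enn2real (L2Omega_sq M nrm u))"

definition L2Omega ::
    "'w measure \<Rightarrow> 'w measure \<Rightarrow> (real ^ 'n) set
      \<Rightarrow> ((real ^ 'n \<Rightarrow> real) \<Rightarrow> real) \<Rightarrow> ('w \<Rightarrow> real ^ 'n \<Rightarrow> real) set" where
  "L2Omega M Ft P nrm =
     {u. (\<forall>x\<in>P. (\<lambda>\<omega>. u \<omega> x) \<in> borel_measurable Ft) \<and> L2Omega_sq M nrm u < \<infinity>}"

section \<open>The Ito integral\<close>

definition simple_integrand ::
    "'w measure \<Rightarrow> (real \<Rightarrow> 'w measure) \<Rightarrow> real \<Rightarrow> nat \<Rightarrow> (nat \<Rightarrow> real) \<Rightarrow> (nat \<Rightarrow> 'w \<Rightarrow> real) \<Rightarrow> bool"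
  where
  "simple_integrand M F t m \<tau> \<xi> \<longleftrightarrow>
     \<tau> 0 = 0 \<and> \<tau> m = t \<and>
     (\<forall>j<m. \<tau> j \<le> \<tau> (Suc j) \<and> \<xi> j \<in> borel_measurable (F (\<tau> j)) \<and>
            (\<exists>b. \<forall>\<omega>\<in>space M. \<bar>\<xi> j \<omega>\<bar> \<le> b))"

definition simple_process ::
    "nat \<Rightarrow> (nat \<Rightarrow> real) \<Rightarrow> (nat \<Rightarrow> 'w \<Rightarrow> real) \<Rightarrow> real \<Rightarrow> 'w \<Rightarrow> real" where
  "simple_process m \<tau> \<xi> s \<omega> = (\<Sum>j<m. \<xi> j \<omega> * indicator {\<tau> j<..\<tau> (Suc j)} s)"

definition simple_ito ::
    "(real \<Rightarrow> 'w \<Rightarrow> real) \<Rightarrow> nat \<Rightarrow> (nat \<Rightarrow> real) \<Rightarrow> (nat \<Rightarrow> 'w \<Rightarrow> real) \<Rightarrow> 'w \<Rightarrow> real" where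
  "simple_ito B m \<tau> \<xi> \<omega> = (\<Sum>j<m. \<xi> j \<omega> * (B (\<tau> (Suc j)) \<omega> - B (\<tau> j) \<omega>))"

text \<open>\<open>Y\<close> is (a version of) the integral of \<open>f\<close> with respect to \<open>B\<close> over \<open>[0,t]\<close>, the
  \<open>L\<^sup>2(\<Omega>)\<close>-limit of the integrals of simple processes approximating \<open>f\<close>.\<close>

definition has_ito_integral ::
    "'w measure \<Rightarrow> (real \<Rightarrow> 'w measure) \<Rightarrow> (real \<Rightarrow> 'w \<Rightarrow> real) \<Rightarrow> real
      \<Rightarrow> (real \<Rightarrow> 'w \<Rightarrow> real) \<Rightarrow> ('w \<Rightarrow> real) \<Rightarrow> bool" where
  "has_ito_integral M F B t f Y \<longleftrightarrow>
     Y \<in> borel_measurable M \<and>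
     (\<exists>m \<tau> \<xi>.
        (\<forall>k::nat. simple_integrand M F t (m k) (\<tau> k) (\<xi> k)) \<and>
        (\<lambda>k. \<integral>\<^sup>+\<omega>. (\<integral>\<^sup>+s\<in>{0..t}. ennreal ((simple_process (m k) (\<tau> k) (\<xi> k) s \<omega> - f s \<omega>)\<^sup>2) \<partial>lborel) \<partial>M)
          \<longlonglongrightarrow> 0 \<and>
        (\<lambda>k. \<integral>\<^sup>+\<omega>. ennreal ((simple_ito B (m k) (\<tau> k) (\<xi> k) \<omega> - Y \<omega>)\<^sup>2) \<partial>M) \<longlonglongrightarrow> 0)"

section \<open>The semi-discrete stochastic parabolic equation\<close>

definition drift ::
    "real \<Rightarrow> ('n::finite \<Rightarrow> real ^ 'n \<Rightarrow> real) \<Rightarrow> ('n \<Rightarrow> real ^ 'n \<Rightarrow> real) \<Rightarrow> (real ^ 'n \<Rightarrow> real)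
      \<Rightarrow> (real ^ 'n \<Rightarrow> real) \<Rightarrow> real ^ 'n \<Rightarrow> real" where
  "drift h \<gamma> b1 b2 v x =
     (\<Sum>i\<in>UNIV. Dh h i (\<lambda>y. \<gamma> i y * Dh h i v y) x)
     + (\<Sum>i\<in>UNIV. b1 i x * Ah h i (Dh h i v) x) + b2 x * v x"

definition is_solution ::
    "'w measure \<Rightarrow> (real \<Rightarrow> 'w \<Rightarrow> real) \<Rightarrow> real \<Rightarrow> real
      \<Rightarrow> ('n::finite \<Rightarrow> real ^ 'n \<Rightarrow> real)
      \<Rightarrow> ('n \<Rightarrow> real \<Rightarrow> 'w \<Rightarrow> real ^ 'n \<Rightarrow> real) \<Rightarrow> (real \<Rightarrow> 'w \<Rightarrow> real ^ 'n \<Rightarrow> real)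
      \<Rightarrow> (real \<Rightarrow> 'w \<Rightarrow> real ^ 'n \<Rightarrow> real) \<Rightarrow> ('w \<Rightarrow> real ^ 'n \<Rightarrow> real)
      \<Rightarrow> (real \<Rightarrow> 'w \<Rightarrow> real ^ 'n \<Rightarrow> real) \<Rightarrow> bool" where
  "is_solution M B T h \<gamma> a1 a2 g w0 w \<longleftrightarrow>
     w \<in> L2F M (aug_filtration M B) T (primal_mesh h) (L2_norm h (primal_mesh h)) \<and>
     (AE \<omega> in M. \<forall>x\<in>primal_mesh h. continuous_on {0..T} (\<lambda>t. w t \<omega> x)) \<and>
     (AE \<omega> in M. \<forall>t\<in>{0<..<T}. \<forall>x\<in>mesh_boundary h. w t \<omega> x = 0) \<and>
     (AE \<omega> in M. \<forall>x\<in>primal_mesh h. w 0 \<omega> x = w0 \<omega> x) \<and>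
     (\<forall>t\<in>{0..T}. \<forall>x\<in>primal_mesh h. \<exists>Y.
        has_ito_integral M (aug_filtration M B) B t (\<lambda>s \<omega>. g s \<omega> x) Y \<and>
        (AE \<omega> in M. w t \<omega> x = w 0 \<omega> x
            + (LINT s:{0..t}|lborel. drift h \<gamma> (\<lambda>i. a1 i s \<omega>) (a2 s \<omega>) (w s \<omega>) x) + Y \<omega>))"

text \<open>The norm of a pair (interior observation on \<open>G0\<close>, terminal observation).\<close>

definition X1_norm ::
    "'w measure \<Rightarrow> real \<Rightarrow> real \<Rightarrow> (real ^ 'n) set
      \<Rightarrow> (real \<Rightarrow> 'w \<Rightarrow> real ^ 'n \<Rightarrow> real) \<times> ('w \<Rightarrow> real ^ 'n \<Rightarrow> real) \<Rightarrow> real" where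
  "X1_norm M T h G0 f =
     L2F_norm M T (L2_norm h (G0 \<inter> primal_mesh h)) (fst f)
     + L2Omega_norm M (L2_norm h (primal_mesh h)) (snd f)"

text \<open>The restriction of \<open>w\<close> to \<open>(G0 \<inter> mesh) \<times> (0,T)\<close> is represented by its extension by zero.\<close>

definition Lambda1 ::
    "real \<Rightarrow> real \<Rightarrow> (real ^ 'n) set \<Rightarrow> (real \<Rightarrow> 'w \<Rightarrow> real ^ 'n \<Rightarrow> real)
      \<Rightarrow> (real \<Rightarrow> 'w \<Rightarrow> real ^ 'n \<Rightarrow> real) \<times> ('w \<Rightarrow> real ^ 'n \<Rightarrow> real)" where
  "Lambda1 T h G0 w =
     ((\<lambda>t \<omega> x. if x \<in> G0 \<inter> primal_mesh h \<and> t \<in> {0<..<T} then w t \<omega> x else 0), w T)"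

end

theory Submission
  imports Defs
begin

text \<open>
  Write \<open>u\<close> for the difference of the two solutions and \<open>g\<close> for the difference of the two
  sources. The hypothesis on \<open>g\<close> bounds the logarithmic gradient of \<open>g\<close>, so \<open>g\<close> has constant
  sign and its values at any two mesh points are comparable: the size of \<open>g\<close> is already visible
  inside \<open>G0\<close>, and no Carleman estimate is needed.

  Fix a cutoff \<open>\<phi>\<close>, the square of a Lipschitz bump supported in \<open>G0\<close>, and subtract \<open>\<theta>\<close> times
  the Ito identity for \<open>E \<integral> \<phi> u\<^sup>2\<close> from the one for \<open>E (\<integral> \<phi> u)\<^sup>2\<close>. The quadratic
  variation \<open>(\<integral> \<phi> g)\<^sup>2 - \<theta> \<integral> \<phi> g\<^sup>2\<close> dominates a multiple of \<open>\<integral> g\<^sup>2\<close> for small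
  \<open>\<theta>\<close>. In the drift, the localized gradient energy produced by the first identity is absorbed by
  the dissipation in the second, whatever \<open>\<theta>\<close>; the potential in \<open>L\<^sup>n\<close> is handled by a
  discrete Gagliardo inequality of Loomis-Whitney type. What remains is \<open>\<integral> u\<^sup>2\<close> over \<open>G0\<close>
  and the terminal value.
\<close>

section \<open>Square-integrable functions\<close>

text \<open>The identity for the squared pairing alone already has a coercive quadratic variation,
  but its drift contains a gradient of \<open>u\<close> that no observation controls. The subtracted
  identity supplies that gradient with the good sign, at the price of \<open>\<theta>\<close> times
  its own quadratic variation; this price is what forces \<open>\<theta>\<close> to be small. Both
  identities are contractions of one product rule for pairs of mesh values \<open>u x * u y\<close>,
  so Ito calculus is needed only for finitely many real processes, which start from zero because the
  initial datum is shared.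

  Uniformity in \<open>h\<close> rests on three points. The weight is a square because the
  difference of \<open>ch\<^sup>2\<close> is bounded by twice the average of \<open>ch\<close>:
  differentiating the weight costs only its square root, which Young's inequality can absorb. The
  potential is tested against \<open>(ch * v)\<^sup>2\<close>, whose first difference is bounded in
  L^1 by energy and mass; the endpoint inequality for W^{1,1} pairs it with the L^n norm for every n
  at least 2. Finally, two mesh points are joined by fewer than n / h lattice steps, each costing a
  factor \<open>exp (2 * C0 * h)\<close>.\<close>

definition square_integrable :: "'a measure \<Rightarrow> ('a \<Rightarrow> real) \<Rightarrow> bool" where
  "square_integrable M f \<longleftrightarrow> f \<in> borel_measurable M \<and> integrable M (\<lambda>x. (f x)\<^sup>2)"

lemma square_integrableD [measurable_dest]:
  "square_integrable M f \<Longrightarrow> f \<in> borel_measurable M"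
  by (simp add: square_integrable_def)

lemma square_integrable_iff_nn:
  "square_integrable M f \<longleftrightarrow>
     f \<in> borel_measurable M \<and> (\<integral>\<^sup>+x. ennreal ((f x)\<^sup>2) \<partial>M) < \<infinity>"
  by (auto simp: square_integrable_def integrable_iff_bounded)

lemma nn_integral_square:
  "square_integrable M f \<Longrightarrow> (\<integral>\<^sup>+x. ennreal ((f x)\<^sup>2) \<partial>M) = ennreal (\<integral>x. (f x)\<^sup>2 \<partial>M)"
  unfolding square_integrable_def by (intro nn_integral_eq_integral) auto

lemma square_integrable_mult:
  assumes "square_integrable M f" "square_integrable M g"
  shows "integrable M (\<lambda>x. f x * g x)"
proof (rule Bochner_Integration.integrable_bound)
  show "integrable M (\<lambda>x. (f x)\<^sup>2 + (g x)\<^sup>2)"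
    using assms by (auto simp: square_integrable_def)
  have "\<bar>a * b\<bar> \<le> a\<^sup>2 + b\<^sup>2" for a b :: real
    using sum_squares_bound[of "\<bar>a\<bar>" "\<bar>b\<bar>"] mult_nonneg_nonneg[of "\<bar>a\<bar>" "\<bar>b\<bar>"]
    unfolding abs_mult power2_abs by linarith
  then show "AE x in M. norm (f x * g x) \<le> norm ((f x)\<^sup>2 + (g x)\<^sup>2)" by auto
qed (use assms in \<open>auto simp: square_integrable_def\<close>)

lemma square_integrable_add:
  assumes "square_integrable M f" "square_integrable M g"
  shows "square_integrable M (\<lambda>x. f x + g x)"
  using assms square_integrable_mult[OF assms]
  by (auto simp: square_integrable_def power2_sum mult.assoc)

lemma square_integrable_cmult:
  assumes "square_integrable M f" shows "square_integrable M (\<lambda>x. c * f x)"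
  using assms by (auto simp: square_integrable_def power_mult_distrib)

lemma square_integrable_diff:
  assumes "square_integrable M f" "square_integrable M g"
  shows "square_integrable M (\<lambda>x. f x - g x)"
  using square_integrable_add[OF assms(1) square_integrable_cmult[OF assms(2), of "-1"]] by simp

lemma square_integrable_zero: "square_integrable M (\<lambda>_. 0)"
  by (simp add: square_integrable_def)

lemma square_integrable_sum:
  assumes "\<And>i. i \<in> I \<Longrightarrow> square_integrable M (f i)"
  shows "square_integrable M (\<lambda>x. \<Sum>i\<in>I. f i x)"
  using assms by (induction I rule: infinite_finite_induct)
    (auto intro: square_integrable_add square_integrable_zero)

lemma square_integrable_bound:
  assumes "square_integrable M f" "g \<in> borel_measurable M" "AE x in M. \<bar>g x\<bar> \<le> \<bar>f x\<bar>"
  shows "square_integrable M g"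
  unfolding square_integrable_def
proof (intro conjI)
  show "integrable M (\<lambda>x. (g x)\<^sup>2)"
    by (rule Bochner_Integration.integrable_bound[of _ "\<lambda>x. (f x)\<^sup>2"])
      (use assms in \<open>auto simp: square_integrable_def abs_le_square_iff\<close>)
qed (use assms in auto)

lemma square_integrable_mult_bounded:
  assumes "square_integrable M f" "g \<in> borel_measurable M" "AE x in M. \<bar>g x\<bar> \<le> b"
  shows "square_integrable M (\<lambda>x. g x * f x)"
proof (rule square_integrable_bound)
  show "square_integrable M (\<lambda>x. b * f x)" by (intro square_integrable_cmult assms)
  show "AE x in M. \<bar>g x * f x\<bar> \<le> \<bar>b * f x\<bar>"
    using assms(3) by eventually_elim (auto simp: abs_mult intro!: mult_right_mono)
qed (use assms in measurable)

lemma square_integrable_cong_AE: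
  assumes "square_integrable M f" "g \<in> borel_measurable M" "AE x in M. g x = f x"
  shows "square_integrable M g"
  by (rule square_integrable_bound[OF assms(1,2)]) (use assms(3) in auto)

text \<open>Taken over from the inequality for \<open>nn_integral\<close> by passing to absolute
  values; square integrability makes both extended integrals finite, so the estimate survives the
  return to the reals.\<close>

lemma Cauchy_Schwarz_square_integrable:
  assumes f: "square_integrable M f" and g: "square_integrable M g"
  shows "\<bar>\<integral>x. f x * g x \<partial>M\<bar> \<le> sqrt (\<integral>x. (f x)\<^sup>2 \<partial>M) * sqrt (\<integral>x. (g x)\<^sup>2 \<partial>M)"
proof -
  have "ennreal (\<integral>x. \<bar>f x * g x\<bar> \<partial>M) = (\<integral>\<^sup>+x. ennreal \<bar>f x\<bar> * ennreal \<bar>g x\<bar> \<partial>M)"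
    using nn_integral_eq_integral[OF integrable_abs[OF square_integrable_mult[OF f g]]]
    by (simp add: abs_mult ennreal_mult)
  then have "(ennreal (\<integral>x. \<bar>f x * g x\<bar> \<partial>M))\<^sup>2 \<le>
      (\<integral>\<^sup>+x. (ennreal \<bar>f x\<bar>)\<^sup>2 \<partial>M) * (\<integral>\<^sup>+x. (ennreal \<bar>g x\<bar>)\<^sup>2 \<partial>M)"
    using f g Cauchy_Schwarz_nn_integral[of "\<lambda>x. ennreal \<bar>f x\<bar>" M "\<lambda>x. ennreal \<bar>g x\<bar>"]
    by (auto simp: square_integrable_def)
  also have "\<dots> = ennreal ((\<integral>x. (f x)\<^sup>2 \<partial>M) * (\<integral>x. (g x)\<^sup>2 \<partial>M))"
    using nn_integral_square[OF f] nn_integral_square[OF g]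
    by (simp add: ennreal_power ennreal_mult)
  finally have "(\<integral>x. \<bar>f x * g x\<bar> \<partial>M)\<^sup>2 \<le> (\<integral>x. (f x)\<^sup>2 \<partial>M) * (\<integral>x. (g x)\<^sup>2 \<partial>M)"
    by (simp add: ennreal_power ennreal_le_iff)
  then have "(\<integral>x. \<bar>f x * g x\<bar> \<partial>M) \<le> sqrt (\<integral>x. (f x)\<^sup>2 \<partial>M) * sqrt (\<integral>x. (g x)\<^sup>2 \<partial>M)"
    by (metis real_le_rsqrt real_sqrt_mult)
  then show ?thesis
    using integral_abs_bound[of M "\<lambda>x. f x * g x"] by linarith
qed

text \<open>Bilinearity splits the difference of the products into three terms, each small by
  Cauchy-Schwarz. This carries the isometry and the martingale property from simple integrands to
  their limits.\<close>

lemma tendsto_integral_mult_L2: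
  assumes X: "\<And>k. square_integrable M (X k)" "square_integrable M X'"
    and Z: "\<And>k. square_integrable M (Z k)" "square_integrable M Z'"
    and X0: "(\<lambda>k. \<integral>x. (X k x - X' x)\<^sup>2 \<partial>M) \<longlonglongrightarrow> 0"
    and Z0: "(\<lambda>k. \<integral>x. (Z k x - Z' x)\<^sup>2 \<partial>M) \<longlonglongrightarrow> 0"
  shows "(\<lambda>k. \<integral>x. X k x * Z k x \<partial>M) \<longlonglongrightarrow> (\<integral>x. X' x * Z' x \<partial>M)"
proof (rule LIM_zero_cancel, rule Lim_null_comparison)
  let ?n = "\<lambda>f. sqrt (\<integral>x. (f x)\<^sup>2 \<partial>M)"
  let ?B = "\<lambda>k. ?n (\<lambda>x. X k x - X' x) * ?n (\<lambda>x. Z k x - Z' x) + ?n (\<lambda>x. X k x - X' x) * ?n Z'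
      + ?n X' * ?n (\<lambda>x. Z k x - Z' x)"
  note d = square_integrable_diff[OF X(1) X(2)] square_integrable_diff[OF Z(1) Z(2)]
  have eq: "(\<integral>x. X k x * Z k x \<partial>M) - (\<integral>x. X' x * Z' x \<partial>M) =
     (\<integral>x. (X k x - X' x) * (Z k x - Z' x) \<partial>M) + (\<integral>x. (X k x - X' x) * Z' x \<partial>M)
     + (\<integral>x. X' x * (Z k x - Z' x) \<partial>M)" for k
    using square_integrable_mult[OF d(1)[of k] d(2)[of k]] square_integrable_mult[OF d(1)[of k] Z(2)]
      square_integrable_mult[OF X(2) d(2)[of k]] square_integrable_mult[OF X(1)[of k] Z(1)[of k]]
      square_integrable_mult[OF X(2) Z(2)]
    by (simp flip: Bochner_Integration.integral_add Bochner_Integration.integral_diff)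
      (simp add: algebra_simps)
  have "norm ((\<integral>x. X k x * Z k x \<partial>M) - (\<integral>x. X' x * Z' x \<partial>M)) \<le> ?B k" for k
    using Cauchy_Schwarz_square_integrable[OF d(1)[of k] d(2)[of k]]
      Cauchy_Schwarz_square_integrable[OF d(1)[of k] Z(2)]
      Cauchy_Schwarz_square_integrable[OF X(2) d(2)[of k]]
    eq[of k]
    unfolding real_norm_def by linarith
  then show "\<forall>\<^sub>F k in sequentially. norm ((\<integral>x. X k x * Z k x \<partial>M) - (\<integral>x. X' x * Z' x \<partial>M)) \<le> ?B k"
    by auto
  have "?B \<longlonglongrightarrow> sqrt 0 * sqrt 0 + sqrt 0 * ?n Z' + ?n X' * sqrt 0"
    by (intro tendsto_intros X0 Z0)
  then show "?B \<longlonglongrightarrow> 0" by simp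
qed

lemma tendsto_integral_square_nn:
  assumes "\<And>k. square_integrable M (X k)"
    and "(\<lambda>k. \<integral>\<^sup>+x. ennreal ((X k x)\<^sup>2) \<partial>M) \<longlonglongrightarrow> 0"
  shows "(\<lambda>k. \<integral>x. (X k x)\<^sup>2 \<partial>M) \<longlonglongrightarrow> 0"
  using assms(2) unfolding nn_integral_square[OF assms(1)] by (subst (asm) ennreal_tendsto_0_iff) auto

text \<open>\<open>has_ito_integral\<close> demands only measurability of \<open>Y\<close>. A single
  approximant at finite distance already makes \<open>Y\<close> square integrable, and then the
  limit of extended integrals becomes one of real integrals.\<close>

lemma square_integrable_L2_limit:
  assumes X: "\<And>k. square_integrable M (X k)" and Y: "Y \<in> borel_measurable M"
    and lim: "(\<lambda>k. \<integral>\<^sup>+x. ennreal ((X k x - Y x)\<^sup>2) \<partial>M) \<longlonglongrightarrow> 0"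
  shows "square_integrable M Y" "(\<lambda>k. \<integral>x. (X k x - Y x)\<^sup>2 \<partial>M) \<longlonglongrightarrow> 0"
proof -
  have "\<forall>\<^sub>F k in sequentially. (\<integral>\<^sup>+x. ennreal ((X k x - Y x)\<^sup>2) \<partial>M) < 1"
    using order_tendstoD(2)[OF lim] by simp
  then obtain k where "(\<integral>\<^sup>+x. ennreal ((X k x - Y x)\<^sup>2) \<partial>M) < 1"
    by (auto dest: eventually_happens)
  then have "(\<integral>\<^sup>+x. ennreal ((X k x - Y x)\<^sup>2) \<partial>M) < \<infinity>"
    by (rule order.strict_trans) (simp add: less_top[symmetric])
  then have "square_integrable M (\<lambda>x. X k x - Y x)"
    using X[of k] Y by (auto simp: square_integrable_iff_nn)
  from square_integrable_diff[OF X[of k] this] show "square_integrable M Y" by simp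
  then show "(\<lambda>k. \<integral>x. (X k x - Y x)\<^sup>2 \<partial>M) \<longlonglongrightarrow> 0"
    by (intro tendsto_integral_square_nn square_integrable_diff X lim)
qed

lemma bounded_square_integrable:
  assumes "finite_measure N" "f \<in> borel_measurable N" "\<And>x. x \<in> space N \<Longrightarrow> \<bar>f x\<bar> \<le> (b::real)"
  shows "square_integrable N f"
  unfolding square_integrable_def
proof
  interpret N: finite_measure N by fact
  show "integrable N (\<lambda>x. (f x)\<^sup>2)"
  proof (rule N.integrable_const_bound[of _ "b\<^sup>2"])
    show "AE x in N. norm ((f x)\<^sup>2) \<le> b\<^sup>2"
      using order_trans[OF assms(3) abs_ge_self] by (intro AE_I2) (auto simp: abs_le_square_iff[symmetric])
  qed (use assms in auto)
qed fact

lemma integral_sum_sum: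
  fixes f :: "'i \<Rightarrow> 'j \<Rightarrow> 'a \<Rightarrow> real"
  assumes "\<And>i j. i \<in> I \<Longrightarrow> j \<in> J \<Longrightarrow> integrable N (f i j)"
  shows "(\<integral>x. (\<Sum>i\<in>I. \<Sum>j\<in>J. f i j x) \<partial>N) = (\<Sum>i\<in>I. \<Sum>j\<in>J. \<integral>x. f i j x \<partial>N)"
proof -
  have "(\<integral>x. (\<Sum>i\<in>I. \<Sum>j\<in>J. f i j x) \<partial>N) = (\<Sum>i\<in>I. \<integral>x. (\<Sum>j\<in>J. f i j x) \<partial>N)"
    using assms by (intro Bochner_Integration.integral_sum Bochner_Integration.integrable_sum)
  also have "\<dots> = (\<Sum>i\<in>I. \<Sum>j\<in>J. \<integral>x. f i j x \<partial>N)"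
    using assms by (intro sum.cong refl Bochner_Integration.integral_sum)
  finally show ?thesis .
qed

section \<open>Brownian increments and the Ito integral\<close>

locale brownian = prob_space M for M :: "'w measure" +
  fixes B :: "real \<Rightarrow> 'w \<Rightarrow> real"
  assumes bm: "brownian_motion M B"
begin

abbreviation "Filt \<equiv> aug_filtration M B"

section \<open>The augmented filtration and its independence from later increments\<close>

lemma B_measurable [measurable]: "0 \<le> t \<Longrightarrow> B t \<in> borel_measurable M"
  using bm by (simp add: brownian_motion_def)

lemma filtration_generator_subset:
  "{B s -` A \<inter> space M |s A. 0 \<le> s \<and> s \<le> t \<and> A \<in> sets borel} \<union> null_sets M \<subseteq> sets M"
  using B_measurable by (auto dest: measurable_sets)

lemma space_Filt [simp]: "space (Filt t) = space M"
  unfolding aug_filtration_def by (rule space_measure_of_conv)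

lemma sets_Filt:
  "sets (Filt t) = sigma_sets (space M)
     ({B s -` A \<inter> space M |s A. 0 \<le> s \<and> s \<le> t \<and> A \<in> sets borel} \<union> null_sets M)"
  unfolding aug_filtration_def
  by (rule sets_measure_of) (use filtration_generator_subset sets.space_closed in blast)

lemma sets_Filt_subset: "sets (Filt t) \<subseteq> sets M"
  unfolding sets_Filt by (rule sets.sigma_sets_subset[OF filtration_generator_subset])

lemma sets_Filt_mono: "s \<le> t \<Longrightarrow> sets (Filt s) \<subseteq> sets (Filt t)"
  unfolding sets_Filt by (rule sigma_sets_mono') (use order_trans in blast)

lemma Filt_measurable: "f \<in> borel_measurable (Filt t) \<Longrightarrow> f \<in> borel_measurable M"
  using sets_Filt_subset[of t] by (auto simp: measurable_def)

lemma Filt_measurable_mono: "f \<in> borel_measurable (Filt s) \<Longrightarrow> s \<le> t \<Longrightarrow> f \<in> borel_measurable (Filt t)"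
  using sets_Filt_mono[of s t] by (auto simp: measurable_def)

lemma B_adapted: "0 \<le> u \<Longrightarrow> u \<le> s \<Longrightarrow> B u \<in> borel_measurable (Filt s)"
proof (rule measurableI)
  fix A :: "real set" assume "0 \<le> u" "u \<le> s" "A \<in> sets borel"
  then show "B u -` A \<inter> space (Filt s) \<in> sets (Filt s)"
    unfolding sets_Filt space_Filt by (intro sigma_sets.Basic) auto
qed simp

text \<open>The definition of Brownian motion grants independence only for consecutive increments
  along a strictly increasing grid. The cylinder event is therefore rewritten through partial sums
  of increments up to \<open>s\<close>, and \<open>B t - B s\<close> is the next increment.\<close>

lemma cylinder_indep_increment:
  assumes st: "0 \<le> s" "s < t" and J: "finite J" "J \<subseteq> {0..s}"
    and A: "\<And>u. A u \<in> sets borel" and D: "D \<in> sets borel"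
  defines "cyl \<equiv> {\<omega>\<in>space M. \<forall>u\<in>J. B u \<omega> \<in> A u}"
    and "incr \<equiv> (\<lambda>\<omega>. B t \<omega> - B s \<omega>) -` D \<inter> space M"
  shows "prob (cyl \<inter> incr) = prob cyl * prob incr"
proof -
  \<comment> \<open>Adding \<open>0\<close> and \<open>s\<close> makes the partial sums start at
    \<open>B 0\<close>, which is almost surely zero, and makes the increment that follows the grid
    exactly \<open>B t - B s\<close>.\<close>
  define xs where "xs = sorted_list_of_set (J \<union> {0, s})"
  define ys where "ys = xs @ [t]"
  define m where "m = length xs - 1"
  have fin: "finite (J \<union> {0,s})" using J by simp
  have xs: "sorted xs" "distinct xs" "set xs = J \<union> {0,s}"
    unfolding xs_def by (rule sorted_sorted_list_of_set distinct_sorted_list_of_set set_sorted_list_of_set[OF fin])+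
  have xsne: "xs \<noteq> []" using xs(3) by auto
  have len: "length xs = Suc m" using xsne by (simp add: m_def)
  have sxs: "xs ! i < xs ! j" if "i < j" "j < Suc m" for i j
    using xs(1,2) sorted_wrt_nth_less[of "(<)" xs i j] that len by (simp add: strict_sorted_iff)
  have mem: "xs ! i \<in> J \<union> {0,s}" if "i < Suc m" for i
    using nth_mem[of i xs] that unfolding len xs(3) by simp
  have x0: "xs ! 0 = 0"
  proof -
    obtain i where i: "i < Suc m" "xs ! i = 0"
      using xs(3) len by (metis in_set_conv_nth insertI1 UnI2)
    have "0 \<le> xs ! 0" using mem[of 0] J st by auto
    then show ?thesis using i sxs[of 0 i] by (cases i) auto
  qed
  have xm: "xs ! m = s"
  proof -
    obtain i where i: "i < Suc m" "xs ! i = s"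
      using xs(3) len by (metis in_set_conv_nth insertI1 insertI2 UnI2)
    have "xs ! m \<le> s" using mem[of m] J st by auto
    then show ?thesis using i sxs[of i m] by (cases "i = m") auto
  qed
  have ys: "ys ! i = xs ! i" if "i < Suc m" for i
    using that len by (simp add: ys_def nth_append)
  have yt: "ys ! Suc m = t" using len by (simp add: ys_def nth_append)
  have mono: "ys ! j < ys ! Suc j" if "j < Suc m" for j
  proof (cases "j = m")
    case True then show ?thesis using yt ys[of m] xm st by simp
  next
    case False then show ?thesis using ys[of j] ys[of "Suc j"] sxs[of j "Suc j"] that by simp
  qed
  define \<Delta> where "\<Delta> = (\<lambda>j \<omega>. B (ys ! Suc j) \<omega> - B (ys ! j) \<omega>)"
  have "indep_vars (\<lambda>_. borel) \<Delta> {..<Suc m}"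
  proof -
    have "\<forall>(m::nat) \<tau>. 0 \<le> \<tau> 0 \<and> (\<forall>j<m. \<tau> j < \<tau> (Suc j)) \<longrightarrow>
        indep_vars (\<lambda>_. borel) (\<lambda>j \<omega>. B (\<tau> (Suc j)) \<omega> - B (\<tau> j) \<omega>) {..<m}"
      using bm unfolding brownian_motion_def by blast
    from this[rule_format, of "nth ys" "Suc m"] show ?thesis
      using mono x0 ys[of 0] unfolding \<Delta>_def by simp
  qed
  from indep_var_restrict[OF this, of "{..<m}" "{m}"]
  have ind: "indep_var (PiM {..<m} (\<lambda>_. borel)) (\<lambda>\<omega>. \<lambda>i\<in>{..<m}. \<Delta> i \<omega>)
     (PiM {m} (\<lambda>_. borel)) (\<lambda>\<omega>. \<lambda>i\<in>{m}. \<Delta> i \<omega>)"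
    by auto
  have "\<forall>u\<in>J. \<exists>i. i < Suc m \<and> xs ! i = u"
    using xs(3) len by (metis in_set_conv_nth UnI1)
  then obtain idx where idx: "\<And>u. u \<in> J \<Longrightarrow> idx u < Suc m \<and> xs ! (idx u) = u" by metis
  define XA where "XA = {f \<in> space (PiM {..<m} (\<lambda>_. borel)). \<forall>u\<in>J. (\<Sum>j<idx u. f j) \<in> A u}"
  define XB where "XB = {f \<in> space (PiM {m} (\<lambda>_. borel)). f m \<in> D}"
  have XA: "XA \<in> sets (PiM {..<m} (\<lambda>_. borel))"
  proof -
    have "(\<lambda>f. \<Sum>j<idx u. f j) \<in> borel_measurable (PiM {..<m} (\<lambda>_. borel :: real measure))"
      if "u \<in> J" for u
      using idx[OF that] by (intro borel_measurable_sum measurable_component_singleton) auto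
    from measurable_sets[OF this A]
    have "{f \<in> space (PiM {..<m} (\<lambda>_. borel :: real measure)). (\<Sum>j<idx u. f j) \<in> A u}
        \<in> sets (PiM {..<m} (\<lambda>_. borel))" if "u \<in> J" for u
      using that by (simp add: vimage_def Int_def conj_commute)
    then show ?thesis unfolding XA_def using J(1) by (intro sets.sets_Collect_finite_All)
  qed
  have XB: "XB \<in> sets (PiM {m} (\<lambda>_. borel))"
    unfolding XB_def using D by measurable
  have tele: "(\<Sum>j<i. \<Delta> j \<omega>) = B (ys ! i) \<omega> - B 0 \<omega>" for i \<omega>
    using x0 ys[of 0] unfolding \<Delta>_def by (subst sum_lessThan_telescope) simp
  \<comment> \<open>The two events agree only almost surely, because the telescoping sum leaves
    \<open>B 0\<close> behind.\<close>
  have "AE \<omega> in M. B 0 \<omega> = 0" using bm by (simp add: brownian_motion_def)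
  then have ae: "AE \<omega> in M. \<omega> \<in> cyl \<longleftrightarrow> \<omega> \<in> (\<lambda>\<omega>. \<lambda>i\<in>{..<m}. \<Delta> i \<omega>) -` XA \<inter> space M"
  proof eventually_elim
    case (elim \<omega>)
    have "(\<Sum>j<idx u. (\<lambda>i\<in>{..<m}. \<Delta> i \<omega>) j) = B u \<omega>" if "u \<in> J" for u
    proof -
      have "(\<Sum>j<idx u. (\<lambda>i\<in>{..<m}. \<Delta> i \<omega>) j) = (\<Sum>j<idx u. \<Delta> j \<omega>)"
        using idx[OF that] by (intro sum.cong) auto
      then show ?thesis using tele[of \<omega> "idx u"] elim idx[OF that] ys by auto
    qed
    then show ?case by (auto simp: cyl_def XA_def space_PiM)
  qed
  have dm: "\<Delta> m = (\<lambda>\<omega>. B t \<omega> - B s \<omega>)"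
    using yt ys[of m] xm by (simp add: \<Delta>_def)
  have incr: "incr = (\<lambda>\<omega>. \<lambda>i\<in>{m}. \<Delta> i \<omega>) -` XB \<inter> space M"
    by (auto simp: incr_def XB_def space_PiM dm)
  have [measurable]: "cyl \<in> sets M" unfolding cyl_def
    using J(1) J(2) A
    by (intro sets.sets_Collect_finite_All) (auto intro!: measurable_sets_Collect[OF B_measurable])
  have [measurable]: "incr \<in> sets M"
    unfolding incr_def using st by (intro measurable_sets[OF _ D] borel_measurable_diff B_measurable) auto
  have r: "(\<lambda>\<omega>. \<lambda>i\<in>{..<m}. \<Delta> i \<omega>) -` XA \<inter> space M \<in> sets M"
    using indep_var_rv1[OF ind] XA by (rule measurable_sets)
  let ?A' = "(\<lambda>\<omega>. \<lambda>i\<in>{..<m}. \<Delta> i \<omega>) -` XA \<inter> space M"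
  have "prob (cyl \<inter> incr) = prob (?A' \<inter> incr)"
    using ae r by (intro finite_measure_eq_AE) auto
  also have "\<dots> = prob ?A' * prob incr"
  proof -
    have "?A' \<inter> incr = (\<lambda>\<omega>. (\<lambda>i\<in>{..<m}. \<Delta> i \<omega>, \<lambda>i\<in>{m}. \<Delta> i \<omega>)) -` (XA \<times> XB) \<inter> space M"
      unfolding incr by blast
    then show ?thesis unfolding incr using indep_varD[OF ind XA XB] by simp
  qed
  also have "prob ?A' = prob cyl"
    using ae r by (intro finite_measure_eq_AE) auto
  finally show ?thesis .
qed

text \<open>Dynkin's argument: cylinders over finitely many times together with the null sets are
  stable under intersection, which events at a single time are not, and they generate a
  sigma-algebra containing \<open>Filt s\<close>. The null sets are present because the filtration
  is augmented.\<close>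

lemma increment_indep:
  assumes st: "0 \<le> s" "s < t" and Z: "Z \<in> borel_measurable (Filt s)"
  shows "indep_var borel Z borel (\<lambda>\<omega>. B t \<omega> - B s \<omega>)"
proof -
  define P where "P = {{\<omega>\<in>space M. \<forall>u\<in>J. B u \<omega> \<in> A u} |J A.
     finite J \<and> J \<subseteq> {0..s} \<and> (\<forall>u. A u \<in> sets (borel::real measure))}"
  define Q where "Q = {(\<lambda>\<omega>. B t \<omega> - B s \<omega>) -` A \<inter> space M |A. A \<in> sets borel}"
  have Psets: "P \<subseteq> sets M"
    unfolding P_def
    by (auto intro!: sets.sets_Collect_finite_All measurable_sets_Collect[OF B_measurable])
  have Qsets: "Q \<subseteq> sets M" unfolding Q_def using st by auto
  have "indep_set (P \<union> null_sets M) Q"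
    unfolding indep_sets2_eq
  proof (intro conjI ballI)
    fix a b assume a: "a \<in> P \<union> null_sets M" and b: "b \<in> Q"
    show "prob (a \<inter> b) = prob a * prob b"
    proof (cases "a \<in> P")
      case True then show ?thesis using b cylinder_indep_increment[OF st]
        unfolding P_def Q_def by auto
    next
      case False
      then have "a \<in> null_sets M" "a \<inter> b \<in> null_sets M"
        using a b Qsets by (auto intro: null_set_Int2)
      then show ?thesis by (simp add: measure_eq_0_null_sets)
    qed
  qed (use Psets Qsets in auto)
  moreover have "Int_stable (P \<union> null_sets M)"
  proof (rule Int_stableI)
    fix a b assume a: "a \<in> P \<union> null_sets M" and b: "b \<in> P \<union> null_sets M"
    show "a \<inter> b \<in> P \<union> null_sets M"
    proof (cases "a \<in> P \<and> b \<in> P")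
      case True
      then obtain J A J' A' where
        J: "finite J" "J \<subseteq> {0..s}" "\<And>u. A u \<in> sets borel" "a = {\<omega>\<in>space M. \<forall>u\<in>J. B u \<omega> \<in> A u}" and
        J': "finite J'" "J' \<subseteq> {0..s}" "\<And>u. A' u \<in> sets borel" "b = {\<omega>\<in>space M. \<forall>u\<in>J'. B u \<omega> \<in> A' u}"
        unfolding P_def by blast
      have "a \<inter> b = {\<omega>\<in>space M. \<forall>u\<in>J\<union>J'. B u \<omega> \<in>
          (if u \<in> J then A u else UNIV) \<inter> (if u \<in> J' then A' u else UNIV)}"
        unfolding J(4) J'(4) by (auto split: if_splits)
      moreover have "(if u \<in> J then A u else UNIV) \<inter> (if u \<in> J' then A' u else UNIV) \<in> sets borel" for u
        using J(3) J'(3) by auto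
      ultimately have "a \<inter> b \<in> P" unfolding P_def mem_Collect_eq
        using J(1,2) J'(1,2)
        by (intro exI[of _ "J \<union> J'"] exI[of _ "\<lambda>u. (if u \<in> J then A u else UNIV) \<inter> (if u \<in> J' then A' u else UNIV)"])
          auto
      then show ?thesis by simp
    next
      case False
      then show ?thesis using a b Psets null_set_Int1 null_set_Int2 by blast
    qed
  qed
  moreover have "Int_stable Q"
  proof (rule Int_stableI)
    fix a b assume "a \<in> Q" "b \<in> Q"
    then obtain A A' where "A \<in> sets borel" "A' \<in> sets borel"
      "a = (\<lambda>\<omega>. B t \<omega> - B s \<omega>) -` A \<inter> space M" "b = (\<lambda>\<omega>. B t \<omega> - B s \<omega>) -` A' \<inter> space M"
      unfolding Q_def by blast
    then show "a \<inter> b \<in> Q" unfolding Q_def by (auto intro!: exI[of _ "A \<inter> A'"])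
  qed
  ultimately have "indep_set (sigma_sets (space M) (P \<union> null_sets M)) (sigma_sets (space M) Q)"
    by (rule indep_set_sigma_sets)
  moreover have "sigma_sets (space M) {Z -` A \<inter> space M |A. A \<in> sets borel}
      \<subseteq> sigma_sets (space M) (P \<union> null_sets M)"
  proof -
    have "B u -` A \<inter> space M \<in> P" if "0 \<le> u" "u \<le> s" "A \<in> sets borel" for u A
      unfolding P_def mem_Collect_eq using that by (intro exI[of _ "{u}"] exI[of _ "\<lambda>_. A"]) auto
    then have "sets (Filt s) \<subseteq> sigma_sets (space M) (P \<union> null_sets M)"
      unfolding sets_Filt by (intro sigma_sets_mono') auto
    moreover have "Z -` A \<inter> space M \<in> sets (Filt s)" if "A \<in> sets borel" for A
      using measurable_sets[OF Z that] by simp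
    ultimately show ?thesis by (intro sigma_sets_mono) auto
  qed
  ultimately have "indep_set (sigma_sets (space M) {Z -` A \<inter> space M |A. A \<in> sets borel})
      (sigma_sets (space M) Q)"
    unfolding indep_sets2_eq by blast
  then show ?thesis
    unfolding indep_var_eq Q_def using st Filt_measurable[OF Z] by auto
qed

lemma
  assumes st: "0 \<le> s" "s \<le> t"
  shows increment_square_integrable: "square_integrable M (\<lambda>\<omega>. B t \<omega> - B s \<omega>)"
    and increment_mean: "(\<integral>\<omega>. B t \<omega> - B s \<omega> \<partial>M) = 0"
    and increment_variance: "(\<integral>\<omega>. (B t \<omega> - B s \<omega>)\<^sup>2 \<partial>M) = t - s"
proof -
  have "square_integrable M (\<lambda>\<omega>. B t \<omega> - B s \<omega>) \<and> (\<integral>\<omega>. B t \<omega> - B s \<omega> \<partial>M) = 0 \<and>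
    (\<integral>\<omega>. (B t \<omega> - B s \<omega>)\<^sup>2 \<partial>M) = t - s"
  proof (cases "s = t")
    case True then show ?thesis by (simp add: square_integrable_zero)
  next
    case False
    then have lt: "s < t" using st by simp
    then have pos: "0 < sqrt (t - s)" by simp
    have D: "distributed M lborel (\<lambda>\<omega>. B t \<omega> - B s \<omega>) (normal_density 0 (sqrt (t - s)))"
      using bm st lt unfolding brownian_motion_def by blast
    have mean: "(\<integral>\<omega>. B t \<omega> - B s \<omega> \<partial>M) = 0"
      by (rule normal_distributed_expectation[OF pos D])
    moreover have "(\<integral>\<omega>. (B t \<omega> - B s \<omega>)\<^sup>2 \<partial>M) = t - s"
      using normal_distributed_variance[OF pos D] unfolding mean using lt by simp
    moreover have "integrable M (\<lambda>\<omega>. (B t \<omega> - B s \<omega>)\<^sup>2)"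
      using distributed_integrable[OF D, of "\<lambda>x. x\<^sup>2"] integrable_normal_moment[OF pos, of 0 2] by simp
    ultimately show ?thesis using st by (simp add: square_integrable_def)
  qed
  then show "square_integrable M (\<lambda>\<omega>. B t \<omega> - B s \<omega>)" "(\<integral>\<omega>. B t \<omega> - B s \<omega> \<partial>M) = 0"
    "(\<integral>\<omega>. (B t \<omega> - B s \<omega>)\<^sup>2 \<partial>M) = t - s" by auto
qed

lemma square_integrable_integrable: "square_integrable M f \<Longrightarrow> integrable M f"
  using square_integrable_mult[of M f "\<lambda>_. 1"] by (simp add: square_integrable_def)

lemma adapted_times_increment:
  assumes st: "0 \<le> s" "s \<le> t" and Z: "Z \<in> borel_measurable (Filt s)" "square_integrable M Z"
  shows "(\<integral>\<omega>. Z \<omega> * (B t \<omega> - B s \<omega>) \<partial>M) = 0"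
proof (cases "s = t")
  case False
  then show ?thesis
    using indep_var_lebesgue_integral[OF increment_indep[of s t Z] square_integrable_integrable[OF Z(2)]
        square_integrable_integrable[OF increment_square_integrable[OF st]]] st Z increment_mean[OF st]
    by simp
qed simp

lemma adapted_times_increment_square:
  assumes st: "0 \<le> s" "s \<le> t" and Z: "Z \<in> borel_measurable (Filt s)" "integrable M Z"
  shows "(\<integral>\<omega>. Z \<omega> * (B t \<omega> - B s \<omega>)\<^sup>2 \<partial>M) = (\<integral>\<omega>. Z \<omega> \<partial>M) * (t - s)"
proof (cases "s = t")
  case False
  have "indep_var borel ((\<lambda>x. x) \<circ> Z) borel ((\<lambda>x. x\<^sup>2) \<circ> (\<lambda>\<omega>. B t \<omega> - B s \<omega>))"
    using False st Z by (intro indep_var_compose[OF increment_indep]) auto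
  then have "indep_var borel Z borel (\<lambda>\<omega>. (B t \<omega> - B s \<omega>)\<^sup>2)" by (simp add: comp_def)
  from indep_var_lebesgue_integral[OF this Z(2)] show ?thesis
    using increment_square_integrable[OF st] increment_variance[OF st]
    by (simp add: square_integrable_def)
qed simp

section \<open>Time and probability combined in one finite product measure\<close>

abbreviation "Time T \<equiv> restrict_space lborel {0..T::real}"
abbreviation "PT T \<equiv> Time T \<Otimes>\<^sub>M M"

lemma finite_measure_Time: "finite_measure (Time T)"
  by (rule finite_measureI) (simp add: space_restrict_space emeasure_restrict_space emeasure_lborel_Icc_eq)

lemma pair_Time: "pair_sigma_finite (Time T) M"
  using finite_measure_Time[of T] finite_measure_axioms
  by (simp add: pair_sigma_finite_def finite_measure.axioms(1) finite_measure_def)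

lemma finite_measure_PT: "finite_measure (PT T)"
  by (rule finite_measure_pair_measure[OF finite_measure_axioms finite_measure_Time])

lemma bounded_times_increment:
  assumes "0 \<le> a" "a \<le> b" "\<xi> \<in> borel_measurable M" "\<And>\<omega>. \<omega> \<in> space M \<Longrightarrow> \<bar>\<xi> \<omega>\<bar> \<le> k"
  shows "square_integrable M (\<lambda>\<omega>. \<xi> \<omega> * (B b \<omega> - B a \<omega>))"
  using assms by (intro square_integrable_mult_bounded[of _ _ _ k] increment_square_integrable AE_I2)

text \<open>Only the overlap of the two intervals contributes: every other piece contains an
  increment that comes after everything it is multiplied with, so its mean vanishes.\<close>

lemma increment_pair_ordered:
  assumes ab: "0 \<le> a" "a \<le> b" and cd: "a \<le> c" "c \<le> d"
    and \<xi>: "\<xi> \<in> borel_measurable (Filt a)" "\<And>\<omega>. \<omega> \<in> space M \<Longrightarrow> \<bar>\<xi> \<omega>\<bar> \<le> k"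
    and \<eta>: "\<eta> \<in> borel_measurable (Filt c)" "\<And>\<omega>. \<omega> \<in> space M \<Longrightarrow> \<bar>\<eta> \<omega>\<bar> \<le> l"
  shows "(\<integral>\<omega>. (\<xi> \<omega> * (B b \<omega> - B a \<omega>)) * (\<eta> \<omega> * (B d \<omega> - B c \<omega>)) \<partial>M) =
     (\<integral>\<omega>. \<xi> \<omega> * \<eta> \<omega> \<partial>M) * measure lborel ({a<..b} \<inter> {c<..d})"
proof -
  define X where "X = (\<lambda>\<omega>. \<xi> \<omega> * \<eta> \<omega>)"
  have X: "X \<in> borel_measurable (Filt c)"
    unfolding X_def using Filt_measurable_mono[OF \<xi>(1) cd(1)] \<eta>(1) by measurable
  have Xb: "\<bar>X \<omega>\<bar> \<le> k * l" if "\<omega> \<in> space M" for \<omega>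
    using \<xi>(2)[OF that] \<eta>(2)[OF that] unfolding X_def abs_mult by (intro mult_mono) auto
  have XM: "X \<in> borel_measurable M" using Filt_measurable[OF X] .
  have Xs: "square_integrable M X"
    by (rule bounded_square_integrable[OF finite_measure_axioms XM Xb])
  note sq = bounded_times_increment[OF _ _ XM Xb]
  have zero: "integrable M (\<lambda>\<omega>. X \<omega> * (B q \<omega> - B p \<omega>) * (B s \<omega> - B r \<omega>)) \<and>
     (\<integral>\<omega>. X \<omega> * (B q \<omega> - B p \<omega>) * (B s \<omega> - B r \<omega>) \<partial>M) = 0"
    if "0 \<le> p" "p \<le> q" "q \<le> r" "r \<le> s" "c \<le> r" for p q r s
  proof
    show "integrable M (\<lambda>\<omega>. X \<omega> * (B q \<omega> - B p \<omega>) * (B s \<omega> - B r \<omega>))"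
      using that by (intro square_integrable_mult sq increment_square_integrable) auto
    have "(\<lambda>\<omega>. X \<omega> * (B q \<omega> - B p \<omega>)) \<in> borel_measurable (Filt r)"
      using that Filt_measurable_mono[OF X] B_adapted[of q r] B_adapted[of p r] by auto
    then show "(\<integral>\<omega>. X \<omega> * (B q \<omega> - B p \<omega>) * (B s \<omega> - B r \<omega>) \<partial>M) = 0"
      using that by (intro adapted_times_increment sq) auto
  qed
  show ?thesis
  proof (cases "b \<le> c")
    case True
    have "(\<integral>\<omega>. (\<xi> \<omega> * (B b \<omega> - B a \<omega>)) * (\<eta> \<omega> * (B d \<omega> - B c \<omega>)) \<partial>M) =
       (\<integral>\<omega>. X \<omega> * (B b \<omega> - B a \<omega>) * (B d \<omega> - B c \<omega>) \<partial>M)"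
      unfolding X_def by (simp add: mult_ac)
    also have "\<dots> = 0" using zero[of a b c d] ab cd True by simp
    finally have z: "(\<integral>\<omega>. (\<xi> \<omega> * (B b \<omega> - B a \<omega>)) * (\<eta> \<omega> * (B d \<omega> - B c \<omega>)) \<partial>M) = 0" .
    have e: "{a<..b} \<inter> {c<..d} = {}" using True by auto
    show ?thesis unfolding z e by simp
  next
    case False
    define e where "e = min b d"
    have e: "c \<le> e" "e \<le> b" "e \<le> d" and eq: "e = b \<or> e = d" using False cd by (auto simp: e_def)
    have main: "integrable M (\<lambda>\<omega>. X \<omega> * (B e \<omega> - B c \<omega>)\<^sup>2) \<and>
       (\<integral>\<omega>. X \<omega> * (B e \<omega> - B c \<omega>)\<^sup>2 \<partial>M) = (\<integral>\<omega>. X \<omega> \<partial>M) * (e - c)"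
    proof
      show "integrable M (\<lambda>\<omega>. X \<omega> * (B e \<omega> - B c \<omega>)\<^sup>2)"
        using square_integrable_mult[OF sq[of c e] increment_square_integrable[of c e]] ab cd e
        by (simp add: power2_eq_square mult.assoc)
      show "(\<integral>\<omega>. X \<omega> * (B e \<omega> - B c \<omega>)\<^sup>2 \<partial>M) = (\<integral>\<omega>. X \<omega> \<partial>M) * (e - c)"
        using X ab cd e square_integrable_integrable[OF Xs] by (intro adapted_times_increment_square) auto
    qed
    \<comment> \<open>One of the last two products is zero, since \<open>e\<close> is
      \<open>b\<close> or \<open>d\<close>. Writing both treats nested and staggered intervals in
      one formula.\<close>
    have "(\<xi> \<omega> * (B b \<omega> - B a \<omega>)) * (\<eta> \<omega> * (B d \<omega> - B c \<omega>)) =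
       X \<omega> * (B c \<omega> - B a \<omega>) * (B d \<omega> - B c \<omega>) + X \<omega> * (B e \<omega> - B c \<omega>)\<^sup>2
       + X \<omega> * (B e \<omega> - B c \<omega>) * (B d \<omega> - B e \<omega>) + X \<omega> * (B e \<omega> - B c \<omega>) * (B b \<omega> - B e \<omega>)" for \<omega>
      using eq unfolding X_def power2_eq_square by (elim disjE) (simp_all, simp_all add: algebra_simps)
    then have "(\<integral>\<omega>. (\<xi> \<omega> * (B b \<omega> - B a \<omega>)) * (\<eta> \<omega> * (B d \<omega> - B c \<omega>)) \<partial>M) = (\<integral>\<omega>. X \<omega> \<partial>M) * (e - c)"
      using zero[of a c c d] zero[of c e e d] zero[of c e e b] main ab cd e by simp
    moreover have "{a<..b} \<inter> {c<..d} = {c<..e}" using cd by (auto simp: e_def)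
    ultimately show ?thesis using e by (simp only: X_def measure_lborel_Ioc)
  qed
qed

lemma increment_pair:
  assumes "0 \<le> a" "a \<le> b" "0 \<le> c" "c \<le> d"
    and "\<xi> \<in> borel_measurable (Filt a)" "\<And>\<omega>. \<omega> \<in> space M \<Longrightarrow> \<bar>\<xi> \<omega>\<bar> \<le> k"
    and "\<eta> \<in> borel_measurable (Filt c)" "\<And>\<omega>. \<omega> \<in> space M \<Longrightarrow> \<bar>\<eta> \<omega>\<bar> \<le> l"
  shows "(\<integral>\<omega>. (\<xi> \<omega> * (B b \<omega> - B a \<omega>)) * (\<eta> \<omega> * (B d \<omega> - B c \<omega>)) \<partial>M) =
     (\<integral>\<omega>. \<xi> \<omega> * \<eta> \<omega> \<partial>M) * measure lborel ({a<..b} \<inter> {c<..d})"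
proof (cases "a \<le> c")
  case True
  then show ?thesis using assms by (intro increment_pair_ordered[of _ _ _ _ _ k _ l]) auto
next
  case False
  then have "(\<integral>\<omega>. (\<eta> \<omega> * (B d \<omega> - B c \<omega>)) * (\<xi> \<omega> * (B b \<omega> - B a \<omega>)) \<partial>M) =
     (\<integral>\<omega>. \<eta> \<omega> * \<xi> \<omega> \<partial>M) * measure lborel ({c<..d} \<inter> {a<..b})"
    using assms by (intro increment_pair_ordered[of _ _ _ _ _ l _ k]) auto
  then show ?thesis by (simp add: mult.commute Int_commute)
qed

section \<open>The Ito isometry\<close>

lemma simple_integrandD:
  assumes "simple_integrand M Filt t m \<tau> \<xi>"
  shows "j \<le> m \<Longrightarrow> 0 \<le> \<tau> j" "j \<le> m \<Longrightarrow> \<tau> j \<le> t" "j < m \<Longrightarrow> \<tau> j \<le> \<tau> (Suc j)"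
    "j < m \<Longrightarrow> \<xi> j \<in> borel_measurable (Filt (\<tau> j))" "j < m \<Longrightarrow> \<xi> j \<in> borel_measurable M"
proof -
  have mono: "\<tau> i \<le> \<tau> j" if "i \<le> j" "j \<le> m" for i j
    using that by (induction j rule: dec_induct) (use assms in \<open>auto simp: simple_integrand_def intro: order_trans\<close>)
  show "j \<le> m \<Longrightarrow> 0 \<le> \<tau> j" "j \<le> m \<Longrightarrow> \<tau> j \<le> t"
    using mono[of 0 j] mono[of j m] assms by (auto simp: simple_integrand_def)
  show "j < m \<Longrightarrow> \<tau> j \<le> \<tau> (Suc j)" "j < m \<Longrightarrow> \<xi> j \<in> borel_measurable (Filt (\<tau> j))"
    "j < m \<Longrightarrow> \<xi> j \<in> borel_measurable M"
    using assms Filt_measurable by (auto simp: simple_integrand_def)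
qed

lemma simple_integrand_bound:
  assumes "simple_integrand M Filt t m \<tau> \<xi>"
  obtains b where "\<And>j \<omega>. j < m \<Longrightarrow> \<omega> \<in> space M \<Longrightarrow> \<bar>\<xi> j \<omega>\<bar> \<le> b j"
proof -
  have "\<forall>j. \<exists>b. j < m \<longrightarrow> (\<forall>\<omega>\<in>space M. \<bar>\<xi> j \<omega>\<bar> \<le> b)"
    using assms by (auto simp: simple_integrand_def)
  then show ?thesis using that by metis
qed

lemma simple_ito_square_integrable:
  assumes "simple_integrand M Filt t m \<tau> \<xi>"
  shows "square_integrable M (simple_ito B m \<tau> \<xi>)"
proof -
  obtain b where b: "\<And>j \<omega>. j < m \<Longrightarrow> \<omega> \<in> space M \<Longrightarrow> \<bar>\<xi> j \<omega>\<bar> \<le> b j"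
    using simple_integrand_bound[OF assms] by metis
  show ?thesis unfolding simple_ito_def[abs_def]
  proof (rule square_integrable_sum)
    fix j assume "j \<in> {..<m}"
    then show "square_integrable M (\<lambda>\<omega>. \<xi> j \<omega> * (B (\<tau> (Suc j)) \<omega> - B (\<tau> j) \<omega>))"
      using simple_integrandD[OF assms] b by (intro bounded_times_increment[of _ _ _ "b j"]) auto
  qed
qed

lemma simple_process_square_integrable:
  assumes "simple_integrand M Filt t m \<tau> \<xi>"
  shows "square_integrable (PT T) (\<lambda>(s, \<omega>). simple_process m \<tau> \<xi> s \<omega>)"
proof -
  obtain b where b: "\<And>j \<omega>. j < m \<Longrightarrow> \<omega> \<in> space M \<Longrightarrow> \<bar>\<xi> j \<omega>\<bar> \<le> b j"
    using simple_integrand_bound[OF assms] by metis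
  note [measurable] = simple_integrandD(5)[OF assms]
  have "square_integrable (PT T) (\<lambda>x. \<Sum>j<m. \<xi> j (snd x) * indicator {\<tau> j<..\<tau> (Suc j)} (fst x))"
  proof (rule square_integrable_sum, rule bounded_square_integrable[OF finite_measure_PT])
    fix j x assume "j \<in> {..<m}" "x \<in> space (PT T)"
    then show "\<bar>\<xi> j (snd x) * indicator {\<tau> j<..\<tau> (Suc j)} (fst x)\<bar> \<le> b j"
      using b[of j "snd x"] by (auto simp: space_pair_measure indicator_def)
  qed (auto intro!: borel_measurable_times measurable_compose[OF measurable_snd]
         measurable_compose[OF measurable_fst] measurable_restrict_space1)
  then show ?thesis by (simp add: simple_process_def case_prod_unfold)
qed

text \<open>Stated for unrelated partitions, because the approximations of different Ito integrals
  come from separate existence statements. Both sides reduce to the same double sum over pairs of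
  steps, weighted by the length of the overlap.\<close>

lemma simple_ito_isometry:
  assumes S: "simple_integrand M Filt t m \<tau> \<xi>" and S': "simple_integrand M Filt t' m' \<tau>' \<xi>'"
    and tT: "t \<le> T" "t' \<le> T"
  shows "(\<integral>\<omega>. simple_ito B m \<tau> \<xi> \<omega> * simple_ito B m' \<tau>' \<xi>' \<omega> \<partial>M) =
    (\<integral>(s, \<omega>). simple_process m \<tau> \<xi> s \<omega> * simple_process m' \<tau>' \<xi>' s \<omega> \<partial>PT T)"
proof -
  obtain b where b: "\<And>j \<omega>. j < m \<Longrightarrow> \<omega> \<in> space M \<Longrightarrow> \<bar>\<xi> j \<omega>\<bar> \<le> b j"
    using simple_integrand_bound[OF S] by metis
  obtain b' where b': "\<And>j \<omega>. j < m' \<Longrightarrow> \<omega> \<in> space M \<Longrightarrow> \<bar>\<xi>' j \<omega>\<bar> \<le> b' j"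
    using simple_integrand_bound[OF S'] by metis
  note D = simple_integrandD[OF S] and D' = simple_integrandD[OF S']
  note [measurable] = D(5) D'(5)
  interpret P: pair_sigma_finite "Time T" M by (rule pair_Time)
  let ?I = "\<lambda>i j. {\<tau> i<..\<tau> (Suc i)} \<inter> {\<tau>' j<..\<tau>' (Suc j)}"
  let ?c = "\<Sum>i<m. \<Sum>j<m'. (\<integral>\<omega>. \<xi> i \<omega> * \<xi>' j \<omega> \<partial>M) * measure lborel (?I i j)"
  have "(\<integral>\<omega>. simple_ito B m \<tau> \<xi> \<omega> * simple_ito B m' \<tau>' \<xi>' \<omega> \<partial>M) =
    (\<integral>\<omega>. (\<Sum>i<m. \<Sum>j<m'. (\<xi> i \<omega> * (B (\<tau> (Suc i)) \<omega> - B (\<tau> i) \<omega>)) *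
        (\<xi>' j \<omega> * (B (\<tau>' (Suc j)) \<omega> - B (\<tau>' j) \<omega>))) \<partial>M)"
    by (simp add: simple_ito_def sum_product)
  also have "\<dots> = (\<Sum>i<m. \<Sum>j<m'. (\<integral>\<omega>. (\<xi> i \<omega> * (B (\<tau> (Suc i)) \<omega> - B (\<tau> i) \<omega>)) *
        (\<xi>' j \<omega> * (B (\<tau>' (Suc j)) \<omega> - B (\<tau>' j) \<omega>)) \<partial>M))"
  proof -
    have "integrable M (\<lambda>\<omega>. (\<xi> i \<omega> * (B (\<tau> (Suc i)) \<omega> - B (\<tau> i) \<omega>)) *
        (\<xi>' j \<omega> * (B (\<tau>' (Suc j)) \<omega> - B (\<tau>' j) \<omega>)))" if "i < m" "j < m'" for i j
      using that b b' D D'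
      by (intro square_integrable_mult bounded_times_increment[of _ _ _ "b i"] bounded_times_increment[of _ _ _ "b' j"]) auto
    then show ?thesis
      by (intro integral_sum_sum) auto
  qed
  also have "\<dots> = ?c"
    using b b' D D' by (intro sum.cong refl increment_pair[of _ _ _ _ _ "b _" _ "b' _"]) auto
  also have "?c = (\<integral>x. (\<Sum>i<m. \<Sum>j<m'. \<xi> i (snd x) * \<xi>' j (snd x) * indicator (?I i j) (fst x)) \<partial>PT T)"
  proof -
    have *: "integrable (PT T) (\<lambda>x. \<xi> i (snd x) * \<xi>' j (snd x) * indicator (?I i j) (fst x)) \<and>
       (\<integral>x. \<xi> i (snd x) * \<xi>' j (snd x) * indicator (?I i j) (fst x) \<partial>PT T)
        = (\<integral>\<omega>. \<xi> i \<omega> * \<xi>' j \<omega> \<partial>M) * measure lborel (?I i j)" if ij: "i < m" "j < m'" for i j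
    proof
      have [measurable]: "\<xi> i \<in> borel_measurable M" "\<xi>' j \<in> borel_measurable M" using D D' ij by auto
      have [measurable]: "indicator (?I i j) \<in> borel_measurable (Time T)"
        by (intro measurable_restrict_space1) auto
      have fm: "finite_measure (PT T)" by (rule finite_measure_PT)
      show int: "integrable (PT T) (\<lambda>x. \<xi> i (snd x) * \<xi>' j (snd x) * indicator (?I i j) (fst x))"
      proof (rule finite_measure.integrable_const_bound[OF fm, of _ "b i * b' j"])
        show "AE x in PT T. norm (\<xi> i (snd x) * \<xi>' j (snd x) * indicator (?I i j) (fst x)) \<le> b i * b' j"
        proof (rule AE_I2)
          fix x assume "x \<in> space (PT T)"
          then have "snd x \<in> space M" by (auto simp: space_pair_measure)
          from b[OF ij(1) this] b'[OF ij(2) this]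
          have "\<bar>\<xi> i (snd x)\<bar> * \<bar>\<xi>' j (snd x)\<bar> \<le> b i * b' j" by (intro mult_mono) auto
          moreover have "0 \<le> \<bar>\<xi> i (snd x)\<bar> * \<bar>\<xi>' j (snd x)\<bar>" by simp
          ultimately show "norm (\<xi> i (snd x) * \<xi>' j (snd x) * indicator (?I i j) (fst x)) \<le> b i * b' j"
            unfolding norm_mult real_norm_def indicator_def by (auto simp del: mult_nonneg_nonneg)
        qed
      qed measurable
      have sub: "?I i j \<subseteq> {0..T}"
        using D(1)[of i] D(2)[of "Suc i"] ij tT by auto
      have "(\<integral>x. \<xi> i (snd x) * \<xi>' j (snd x) * indicator (?I i j) (fst x) \<partial>PT T) =
        (\<integral>s. (\<integral>\<omega>. \<xi> i \<omega> * \<xi>' j \<omega> * indicator (?I i j) s \<partial>M) \<partial>Time T)"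
        using P.integral_fst'[OF int] by simp
      also have "\<dots> = (\<integral>s. (\<integral>\<omega>. \<xi> i \<omega> * \<xi>' j \<omega> \<partial>M) * indicator (?I i j) s \<partial>Time T)"
        by simp
      also have "\<dots> = (\<integral>\<omega>. \<xi> i \<omega> * \<xi>' j \<omega> \<partial>M) * measure (Time T) (?I i j)"
      proof -
        have "?I i j \<inter> space (Time T) = ?I i j" using sub by (auto simp: space_restrict_space)
        then show ?thesis by simp
      qed
      also have "measure (Time T) (?I i j) = measure lborel (?I i j)"
        using sub by (intro measure_restrict_space) auto
      finally show "(\<integral>x. \<xi> i (snd x) * \<xi>' j (snd x) * indicator (?I i j) (fst x) \<partial>PT T)
        = (\<integral>\<omega>. \<xi> i \<omega> * \<xi>' j \<omega> \<partial>M) * measure lborel (?I i j)" .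
    qed
    have "(\<integral>x. (\<Sum>i<m. \<Sum>j<m'. \<xi> i (snd x) * \<xi>' j (snd x) * indicator (?I i j) (fst x)) \<partial>PT T) =
      (\<Sum>i<m. \<Sum>j<m'. (\<integral>x. \<xi> i (snd x) * \<xi>' j (snd x) * indicator (?I i j) (fst x) \<partial>PT T))"
      by (rule integral_sum_sum) (use * in blast)
    also have "\<dots> = ?c"
      by (intro sum.cong refl) (use * in blast)
    finally show ?thesis by (rule sym)
  qed
  also have "\<dots> = (\<integral>(s, \<omega>). simple_process m \<tau> \<xi> s \<omega> * simple_process m' \<tau>' \<xi>' s \<omega> \<partial>PT T)"
    by (simp only: case_prod_unfold simple_process_def sum_product indicator_inter_arith mult_ac)
  finally show ?thesis .
qed

text \<open>The norms of the statement are iterated integrals with \<open>\<omega>\<close> outside;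
  Tonelli turns them into integrals over \<open>PT T\<close>, where the L^2 lemmas apply.\<close>

lemma nn_integral_PT:
  fixes F :: "real \<Rightarrow> 'w \<Rightarrow> ennreal"
  assumes "(\<lambda>(s, \<omega>). F s \<omega>) \<in> borel_measurable (PT T)"
  shows "(\<integral>\<^sup>+\<omega>. (\<integral>\<^sup>+s\<in>{0..T}. F s \<omega> \<partial>lborel) \<partial>M) = (\<integral>\<^sup>+(s, \<omega>). F s \<omega> \<partial>PT T)"
proof -
  interpret P: pair_sigma_finite "Time T" M by (rule pair_Time)
  show ?thesis
    using P.nn_integral_snd[OF assms] by (simp add: nn_integral_restrict_space)
qed

lemma PT_measurable_mono:
  assumes "f \<in> borel_measurable (PT T)" "t \<le> T" shows "f \<in> borel_measurable (PT t)"
proof -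
  have "(\<lambda>x. x) \<in> Time t \<rightarrow>\<^sub>M Time T"
    using assms(2) by (intro measurable_restrict_space2 measurable_restrict_space1)
      (auto simp: space_restrict_space)
  then have "(\<lambda>x. (fst x, snd x)) \<in> PT t \<rightarrow>\<^sub>M PT T"
    by (intro measurable_Pair measurable_compose[OF measurable_fst] measurable_snd)
  from measurable_compose[OF this assms(1)] show ?thesis by simp
qed

lemma PT_nn_integral_mono:
  fixes F :: "real \<Rightarrow> 'w \<Rightarrow> ennreal"
  assumes "(\<lambda>(s, \<omega>). F s \<omega>) \<in> borel_measurable (PT T)" "t \<le> T"
  shows "(\<integral>\<^sup>+(s, \<omega>). F s \<omega> \<partial>PT t) \<le> (\<integral>\<^sup>+(s, \<omega>). F s \<omega> \<partial>PT T)"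
  unfolding nn_integral_PT[OF assms(1), symmetric] nn_integral_PT[OF PT_measurable_mono[OF assms], symmetric]
  using assms(2) by (intro nn_integral_mono) (auto simp: indicator_def)

lemma square_integrable_PT_mono:
  assumes "square_integrable (PT T) (\<lambda>(s, \<omega>). f s \<omega>)" "t \<le> T"
  shows "square_integrable (PT t) (\<lambda>(s, \<omega>). f s \<omega>)"
  unfolding square_integrable_iff_nn
proof
  have m: "(\<lambda>(s, \<omega>). f s \<omega>) \<in> borel_measurable (PT T)" by (rule square_integrableD[OF assms(1)])
  then show "(\<lambda>(s, \<omega>). f s \<omega>) \<in> borel_measurable (PT t)" using assms(2) by (rule PT_measurable_mono)
  have "(\<lambda>(s, \<omega>). ennreal ((f s \<omega>)\<^sup>2)) \<in> borel_measurable (PT T)"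
    using m unfolding case_prod_unfold by measurable
  from PT_nn_integral_mono[OF this assms(2)]
  show "(\<integral>\<^sup>+x. ennreal ((case x of (s, \<omega>) \<Rightarrow> f s \<omega>)\<^sup>2) \<partial>PT t) < \<infinity>"
    using assms(1) unfolding square_integrable_iff_nn case_prod_unfold by (auto elim: order_le_less_trans)
qed

lemma PT_integral_square_mono:
  assumes "square_integrable (PT T) (\<lambda>(s, \<omega>). f s \<omega>)" "t \<le> T"
  shows "(\<integral>(s, \<omega>). (f s \<omega>)\<^sup>2 \<partial>PT t) \<le> (\<integral>(s, \<omega>). (f s \<omega>)\<^sup>2 \<partial>PT T)"
  using PT_nn_integral_mono[of "\<lambda>s \<omega>. ennreal ((f s \<omega>)\<^sup>2)" T t] assms
    nn_integral_square[OF assms(1)] nn_integral_square[OF square_integrable_PT_mono[OF assms]]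
    square_integrableD[OF assms(1)]
  by (simp add: case_prod_unfold)

lemma has_ito_integral_approx:
  assumes "has_ito_integral M Filt B t f Y" "square_integrable (PT t) (\<lambda>(s, \<omega>). f s \<omega>)"
  shows "\<exists>m \<tau> \<xi>. (\<forall>k::nat. simple_integrand M Filt t (m k) (\<tau> k) (\<xi> k)) \<and>
    (\<lambda>k. \<integral>(s, \<omega>). (simple_process (m k) (\<tau> k) (\<xi> k) s \<omega> - f s \<omega>)\<^sup>2 \<partial>PT t) \<longlonglongrightarrow> 0 \<and>
    (\<lambda>k. \<integral>\<omega>. (simple_ito B (m k) (\<tau> k) (\<xi> k) \<omega> - Y \<omega>)\<^sup>2 \<partial>M) \<longlonglongrightarrow> 0 \<and>
    square_integrable M Y"
proof -
  obtain m \<tau> \<xi> where Y: "Y \<in> borel_measurable M"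
    and S: "\<And>k::nat. simple_integrand M Filt t (m k) (\<tau> k) (\<xi> k)"
    and f0: "(\<lambda>k. \<integral>\<^sup>+\<omega>. (\<integral>\<^sup>+s\<in>{0..t}. ennreal ((simple_process (m k) (\<tau> k) (\<xi> k) s \<omega> - f s \<omega>)\<^sup>2) \<partial>lborel) \<partial>M)
          \<longlonglongrightarrow> 0"
    and Y0: "(\<lambda>k. \<integral>\<^sup>+\<omega>. ennreal ((simple_ito B (m k) (\<tau> k) (\<xi> k) \<omega> - Y \<omega>)\<^sup>2) \<partial>M) \<longlonglongrightarrow> 0"
    using assms(1) unfolding has_ito_integral_def by blast
  have sq: "square_integrable (PT t) (\<lambda>x. simple_process (m k) (\<tau> k) (\<xi> k) (fst x) (snd x) - f (fst x) (snd x))" for k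
    using square_integrable_diff[OF simple_process_square_integrable[OF S[of k], of t] assms(2)]
    by (simp add: case_prod_unfold)
  have "(\<integral>\<^sup>+\<omega>. (\<integral>\<^sup>+s\<in>{0..t}. ennreal ((simple_process (m k) (\<tau> k) (\<xi> k) s \<omega> - f s \<omega>)\<^sup>2) \<partial>lborel) \<partial>M)
      = (\<integral>\<^sup>+x. ennreal ((simple_process (m k) (\<tau> k) (\<xi> k) (fst x) (snd x) - f (fst x) (snd x))\<^sup>2) \<partial>PT t)" for k
    by (subst nn_integral_PT) (use square_integrableD[OF sq[of k]] in \<open>auto simp: case_prod_unfold\<close>)
  with f0 have "(\<lambda>k. \<integral>x. (simple_process (m k) (\<tau> k) (\<xi> k) (fst x) (snd x) - f (fst x) (snd x))\<^sup>2 \<partial>PT t) \<longlonglongrightarrow> 0"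
    by (intro tendsto_integral_square_nn sq) simp
  then show ?thesis
    using S square_integrable_L2_limit[OF simple_ito_square_integrable[OF S] Y Y0]
    by (intro exI[of _ m] exI[of _ \<tau>] exI[of _ \<xi>]) (simp add: case_prod_unfold)
qed

lemma ito_square_integrable:
  assumes "has_ito_integral M Filt B t f Y" "square_integrable (PT t) (\<lambda>(s, \<omega>). f s \<omega>)"
  shows "square_integrable M Y"
  using has_ito_integral_approx[OF assms] by blast

text \<open>The polarized form is needed because martingale parts at two different mesh points get
  multiplied.\<close>

lemma ito_isometry:
  assumes f: "has_ito_integral M Filt B t f Y" "square_integrable (PT t) (\<lambda>(s, \<omega>). f s \<omega>)"
    and f': "has_ito_integral M Filt B t f' Y'" "square_integrable (PT t) (\<lambda>(s, \<omega>). f' s \<omega>)"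
  shows "(\<integral>\<omega>. Y \<omega> * Y' \<omega> \<partial>M) = (\<integral>(s, \<omega>). f s \<omega> * f' s \<omega> \<partial>PT t)"
proof -
  obtain m \<tau> \<xi> where S: "\<And>k::nat. simple_integrand M Filt t (m k) (\<tau> k) (\<xi> k)"
    "(\<lambda>k. \<integral>(s, \<omega>). (simple_process (m k) (\<tau> k) (\<xi> k) s \<omega> - f s \<omega>)\<^sup>2 \<partial>PT t) \<longlonglongrightarrow> 0"
    "(\<lambda>k. \<integral>\<omega>. (simple_ito B (m k) (\<tau> k) (\<xi> k) \<omega> - Y \<omega>)\<^sup>2 \<partial>M) \<longlonglongrightarrow> 0"
    "square_integrable M Y"
    using has_ito_integral_approx[OF f] by blast
  obtain m' \<tau>' \<xi>' where S': "\<And>k::nat. simple_integrand M Filt t (m' k) (\<tau>' k) (\<xi>' k)"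
    "(\<lambda>k. \<integral>(s, \<omega>). (simple_process (m' k) (\<tau>' k) (\<xi>' k) s \<omega> - f' s \<omega>)\<^sup>2 \<partial>PT t) \<longlonglongrightarrow> 0"
    "(\<lambda>k. \<integral>\<omega>. (simple_ito B (m' k) (\<tau>' k) (\<xi>' k) \<omega> - Y' \<omega>)\<^sup>2 \<partial>M) \<longlonglongrightarrow> 0"
    "square_integrable M Y'"
    using has_ito_integral_approx[OF f'] by blast
  let ?I = "\<lambda>k. \<integral>\<omega>. simple_ito B (m k) (\<tau> k) (\<xi> k) \<omega> * simple_ito B (m' k) (\<tau>' k) (\<xi>' k) \<omega> \<partial>M"
  have "?I \<longlonglongrightarrow> (\<integral>\<omega>. Y \<omega> * Y' \<omega> \<partial>M)"
    by (intro tendsto_integral_mult_L2 simple_ito_square_integrable[OF S(1)]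
        simple_ito_square_integrable[OF S'(1)] S S')
  moreover have "?I \<longlonglongrightarrow> (\<integral>(s, \<omega>). f s \<omega> * f' s \<omega> \<partial>PT t)"
    using tendsto_integral_mult_L2[OF simple_process_square_integrable[OF S(1), of t] f(2)
        simple_process_square_integrable[OF S'(1), of t] f'(2)] S(2) S'(2)
    unfolding simple_ito_isometry[OF S(1) S'(1) order_refl order_refl] case_prod_unfold by simp
  ultimately show ?thesis by (rule LIMSEQ_unique)
qed

section \<open>The martingale property of the Ito integral\<close>

text \<open>Steps that start at \<open>t\<close> or later are set to zero and not merely cut off: their values need not be
  measurable at time \<open>t\<close>.\<close>

definition trunc_val :: "real \<Rightarrow> (nat \<Rightarrow> real) \<Rightarrow> (nat \<Rightarrow> 'w \<Rightarrow> real) \<Rightarrow> nat \<Rightarrow> 'w \<Rightarrow> real" where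
  "trunc_val t \<tau> \<xi> j = (if \<tau> j < t then \<xi> j else (\<lambda>_. 0))"

lemma truncate_simple_integrand:
  assumes S: "simple_integrand M Filt T m \<tau> \<xi>" and t: "0 \<le> t" "t \<le> T"
  shows "simple_integrand M Filt t m (\<lambda>j. min (\<tau> j) t) (trunc_val t \<tau> \<xi>)"
  using assms unfolding simple_integrand_def trunc_val_def
  by (auto simp: min_def intro!: exI[of _ 0])

lemma truncate_simple_process:
  assumes "s \<le> t"
  shows "simple_process m (\<lambda>j. min (\<tau> j) t) (trunc_val t \<tau> \<xi>) s \<omega> = simple_process m \<tau> \<xi> s \<omega>"
  using assms unfolding simple_process_def trunc_val_def
  by (intro sum.cong) (auto simp: indicator_def min_def)

text \<open>Whatever the integral accumulates after \<open>t\<close> is a sum of increments with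
  coefficients known at their start, hence orthogonal to \<open>Z\<close>. A step that straddles
  \<open>t\<close> is split there.\<close>

lemma truncate_simple_ito:
  assumes S: "simple_integrand M Filt T m \<tau> \<xi>" and t: "0 \<le> t" "t \<le> T"
    and Z: "Z \<in> borel_measurable (Filt t)" "square_integrable M Z"
  shows "(\<integral>\<omega>. simple_ito B m \<tau> \<xi> \<omega> * Z \<omega> \<partial>M) =
    (\<integral>\<omega>. simple_ito B m (\<lambda>j. min (\<tau> j) t) (trunc_val t \<tau> \<xi>) \<omega> * Z \<omega> \<partial>M)"
proof -
  note D = simple_integrandD[OF S]
  note D' = simple_integrandD[OF truncate_simple_integrand[OF S t]]
  obtain b where b: "\<And>j \<omega>. j < m \<Longrightarrow> \<omega> \<in> space M \<Longrightarrow> \<bar>\<xi> j \<omega>\<bar> \<le> b j"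
    using simple_integrand_bound[OF S] by metis
  obtain b' where b': "\<And>j \<omega>. j < m \<Longrightarrow> \<omega> \<in> space M \<Longrightarrow> \<bar>trunc_val t \<tau> \<xi> j \<omega>\<bar> \<le> b' j"
    using simple_integrand_bound[OF truncate_simple_integrand[OF S t]] by metis
  let ?t = "\<lambda>j. min (\<tau> j) t" and ?x = "trunc_val t \<tau> \<xi>"
  have int: "integrable M (\<lambda>\<omega>. \<xi> j \<omega> * (B (\<tau> (Suc j)) \<omega> - B (\<tau> j) \<omega>) * Z \<omega>)" if "j < m" for j
    using that D b by (intro square_integrable_mult Z bounded_times_increment[of _ _ _ "b j"]) auto
  have int': "integrable M (\<lambda>\<omega>. ?x j \<omega> * (B (?t (Suc j)) \<omega> - B (?t j) \<omega>) * Z \<omega>)" if "j < m" for j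
    by (intro square_integrable_mult Z bounded_times_increment[of _ _ _ "b' j"])
      (use that D'(1,3,5) b' in auto)
  have zero: "(\<integral>\<omega>. \<xi> j \<omega> * Z \<omega> * (B v \<omega> - B u \<omega>) \<partial>M) = 0 \<and>
      integrable M (\<lambda>\<omega>. \<xi> j \<omega> * Z \<omega> * (B v \<omega> - B u \<omega>))"
    if "j < m" "\<tau> j \<le> u" "t \<le> u" "u \<le> v" for j u v
  proof -
    have sq: "square_integrable M (\<lambda>\<omega>. \<xi> j \<omega> * Z \<omega>)"
      using D b that by (intro square_integrable_mult_bounded[of _ _ _ "b j"] Z AE_I2) auto
    have "(\<lambda>\<omega>. \<xi> j \<omega> * Z \<omega>) \<in> borel_measurable (Filt u)"
      using Filt_measurable_mono[OF D(4)[OF that(1)] that(2)] Filt_measurable_mono[OF Z(1) that(3)] by auto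
    then show ?thesis using sq that t
      by (intro conjI adapted_times_increment square_integrable_mult increment_square_integrable) auto
  qed
  have "(\<integral>\<omega>. \<xi> j \<omega> * (B (\<tau> (Suc j)) \<omega> - B (\<tau> j) \<omega>) * Z \<omega> \<partial>M) =
     (\<integral>\<omega>. ?x j \<omega> * (B (?t (Suc j)) \<omega> - B (?t j) \<omega>) * Z \<omega> \<partial>M)" if j: "j < m" for j
  proof -
    consider "\<tau> (Suc j) \<le> t" | "\<tau> j < t" "t < \<tau> (Suc j)" | "t \<le> \<tau> j"
      by linarith
    then show ?thesis
    proof cases
      case 1
      with D(3)[OF j] have "\<tau> j \<le> t" by simp
      show ?thesis
      proof (cases "\<tau> j < t")
        case True then show ?thesis using 1 by (simp add: trunc_val_def)
      next
        case False
        \<comment> \<open>A step of length zero at \<open>t\<close> loses its value under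
          \<open>trunc_val\<close>, but its increment vanishes on both sides.\<close>
        then have "\<tau> j = t" "\<tau> (Suc j) = t" using \<open>\<tau> j \<le> t\<close> 1 D(3)[OF j] by auto
        then show ?thesis by simp
      qed
    next
      case 2
      have "\<xi> j \<omega> * (B (\<tau> (Suc j)) \<omega> - B (\<tau> j) \<omega>) * Z \<omega> =
         ?x j \<omega> * (B (?t (Suc j)) \<omega> - B (?t j) \<omega>) * Z \<omega> + \<xi> j \<omega> * Z \<omega> * (B (\<tau> (Suc j)) \<omega> - B t \<omega>)" for \<omega>
        using 2 by (simp add: trunc_val_def algebra_simps)
      then show ?thesis using zero[OF j, of t "\<tau> (Suc j)"] 2 int'[OF j] by simp
    next
      case 3
      then have "(\<integral>\<omega>. \<xi> j \<omega> * (B (\<tau> (Suc j)) \<omega> - B (\<tau> j) \<omega>) * Z \<omega> \<partial>M) = 0"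
        using zero[OF j, of "\<tau> j" "\<tau> (Suc j)"] D(3)[OF j] by (simp add: mult_ac)
      then show ?thesis using 3 by (simp add: trunc_val_def)
    qed
  qed
  then show ?thesis unfolding simple_ito_def sum_distrib_right
    using int int' by (simp add: Bochner_Integration.integral_sum)
qed

text \<open>\<open>Y\<close> and \<open>Y'\<close> come with unrelated approximating sequences.
  Truncating the one for \<open>Y\<close> at \<open>t\<close> gives another approximation of
  \<open>f\<close> on \<open>[0,t]\<close>, and the isometry shows that its integrals and those
  leading to \<open>Y'\<close> merge in L^2. Testing against \<open>Z\<close> takes the place of
  conditional expectations.\<close>

lemma ito_martingale:
  assumes t: "0 \<le> t" "t \<le> T" and f: "square_integrable (PT T) (\<lambda>(s, \<omega>). f s \<omega>)"
    and Y: "has_ito_integral M Filt B T f Y" and Y': "has_ito_integral M Filt B t f Y'"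
    and Z: "Z \<in> borel_measurable (Filt t)" "square_integrable M Z"
  shows "(\<integral>\<omega>. Y \<omega> * Z \<omega> \<partial>M) = (\<integral>\<omega>. Y' \<omega> * Z \<omega> \<partial>M)"
proof -
  note ft = square_integrable_PT_mono[OF f t(2)]
  obtain m \<tau> \<xi> where S: "\<And>k::nat. simple_integrand M Filt T (m k) (\<tau> k) (\<xi> k)"
    "(\<lambda>k. \<integral>(s, \<omega>). (simple_process (m k) (\<tau> k) (\<xi> k) s \<omega> - f s \<omega>)\<^sup>2 \<partial>PT T) \<longlonglongrightarrow> 0"
    "(\<lambda>k. \<integral>\<omega>. (simple_ito B (m k) (\<tau> k) (\<xi> k) \<omega> - Y \<omega>)\<^sup>2 \<partial>M) \<longlonglongrightarrow> 0"
    "square_integrable M Y"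
    using has_ito_integral_approx[OF Y f] by blast
  obtain m' \<tau>' \<xi>' where S': "\<And>k::nat. simple_integrand M Filt t (m' k) (\<tau>' k) (\<xi>' k)"
    "(\<lambda>k. \<integral>(s, \<omega>). (simple_process (m' k) (\<tau>' k) (\<xi>' k) s \<omega> - f s \<omega>)\<^sup>2 \<partial>PT t) \<longlonglongrightarrow> 0"
    "(\<lambda>k. \<integral>\<omega>. (simple_ito B (m' k) (\<tau>' k) (\<xi>' k) \<omega> - Y' \<omega>)\<^sup>2 \<partial>M) \<longlonglongrightarrow> 0"
    "square_integrable M Y'"
    using has_ito_integral_approx[OF Y' ft] by blast
  define \<sigma> where "\<sigma> = (\<lambda>k j. min (\<tau> k j) t)"
  define \<eta> where "\<eta> = (\<lambda>k. trunc_val t (\<tau> k) (\<xi> k))"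
  have R: "simple_integrand M Filt t (m k) (\<sigma> k) (\<eta> k)" for k
    unfolding \<sigma>_def \<eta>_def by (rule truncate_simple_integrand[OF S(1) t])
  have R0: "(\<lambda>k. \<integral>(s, \<omega>). (simple_process (m k) (\<sigma> k) (\<eta> k) s \<omega> - f s \<omega>)\<^sup>2 \<partial>PT t) \<longlonglongrightarrow> 0"
  proof (rule tendsto_sandwich[OF _ _ tendsto_const S(2)])
    have "(\<integral>(s, \<omega>). (simple_process (m k) (\<sigma> k) (\<eta> k) s \<omega> - f s \<omega>)\<^sup>2 \<partial>PT t) =
        (\<integral>(s, \<omega>). (simple_process (m k) (\<tau> k) (\<xi> k) s \<omega> - f s \<omega>)\<^sup>2 \<partial>PT t)" for k
      by (intro Bochner_Integration.integral_cong refl)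
        (auto simp: \<sigma>_def \<eta>_def truncate_simple_process space_pair_measure space_restrict_space)
    moreover have "(\<integral>(s, \<omega>). (simple_process (m k) (\<tau> k) (\<xi> k) s \<omega> - f s \<omega>)\<^sup>2 \<partial>PT t) \<le>
        (\<integral>(s, \<omega>). (simple_process (m k) (\<tau> k) (\<xi> k) s \<omega> - f s \<omega>)\<^sup>2 \<partial>PT T)" for k
      using square_integrable_diff[OF simple_process_square_integrable[OF S(1)[of k], of T] f] t
      by (intro PT_integral_square_mono) (simp_all add: case_prod_unfold)
    ultimately show "\<forall>\<^sub>F k in sequentially. (\<integral>(s, \<omega>). (simple_process (m k) (\<sigma> k) (\<eta> k) s \<omega> - f s \<omega>)\<^sup>2 \<partial>PT t)
      \<le> (\<integral>(s, \<omega>). (simple_process (m k) (\<tau> k) (\<xi> k) s \<omega> - f s \<omega>)\<^sup>2 \<partial>PT T)" by auto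
  qed (auto intro!: always_eventually Bochner_Integration.integral_nonneg simp: case_prod_unfold)
  let ?R = "\<lambda>k. simple_ito B (m k) (\<sigma> k) (\<eta> k)" and ?S' = "\<lambda>k. simple_ito B (m' k) (\<tau>' k) (\<xi>' k)"
  note sR = simple_ito_square_integrable[OF R] and sS' = simple_ito_square_integrable[OF S'(1)]
  note pR = simple_process_square_integrable[OF R, of t]
    and pS' = simple_process_square_integrable[OF S'(1), of t]
  let ?ff = "\<integral>x. f (fst x) (snd x) * f (fst x) (snd x) \<partial>PT t"
  have l1: "(\<lambda>k. \<integral>\<omega>. ?R k \<omega> * ?R k \<omega> \<partial>M) \<longlonglongrightarrow> ?ff"
    unfolding simple_ito_isometry[OF R R order_refl order_refl]
    using tendsto_integral_mult_L2[OF pR ft pR ft] R0 by (simp add: case_prod_unfold)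
  have l2: "(\<lambda>k. \<integral>\<omega>. ?R k \<omega> * ?S' k \<omega> \<partial>M) \<longlonglongrightarrow> ?ff"
    unfolding simple_ito_isometry[OF R S'(1) order_refl order_refl]
    using tendsto_integral_mult_L2[OF pR ft pS' ft] R0 S'(2) by (simp add: case_prod_unfold)
  have l3: "(\<lambda>k. \<integral>\<omega>. ?S' k \<omega> * ?S' k \<omega> \<partial>M) \<longlonglongrightarrow> ?ff"
    unfolding simple_ito_isometry[OF S'(1) S'(1) order_refl order_refl]
    using tendsto_integral_mult_L2[OF pS' ft pS' ft] S'(2) by (simp add: case_prod_unfold)
  \<comment> \<open>The subtracted zero is the limit function in the shape that
    \<open>tendsto_integral_mult_L2\<close> expects.\<close>
  have expand: "(x - y - 0)\<^sup>2 = x * x - 2 * (x * y) + y * y" for x y :: real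
    by (simp add: power2_eq_square algebra_simps)
  have "(\<integral>\<omega>. (?R k \<omega> - ?S' k \<omega> - 0)\<^sup>2 \<partial>M) = (\<integral>\<omega>. ?R k \<omega> * ?R k \<omega> \<partial>M)
      - 2 * (\<integral>\<omega>. ?R k \<omega> * ?S' k \<omega> \<partial>M) + (\<integral>\<omega>. ?S' k \<omega> * ?S' k \<omega> \<partial>M)" for k
    using square_integrable_mult[OF sR[of k] sR[of k]] square_integrable_mult[OF sR[of k] sS'[of k]]
      square_integrable_mult[OF sS'[of k] sS'[of k]]
    unfolding expand by simp
  moreover have "(\<lambda>k. (\<integral>\<omega>. ?R k \<omega> * ?R k \<omega> \<partial>M)
      - 2 * (\<integral>\<omega>. ?R k \<omega> * ?S' k \<omega> \<partial>M) + (\<integral>\<omega>. ?S' k \<omega> * ?S' k \<omega> \<partial>M)) \<longlonglongrightarrow> ?ff - 2 * ?ff + ?ff"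
    by (intro tendsto_intros l1 l2 l3)
  ultimately have "(\<lambda>k. \<integral>\<omega>. (?R k \<omega> - ?S' k \<omega> - 0)\<^sup>2 \<partial>M) \<longlonglongrightarrow> 0" by simp
  from tendsto_integral_mult_L2[OF square_integrable_diff[OF sR sS'] square_integrable_zero Z(2) Z(2) this]
  have "(\<lambda>k. \<integral>\<omega>. (?R k \<omega> - ?S' k \<omega>) * Z \<omega> \<partial>M) \<longlonglongrightarrow> 0" by simp
  moreover have "(\<lambda>k. \<integral>\<omega>. ?S' k \<omega> * Z \<omega> \<partial>M) \<longlonglongrightarrow> (\<integral>\<omega>. Y' \<omega> * Z \<omega> \<partial>M)"
    using tendsto_integral_mult_L2[OF sS' S'(4) Z(2) Z(2) S'(3)] by simp
  ultimately have "(\<lambda>k. (\<integral>\<omega>. (?R k \<omega> - ?S' k \<omega>) * Z \<omega> \<partial>M) + (\<integral>\<omega>. ?S' k \<omega> * Z \<omega> \<partial>M))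
      \<longlonglongrightarrow> 0 + (\<integral>\<omega>. Y' \<omega> * Z \<omega> \<partial>M)"
    by (rule tendsto_add)
  moreover have "(\<integral>\<omega>. (?R k \<omega> - ?S' k \<omega>) * Z \<omega> \<partial>M) + (\<integral>\<omega>. ?S' k \<omega> * Z \<omega> \<partial>M)
      = (\<integral>\<omega>. simple_ito B (m k) (\<tau> k) (\<xi> k) \<omega> * Z \<omega> \<partial>M)" for k
    unfolding truncate_simple_ito[OF S(1) t Z]
    using square_integrable_mult[OF sR[of k] Z(2)] square_integrable_mult[OF sS'[of k] Z(2)]
    by (simp add: left_diff_distrib \<sigma>_def \<eta>_def)
  ultimately have "(\<lambda>k. \<integral>\<omega>. simple_ito B (m k) (\<tau> k) (\<xi> k) \<omega> * Z \<omega> \<partial>M) \<longlonglongrightarrow> (\<integral>\<omega>. Y' \<omega> * Z \<omega> \<partial>M)"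
    by simp
  moreover have "(\<lambda>k. \<integral>\<omega>. simple_ito B (m k) (\<tau> k) (\<xi> k) \<omega> * Z \<omega> \<partial>M) \<longlonglongrightarrow> (\<integral>\<omega>. Y \<omega> * Z \<omega> \<partial>M)"
    using tendsto_integral_mult_L2[OF simple_ito_square_integrable[OF S(1)] S(4) Z(2) Z(2) S(3)] by simp
  ultimately show ?thesis by (intro LIMSEQ_unique[of _ _ "\<integral>\<omega>. Y' \<omega> * Z \<omega> \<partial>M"])
qed

end

section \<open>The Ito product rule\<close>

text \<open>Integration by parts in Fubini form: the square is cut along its diagonal into two
  triangles.\<close>

lemma product_of_integrals:
  fixes f g :: "real \<Rightarrow> real"
  assumes f: "integrable (restrict_space lborel {0..T}) f" and g: "integrable (restrict_space lborel {0..T}) g"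
  shows "(\<integral>s. f s \<partial>restrict_space lborel {0..T}) * (\<integral>s. g s \<partial>restrict_space lborel {0..T}) =
    (\<integral>t. g t * (\<integral>s. indicator {..t} s * f s \<partial>restrict_space lborel {0..T}) \<partial>restrict_space lborel {0..T}) +
    (\<integral>t. f t * (\<integral>s. indicator {..t} s * g s \<partial>restrict_space lborel {0..T}) \<partial>restrict_space lborel {0..T})"
proof -
  let ?N = "restrict_space lborel {0..T}"
  interpret finite_measure ?N
    by (rule finite_measureI) (simp add: space_restrict_space emeasure_restrict_space emeasure_lborel_Icc_eq)
  interpret N: pair_sigma_finite ?N ?N by unfold_locales
  have [measurable]: "f \<in> borel_measurable ?N" "g \<in> borel_measurable ?N" using f g by auto
  have id [measurable]: "(\<lambda>x. x) \<in> borel_measurable ?N" by (intro measurable_restrict_space1) simp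
  have prod: "integrable (?N \<Otimes>\<^sub>M ?N) (\<lambda>(t, s). u t * v s)" if "integrable ?N u" "integrable ?N v" for u v :: "real \<Rightarrow> real"
  proof (rule N.Fubini_integrable)
    have [measurable]: "u \<in> borel_measurable ?N" "v \<in> borel_measurable ?N" using that by auto
    show "(\<lambda>(t, s). u t * v s) \<in> borel_measurable (?N \<Otimes>\<^sub>M ?N)" by measurable
    show "integrable ?N (\<lambda>x. \<integral>y. norm (case (x, y) of (t, s) \<Rightarrow> u t * v s) \<partial>?N)"
      using that by (simp add: abs_mult)
  qed (use that in auto)
  have ind: "integrable (?N \<Otimes>\<^sub>M ?N) (\<lambda>(t, s). u t * (indicator {..t} s * v s))"
    if "integrable ?N u" "integrable ?N v" for u v :: "real \<Rightarrow> real"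
  proof (rule Bochner_Integration.integrable_bound[OF prod[OF that]])
    have [measurable]: "u \<in> borel_measurable ?N" "v \<in> borel_measurable ?N" using that by auto
    have "(\<lambda>x. u (fst x) * ((if snd x \<le> fst x then 1 else 0) * v (snd x))) \<in> borel_measurable (?N \<Otimes>\<^sub>M ?N)"
      by measurable
    then show "(\<lambda>(t, s). u t * (indicator {..t} s * v s)) \<in> borel_measurable (?N \<Otimes>\<^sub>M ?N)"
      by (simp add: case_prod_unfold indicator_def)
  qed (auto simp: indicator_def)
  note i1 = ind[OF g f] and i2 = ind[OF f g]
  have i3: "integrable (?N \<Otimes>\<^sub>M ?N) (\<lambda>(t, s). f s * (indicator {..s} t * g t))"
    using N.integrable_product_swap[OF i2] by (simp add: case_prod_unfold)
  \<comment> \<open>Both indicators are one on the diagonal, which for fixed \<open>t\<close> is a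
    single point and hence a null set.\<close>
  have null: "(\<integral>s. (indicator {..t} s + indicator {..s} t) * f s \<partial>?N) = (\<integral>s. f s \<partial>?N)" for t :: real
  proof (rule integral_cong_AE)
    show "AE s in ?N. (indicator {..t} s + indicator {..s} t) * f s = f s"
      unfolding AE_restrict_space_iff[of "{0..T}" lborel, simplified]
      using AE_lborel_singleton[of t]
      by eventually_elim (auto simp: indicator_def)
    have "(\<lambda>s. ((if s \<le> t then 1 else 0) + (if t \<le> s then 1 else 0)) * f s) \<in> borel_measurable ?N"
      by measurable
    then show "(\<lambda>s. (indicator {..t} s + indicator {..s} t) * f s) \<in> borel_measurable ?N"
      by (simp add: indicator_def)
  qed auto
  have "(\<integral>t. f t * (\<integral>s. indicator {..t} s * g s \<partial>?N) \<partial>?N) =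
      (\<integral>t. (\<integral>s. f t * (indicator {..t} s * g s) \<partial>?N) \<partial>?N)" by simp
  also have "\<dots> = (\<integral>(t, s). f t * (indicator {..t} s * g s) \<partial>(?N \<Otimes>\<^sub>M ?N))"
    by (rule N.integral_fst[OF i2])
  also have "\<dots> = (\<integral>(t, s). f s * (indicator {..s} t * g t) \<partial>(?N \<Otimes>\<^sub>M ?N))"
    using N.integral_product_swap[of "\<lambda>(t, s). f t * (indicator {..t} s * g s)"] i2
    by (simp add: case_prod_unfold)
  finally have e2: "(\<integral>t. f t * (\<integral>s. indicator {..t} s * g s \<partial>?N) \<partial>?N) =
    (\<integral>(t, s). f s * (indicator {..s} t * g t) \<partial>(?N \<Otimes>\<^sub>M ?N))" .
  have e1: "(\<integral>t. g t * (\<integral>s. indicator {..t} s * f s \<partial>?N) \<partial>?N) =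
      (\<integral>(t, s). g t * (indicator {..t} s * f s) \<partial>(?N \<Otimes>\<^sub>M ?N))"
    using N.integral_fst[OF i1] by simp
  have "(\<integral>(t, s). g t * (indicator {..t} s * f s) \<partial>(?N \<Otimes>\<^sub>M ?N)) +
      (\<integral>(t, s). f s * (indicator {..s} t * g t) \<partial>(?N \<Otimes>\<^sub>M ?N)) =
      (\<integral>x. (case x of (t, s) \<Rightarrow> g t * (indicator {..t} s * f s)) + (case x of (t, s) \<Rightarrow> f s * (indicator {..s} t * g t)) \<partial>(?N \<Otimes>\<^sub>M ?N))"
    using i1 i3 by simp
  also have "\<dots> = (\<integral>(t, s). g t * ((indicator {..t} s + indicator {..s} t) * f s) \<partial>(?N \<Otimes>\<^sub>M ?N))"
    by (simp add: case_prod_unfold algebra_simps)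
  also have "\<dots> = (\<integral>t. (\<integral>s. g t * ((indicator {..t} s + indicator {..s} t) * f s) \<partial>?N) \<partial>?N)"
    using Bochner_Integration.integrable_add[OF i1 i3]
    by (intro N.integral_fst[symmetric]) (simp add: case_prod_unfold algebra_simps)
  also have "\<dots> = (\<integral>t. g t * (\<integral>s. f s \<partial>?N) \<partial>?N)"
    using null by simp
  also have "\<dots> = (\<integral>s. f s \<partial>?N) * (\<integral>s. g s \<partial>?N)" by simp
  finally show ?thesis unfolding e1 e2 by simp
qed

context brownian
begin

text \<open>The indefinite integral over a fixed domain with a moving indicator: joint measurability
  in \<open>t\<close> and \<open>\<omega>\<close> and Fubini then apply directly.\<close>

definition time_integral :: "real \<Rightarrow> (real \<Rightarrow> 'w \<Rightarrow> real) \<Rightarrow> real \<Rightarrow> 'w \<Rightarrow> real" where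
  "time_integral T b t \<omega> = (\<integral>s. indicator {..t} s * b s \<omega> \<partial>Time T)"

lemma set_integral_time_integral:
  assumes "0 \<le> t" "t \<le> T"
  shows "(LINT s:{0..t}|lborel. b s \<omega>) = time_integral T b t \<omega>"
  unfolding time_integral_def set_lebesgue_integral_def
  by (subst integral_restrict_space) (use assms in \<open>auto simp: indicator_def intro!: Bochner_Integration.integral_cong\<close>)

lemma square_integrable_PT_snd:
  assumes "square_integrable M f" shows "square_integrable (PT T) (\<lambda>(t, \<omega>). f \<omega>)"
proof -
  interpret P: pair_sigma_finite "Time T" M by (rule pair_Time)
  interpret finite_measure "Time T" by (rule finite_measure_Time)
  have [measurable]: "f \<in> borel_measurable M" using assms by (rule square_integrableD)
  have "integrable (PT T) (\<lambda>(t, \<omega>). (f \<omega>)\<^sup>2)"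
    using assms by (intro P.Fubini_integrable) (auto simp: square_integrable_def)
  then show ?thesis by (simp add: square_integrable_def case_prod_unfold)
qed

text \<open>Supplies one majorant, independent of \<open>t\<close>, for all indefinite integrals at
  once. Its square integrability is Cauchy-Schwarz in time and costs the measure of the time
  interval.\<close>

lemma time_integral_abs_square_integrable:
  assumes b: "square_integrable (PT T) (\<lambda>(s, \<omega>). b s \<omega>)"
  shows "square_integrable M (\<lambda>\<omega>. \<integral>s. \<bar>b s \<omega>\<bar> \<partial>Time T)" (is ?A)
    and "AE \<omega> in M. square_integrable (Time T) (\<lambda>s. b s \<omega>)" (is ?B)
proof -
  interpret P: pair_sigma_finite "Time T" M by (rule pair_Time)
  interpret fT: finite_measure "Time T" by (rule finite_measure_Time)
  have m [measurable]: "(\<lambda>(s, \<omega>). b s \<omega>) \<in> borel_measurable (PT T)" using b by (rule square_integrableD)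
  have i: "integrable (PT T) (\<lambda>(s, \<omega>). (b s \<omega>)\<^sup>2)"
    using b by (simp add: square_integrable_def case_prod_unfold)
  have m': "(\<lambda>s. b s \<omega>) \<in> borel_measurable (Time T)" if "\<omega> \<in> space M" for \<omega>
    using measurable_compose[OF measurable_Pair2'[OF that, of "Time T"] m] by simp
  show B: ?B
    using P.AE_integrable_snd[OF i] AE_space
    by eventually_elim (simp add: square_integrable_def m')
  have K: "(\<lambda>\<omega>. \<integral>s. \<bar>b s \<omega>\<bar> \<partial>Time T) \<in> borel_measurable M"
  proof (rule P.M1.borel_measurable_lebesgue_integral)
    have "(\<lambda>x. (\<lambda>(s, \<omega>). b s \<omega>) (snd x, fst x)) \<in> borel_measurable (M \<Otimes>\<^sub>M Time T)"
      by measurable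
    then show "(\<lambda>(\<omega>, s). \<bar>b s \<omega>\<bar>) \<in> borel_measurable (M \<Otimes>\<^sub>M Time T)"
      by (simp add: case_prod_unfold)
  qed
  show ?A unfolding square_integrable_def
  proof (intro conjI K)
    show "integrable M (\<lambda>\<omega>. (\<integral>s. \<bar>b s \<omega>\<bar> \<partial>Time T)\<^sup>2)"
    proof (rule Bochner_Integration.integrable_bound)
      show "integrable M (\<lambda>\<omega>. measure (Time T) (space (Time T)) * (\<integral>s. (b s \<omega>)\<^sup>2 \<partial>Time T))"
        using P.integrable_snd[OF i] by simp
      show "AE \<omega> in M. norm ((\<integral>s. \<bar>b s \<omega>\<bar> \<partial>Time T)\<^sup>2) \<le>
        norm (measure (Time T) (space (Time T)) * (\<integral>s. (b s \<omega>)\<^sup>2 \<partial>Time T))"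
        using B
      proof eventually_elim
        case (elim \<omega>)
        then have "square_integrable (Time T) (\<lambda>s. \<bar>b s \<omega>\<bar>)" by (auto simp: square_integrable_def)
        from Cauchy_Schwarz_square_integrable[OF this, of "\<lambda>_. 1"]
        have "\<bar>\<integral>s. \<bar>b s \<omega>\<bar> \<partial>Time T\<bar> \<le> sqrt ((\<integral>s. (b s \<omega>)\<^sup>2 \<partial>Time T) * measure (Time T) (space (Time T)))"
          by (simp add: square_integrable_def real_sqrt_mult)
        then have "\<bar>\<integral>s. \<bar>b s \<omega>\<bar> \<partial>Time T\<bar>\<^sup>2 \<le> (sqrt ((\<integral>s. (b s \<omega>)\<^sup>2 \<partial>Time T) * measure (Time T) (space (Time T))))\<^sup>2"
          by (intro power_mono) auto
        then show ?case by (simp add: mult.commute)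
      qed
    qed (use K in measurable)
  qed
qed

lemma time_integral_square_integrable:
  assumes b: "square_integrable (PT T) (\<lambda>(s, \<omega>). b s \<omega>)"
  shows "square_integrable (PT T) (\<lambda>(t, \<omega>). time_integral T b t \<omega>)"
    and "square_integrable M (time_integral T b t)"
proof -
  interpret P: pair_sigma_finite "Time T" M by (rule pair_Time)
  interpret fT: finite_measure "Time T" by (rule finite_measure_Time)
  have m [measurable]: "(\<lambda>(s, \<omega>). b s \<omega>) \<in> borel_measurable (PT T)" using b by (rule square_integrableD)
  have id [measurable]: "(\<lambda>x. x) \<in> borel_measurable (Time T)" by (intro measurable_restrict_space1) simp
  have meas: "(\<lambda>(t, \<omega>). time_integral T b t \<omega>) \<in> borel_measurable (PT T)"
    unfolding time_integral_def case_prod_unfold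
  proof (rule P.M1.borel_measurable_lebesgue_integral)
    have "(\<lambda>x. (if snd x \<le> fst (fst x) then 1 else 0) * (\<lambda>(s, \<omega>). b s \<omega>) (snd x, snd (fst x)))
      \<in> borel_measurable (PT T \<Otimes>\<^sub>M Time T)" by measurable
    then show "(\<lambda>(x, s). indicator {..fst x} s * b s (snd x)) \<in> borel_measurable (PT T \<Otimes>\<^sub>M Time T)"
      by (simp add: case_prod_unfold indicator_def)
  qed
  have meas': "time_integral T b t \<in> borel_measurable M" for t
    unfolding time_integral_def[abs_def]
  proof (rule P.M1.borel_measurable_lebesgue_integral)
    have "(\<lambda>x. (if snd x \<le> t then 1 else 0) * (\<lambda>(s, \<omega>). b s \<omega>) (snd x, fst x))
      \<in> borel_measurable (M \<Otimes>\<^sub>M Time T)" by measurable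
    then show "(\<lambda>(x, s). indicator {..t} s * b s x) \<in> borel_measurable (M \<Otimes>\<^sub>M Time T)"
      by (simp add: case_prod_unfold indicator_def)
  qed
  have le: "AE \<omega> in M. \<forall>t. \<bar>time_integral T b t \<omega>\<bar> \<le> \<bar>\<integral>s. \<bar>b s \<omega>\<bar> \<partial>Time T\<bar>"
    using time_integral_abs_square_integrable(2)[OF b]
  proof eventually_elim
    case (elim \<omega>)
    then have [measurable]: "(\<lambda>s. b s \<omega>) \<in> borel_measurable (Time T)" by (rule square_integrableD)
    have int: "integrable (Time T) (\<lambda>s. \<bar>b s \<omega>\<bar>)"
      using square_integrable_mult[OF elim, of "\<lambda>_. 1"] by (simp add: square_integrable_def)
    show ?case
    proof
      fix t
      have [measurable]: "indicator {..t} \<in> borel_measurable (Time T)"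
        by (intro measurable_restrict_space1) simp
      have "\<bar>time_integral T b t \<omega>\<bar> \<le> (\<integral>s. \<bar>indicator {..t} s * b s \<omega>\<bar> \<partial>Time T)"
        unfolding time_integral_def by (rule integral_abs_bound)
      also have "\<dots> \<le> (\<integral>s. \<bar>b s \<omega>\<bar> \<partial>Time T)"
      proof (rule integral_mono)
        show "integrable (Time T) (\<lambda>s. \<bar>indicator {..t} s * b s \<omega>\<bar>)"
          by (rule Bochner_Integration.integrable_bound[OF int]) (measurable, auto simp: indicator_def)
      qed (use int in \<open>auto simp: indicator_def\<close>)
      finally show "\<bar>time_integral T b t \<omega>\<bar> \<le> \<bar>\<integral>s. \<bar>b s \<omega>\<bar> \<partial>Time T\<bar>" by linarith
    qed
  qed
  show "square_integrable M (time_integral T b t)"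
    by (rule square_integrable_bound[OF time_integral_abs_square_integrable(1)[OF b] meas'])
      (use le in auto)
  show "square_integrable (PT T) (\<lambda>(t, \<omega>). time_integral T b t \<omega>)"
  proof (rule square_integrable_bound[OF square_integrable_PT_snd[OF time_integral_abs_square_integrable(1)[OF b]] meas])
    have [measurable]: "(\<lambda>\<omega>. \<integral>s. \<bar>b s \<omega>\<bar> \<partial>Time T) \<in> borel_measurable M"
      by (rule square_integrableD[OF time_integral_abs_square_integrable(1)[OF b]])
    have "{x \<in> space (PT T). \<bar>case x of (t, \<omega>) \<Rightarrow> time_integral T b t \<omega>\<bar>
       \<le> \<bar>case x of (t, \<omega>) \<Rightarrow> \<integral>s. \<bar>b s \<omega>\<bar> \<partial>Time T\<bar>} \<in> sets (PT T)"
      using meas by measurable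
    moreover have "AE t in Time T. AE \<omega> in M. \<bar>time_integral T b t \<omega>\<bar> \<le> \<bar>\<integral>s. \<bar>b s \<omega>\<bar> \<partial>Time T\<bar>"
    proof (rule AE_I2)
      fix t show "AE \<omega> in M. \<bar>time_integral T b t \<omega>\<bar> \<le> \<bar>\<integral>s. \<bar>b s \<omega>\<bar> \<partial>Time T\<bar>"
        using le by eventually_elim blast
    qed
    ultimately show "AE x in PT T. \<bar>case x of (t, \<omega>) \<Rightarrow> time_integral T b t \<omega>\<bar>
       \<le> \<bar>case x of (t, \<omega>) \<Rightarrow> \<integral>s. \<bar>b s \<omega>\<bar> \<partial>Time T\<bar>"
      by (intro P.AE_pair_measure) (auto simp: case_prod_unfold)
  qed
qed

text \<open>No partition of the time interval is needed: with \<open>p = I + Y\<close>, the martingale property replaces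
  \<open>Y T\<close> by \<open>Y t\<close> against the drift at time \<open>t\<close>, and what is left is \<open>I * I'\<close>, which
  is handled by Fubini.\<close>

theorem ito_product_rule:
  fixes p p' b b' Y Y' :: "real \<Rightarrow> 'w \<Rightarrow> real"
  assumes T: "0 \<le> T"
    and b: "square_integrable (PT T) (\<lambda>(s, \<omega>). b s \<omega>)" "square_integrable (PT T) (\<lambda>(s, \<omega>). b' s \<omega>)"
    and p: "square_integrable (PT T) (\<lambda>(s, \<omega>). p s \<omega>)" "square_integrable (PT T) (\<lambda>(s, \<omega>). p' s \<omega>)"
    and eq: "\<And>t. t \<in> {0..T} \<Longrightarrow> AE \<omega> in M. p t \<omega> = (LINT s:{0..t}|lborel. b s \<omega>) + Y t \<omega>"
      "\<And>t. t \<in> {0..T} \<Longrightarrow> AE \<omega> in M. p' t \<omega> = (LINT s:{0..t}|lborel. b' s \<omega>) + Y' t \<omega>"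
    and Y: "\<And>t. t \<in> {0..T} \<Longrightarrow> square_integrable M (Y t)"
      "\<And>t. t \<in> {0..T} \<Longrightarrow> square_integrable M (Y' t)"
    and meas: "p T \<in> borel_measurable M" "p' T \<in> borel_measurable M"
    and mart: "AE t in Time T. (\<integral>\<omega>. Y T \<omega> * b' t \<omega> \<partial>M) = (\<integral>\<omega>. Y t \<omega> * b' t \<omega> \<partial>M)"
      "AE t in Time T. (\<integral>\<omega>. Y' T \<omega> * b t \<omega> \<partial>M) = (\<integral>\<omega>. Y' t \<omega> * b t \<omega> \<partial>M)"
  shows "(\<integral>\<omega>. p T \<omega> * p' T \<omega> \<partial>M) = (\<integral>\<omega>. Y T \<omega> * Y' T \<omega> \<partial>M) +
    (\<integral>(t, \<omega>). p t \<omega> * b' t \<omega> + p' t \<omega> * b t \<omega> \<partial>PT T)"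
proof -
  interpret P: pair_sigma_finite "Time T" M by (rule pair_Time)
  interpret fT: finite_measure "Time T" by (rule finite_measure_Time)
  let ?I = "time_integral T b" and ?I' = "time_integral T b'"
  note sI = time_integral_square_integrable[OF b(1)] and sI' = time_integral_square_integrable[OF b(2)]
  have TT: "T \<in> {0..T}" using T by simp
  \<comment> \<open>The mean of drift times martingale part: Fubini pulls the time integral outside,
    \<open>mt\<close> moves \<open>Z\<close> from time \<open>T\<close> to time \<open>t\<close>,
    and \<open>Z t\<close> is \<open>q t\<close> minus its accumulated drift.\<close>
  have cross: "(\<integral>\<omega>. time_integral T c T \<omega> * Z T \<omega> \<partial>M) =
      (\<integral>(t, \<omega>). q t \<omega> * c t \<omega> \<partial>PT T) - (\<integral>(t, \<omega>). time_integral T d t \<omega> * c t \<omega> \<partial>PT T)"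
    if c: "square_integrable (PT T) (\<lambda>(s, \<omega>). c s \<omega>)" and d: "square_integrable (PT T) (\<lambda>(s, \<omega>). d s \<omega>)"
      and q: "square_integrable (PT T) (\<lambda>(s, \<omega>). q s \<omega>)"
      and Z: "square_integrable M (Z T)"
      and eqq: "\<And>t. t \<in> {0..T} \<Longrightarrow> AE \<omega> in M. q t \<omega> = (LINT s:{0..t}|lborel. d s \<omega>) + Z t \<omega>"
      and mt: "AE t in Time T. (\<integral>\<omega>. Z T \<omega> * c t \<omega> \<partial>M) = (\<integral>\<omega>. Z t \<omega> * c t \<omega> \<partial>M)"
      and Zm: "\<And>t. t \<in> {0..T} \<Longrightarrow> square_integrable M (Z t)"
    for c d q Z :: "real \<Rightarrow> 'w \<Rightarrow> real"
  proof -
    note sd = time_integral_square_integrable(1)[OF d]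
    have i1: "integrable (PT T) (\<lambda>(t, \<omega>). Z T \<omega> * c t \<omega>)"
      using square_integrable_mult[OF square_integrable_PT_snd[OF Z] c] by (simp add: case_prod_unfold)
    have i2: "integrable (PT T) (\<lambda>(t, \<omega>). q t \<omega> * c t \<omega>)"
      using square_integrable_mult[OF q c] by (simp add: case_prod_unfold)
    have i3: "integrable (PT T) (\<lambda>(t, \<omega>). time_integral T d t \<omega> * c t \<omega>)"
      using square_integrable_mult[OF sd c] by (simp add: case_prod_unfold)
    have i4: "integrable (PT T) (\<lambda>(t, \<omega>). (q t \<omega> - time_integral T d t \<omega>) * c t \<omega>)"
      using Bochner_Integration.integrable_diff[OF i2 i3] by (simp add: case_prod_unfold left_diff_distrib)
    have cm: "(\<lambda>\<omega>. c t \<omega>) \<in> borel_measurable M" "(\<lambda>\<omega>. q t \<omega>) \<in> borel_measurable M" if "t \<in> space (Time T)" for t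
      using measurable_compose[OF measurable_Pair1'[OF that, of M] square_integrableD[OF c]]
        measurable_compose[OF measurable_Pair1'[OF that, of M] square_integrableD[OF q]] by simp_all
    have "(\<integral>\<omega>. time_integral T c T \<omega> * Z T \<omega> \<partial>M) = (\<integral>\<omega>. (\<integral>t. Z T \<omega> * c t \<omega> \<partial>Time T) \<partial>M)"
      unfolding time_integral_def
      by (intro Bochner_Integration.integral_cong refl)
        (auto simp: indicator_def space_restrict_space mult.commute intro!: Bochner_Integration.integral_cong
          simp flip: integral_mult_right_zero)
    also have "\<dots> = (\<integral>(t, \<omega>). Z T \<omega> * c t \<omega> \<partial>PT T)" by (rule P.integral_snd[OF i1])
    also have "\<dots> = (\<integral>t. (\<integral>\<omega>. Z T \<omega> * c t \<omega> \<partial>M) \<partial>Time T)" by (rule P.integral_fst[OF i1, symmetric])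
    also have "\<dots> = (\<integral>t. (\<integral>\<omega>. (q t \<omega> - time_integral T d t \<omega>) * c t \<omega> \<partial>M) \<partial>Time T)"
    proof (rule integral_cong_AE)
      show "AE t in Time T. (\<integral>\<omega>. Z T \<omega> * c t \<omega> \<partial>M) =
          (\<integral>\<omega>. (q t \<omega> - time_integral T d t \<omega>) * c t \<omega> \<partial>M)"
        using mt AE_space
      proof eventually_elim
        case (elim t)
        then have t: "t \<in> {0..T}" by (simp add: space_restrict_space)
        have "(\<integral>\<omega>. Z t \<omega> * c t \<omega> \<partial>M) = (\<integral>\<omega>. (q t \<omega> - time_integral T d t \<omega>) * c t \<omega> \<partial>M)"
        proof (rule integral_cong_AE)
          show "AE \<omega> in M. Z t \<omega> * c t \<omega> = (q t \<omega> - time_integral T d t \<omega>) * c t \<omega>"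
            using eqq[OF t] set_integral_time_integral[of t T d] t by auto
        qed (use square_integrableD[OF Zm[OF t]] cm[OF elim(2)]
              square_integrableD[OF time_integral_square_integrable(2)[OF d, of t]] in measurable)
        then show ?case using elim(1) by simp
      qed
    qed (use P.integrable_fst[OF i1] P.integrable_fst[OF i4] in auto)
    also have "\<dots> = (\<integral>(t, \<omega>). (q t \<omega> - time_integral T d t \<omega>) * c t \<omega> \<partial>PT T)"
      by (rule P.integral_fst[OF i4])
    also have "\<dots> = (\<integral>(t, \<omega>). q t \<omega> * c t \<omega> \<partial>PT T) - (\<integral>(t, \<omega>). time_integral T d t \<omega> * c t \<omega> \<partial>PT T)"
      using Bochner_Integration.integral_diff[OF i2 i3] by (simp add: case_prod_unfold left_diff_distrib)
    finally show ?thesis .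
  qed
  have j1: "integrable (PT T) (\<lambda>(t, \<omega>). b' t \<omega> * ?I t \<omega>)"
    using square_integrable_mult[OF b(2) sI(1)] by (simp add: case_prod_unfold)
  have j2: "integrable (PT T) (\<lambda>(t, \<omega>). b t \<omega> * ?I' t \<omega>)"
    using square_integrable_mult[OF b(1) sI'(1)] by (simp add: case_prod_unfold)
  have IT: "time_integral T c T \<omega> = (\<integral>s. c s \<omega> \<partial>Time T)" for c \<omega>
    unfolding time_integral_def
    by (intro Bochner_Integration.integral_cong) (auto simp: indicator_def space_restrict_space)
  have II: "(\<integral>\<omega>. ?I T \<omega> * ?I' T \<omega> \<partial>M) =
      (\<integral>(t, \<omega>). b' t \<omega> * ?I t \<omega> \<partial>PT T) + (\<integral>(t, \<omega>). b t \<omega> * ?I' t \<omega> \<partial>PT T)"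
  proof -
    have "AE \<omega> in M. ?I T \<omega> * ?I' T \<omega> = (\<integral>t. b' t \<omega> * ?I t \<omega> \<partial>Time T) + (\<integral>t. b t \<omega> * ?I' t \<omega> \<partial>Time T)"
      using time_integral_abs_square_integrable(2)[OF b(1)] time_integral_abs_square_integrable(2)[OF b(2)]
    proof eventually_elim
      case (elim \<omega>)
      have "integrable (Time T) (\<lambda>s. b s \<omega>)" "integrable (Time T) (\<lambda>s. b' s \<omega>)"
        using square_integrable_mult[OF elim(1), of "\<lambda>_. 1"] square_integrable_mult[OF elim(2), of "\<lambda>_. 1"]
        by (simp_all add: square_integrable_def)
      from product_of_integrals[OF this] show ?case
        unfolding IT by (simp add: time_integral_def)
    qed
    then have "(\<integral>\<omega>. ?I T \<omega> * ?I' T \<omega> \<partial>M) =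
       (\<integral>\<omega>. (\<integral>t. b' t \<omega> * ?I t \<omega> \<partial>Time T) + (\<integral>t. b t \<omega> * ?I' t \<omega> \<partial>Time T) \<partial>M)"
      using P.integrable_snd[OF j1] P.integrable_snd[OF j2]
        square_integrableD[OF sI(2)[of T]] square_integrableD[OF sI'(2)[of T]]
      by (intro integral_cong_AE) auto
    also have "\<dots> = (\<integral>(t, \<omega>). b' t \<omega> * ?I t \<omega> \<partial>PT T) + (\<integral>(t, \<omega>). b t \<omega> * ?I' t \<omega> \<partial>PT T)"
      using P.integrable_snd[OF j1] P.integrable_snd[OF j2] P.integral_snd[OF j1] P.integral_snd[OF j2] by simp
    finally show ?thesis .
  qed
  have "AE \<omega> in M. p T \<omega> * p' T \<omega> = ?I T \<omega> * ?I' T \<omega> + ?I' T \<omega> * Y T \<omega> + ?I T \<omega> * Y' T \<omega> + Y T \<omega> * Y' T \<omega>"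
    using eq(1)[OF TT] eq(2)[OF TT]
  proof eventually_elim
    case (elim \<omega>)
    then show ?case
      using set_integral_time_integral[of T T b \<omega>] set_integral_time_integral[of T T b' \<omega>] T
      by (simp add: algebra_simps)
  qed
  then have "(\<integral>\<omega>. p T \<omega> * p' T \<omega> \<partial>M) =
     (\<integral>\<omega>. ?I T \<omega> * ?I' T \<omega> + ?I' T \<omega> * Y T \<omega> + ?I T \<omega> * Y' T \<omega> + Y T \<omega> * Y' T \<omega> \<partial>M)"
    using meas square_integrableD[OF sI(2)[of T]] square_integrableD[OF sI'(2)[of T]]
      square_integrableD[OF Y(1)[OF TT]] square_integrableD[OF Y(2)[OF TT]]
    by (intro integral_cong_AE) auto
  also have "\<dots> = (\<integral>\<omega>. ?I T \<omega> * ?I' T \<omega> \<partial>M) + (\<integral>\<omega>. ?I' T \<omega> * Y T \<omega> \<partial>M) +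
      (\<integral>\<omega>. ?I T \<omega> * Y' T \<omega> \<partial>M) + (\<integral>\<omega>. Y T \<omega> * Y' T \<omega> \<partial>M)"
    using square_integrable_mult[OF sI(2)[of T] sI'(2)[of T]] square_integrable_mult[OF sI'(2)[of T] Y(1)[OF TT]]
      square_integrable_mult[OF sI(2)[of T] Y(2)[OF TT]] square_integrable_mult[OF Y(1)[OF TT] Y(2)[OF TT]]
    by simp
  \<comment> \<open>The integrals of drift against accumulated drift that \<open>cross\<close>
    subtracts are exactly those that \<open>II\<close> adds.\<close>
  also have "\<dots> = (\<integral>\<omega>. Y T \<omega> * Y' T \<omega> \<partial>M) + (\<integral>(t, \<omega>). p t \<omega> * b' t \<omega> \<partial>PT T) + (\<integral>(t, \<omega>). p' t \<omega> * b t \<omega> \<partial>PT T)"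
    using II cross[OF b(2) b(1) p(1) Y(1)[OF TT] eq(1) mart(1) Y(1)]
      cross[OF b(1) b(2) p(2) Y(2)[OF TT] eq(2) mart(2) Y(2)]
    by (simp add: case_prod_unfold mult.commute)
  also have "\<dots> = (\<integral>\<omega>. Y T \<omega> * Y' T \<omega> \<partial>M) + (\<integral>(t, \<omega>). p t \<omega> * b' t \<omega> + p' t \<omega> * b t \<omega> \<partial>PT T)"
    using square_integrable_mult[OF p(1) b(2)] square_integrable_mult[OF p(2) b(1)]
    by (simp add: case_prod_unfold)
  finally show ?thesis .
qed

end

section \<open>A discrete Gagliardo inequality\<close>

text \<open>Every factor is scaled to have sum 1, and the arithmetic-geometric mean inequality is
  summed over \<open>A\<close>. A factor with sum 0 cannot be scaled, but then all the products
  vanish.\<close>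

lemma Hoelder_sum_prod:
  fixes x :: "'i \<Rightarrow> 'a \<Rightarrow> real"
  assumes I: "finite I" "I \<noteq> {}" and x: "\<And>i a. i \<in> I \<Longrightarrow> a \<in> A \<Longrightarrow> 0 \<le> x i a" and A: "finite A"
  shows "(\<Sum>a\<in>A. (\<Prod>i\<in>I. x i a) powr (1 / card I)) \<le> (\<Prod>i\<in>I. \<Sum>a\<in>A. x i a) powr (1 / card I)"
proof (cases "\<exists>i\<in>I. (\<Sum>a\<in>A. x i a) = 0")
  case True
  then obtain i where i: "i \<in> I" "(\<Sum>a\<in>A. x i a) = 0" by blast
  then have "\<forall>a\<in>A. x i a = 0" using A x[OF i(1)] by (simp add: sum_nonneg_eq_0_iff)
  then have "(\<Prod>i\<in>I. x i a) = 0" if "a \<in> A" for a using I i(1) that by (auto intro: prod_zero)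
  then show ?thesis by simp
next
  case False
  let ?X = "\<lambda>i. \<Sum>a\<in>A. x i a"
  have X: "0 < ?X i" if "i \<in> I" for i
    using False that sum_nonneg[of A "x i"] x[OF that] by (metis order_le_less)
  have card: "0 < real (card I)" using I by (simp add: card_gt_0_iff)
  have "(\<Sum>a\<in>A. (\<Prod>i\<in>I. x i a) powr (1 / card I)) =
     (\<Sum>a\<in>A. (\<Prod>i\<in>I. ?X i) powr (1 / card I) * (\<Prod>i\<in>I. x i a / ?X i) powr (1 / card I))"
  proof (rule sum.cong[OF refl])
    fix a assume a: "a \<in> A"
    have "(\<Prod>i\<in>I. x i a) = (\<Prod>i\<in>I. ?X i) * (\<Prod>i\<in>I. x i a / ?X i)"
      unfolding prod.distrib[symmetric] using X by (intro prod.cong) (auto simp: less_le)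
    then show "(\<Prod>i\<in>I. x i a) powr (1 / card I) = (\<Prod>i\<in>I. ?X i) powr (1 / card I) * (\<Prod>i\<in>I. x i a / ?X i) powr (1 / card I)"
      using X x a by (simp add: powr_mult prod_nonneg less_imp_le divide_nonneg_pos)
  qed
  also have "\<dots> = (\<Prod>i\<in>I. ?X i) powr (1 / card I) * (\<Sum>a\<in>A. (\<Prod>i\<in>I. x i a / ?X i) powr (1 / card I))"
    by (simp add: sum_distrib_left)
  also have "(\<Sum>a\<in>A. (\<Prod>i\<in>I. x i a / ?X i) powr (1 / card I)) \<le> (\<Sum>a\<in>A. (\<Sum>i\<in>I. x i a / ?X i / card I))"
  proof (rule sum_mono)
    fix a assume a: "a \<in> A"
    show "(\<Prod>i\<in>I. x i a / ?X i) powr (1 / card I) \<le> (\<Sum>i\<in>I. x i a / ?X i / card I)"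
      using x a X by (intro arith_geom_mean I divide_nonneg_pos) auto
  qed
  also have "(\<Sum>a\<in>A. (\<Sum>i\<in>I. x i a / ?X i / card I)) = (\<Sum>i\<in>I. (\<Sum>a\<in>A. x i a) / ?X i / card I)"
    by (subst sum.swap) (simp only: sum_divide_distrib)
  also have "\<dots> = (\<Sum>i\<in>I. 1 / card I)" using X by (intro sum.cong) (auto simp: less_le)
  also have "\<dots> = 1" using card by simp
  finally show ?thesis by (simp add: mult_left_mono)
qed

lemma powr_inverse_power:
  assumes "0 \<le> x" "0 < m" shows "(x powr (1 / real m)) ^ m = x"
proof (cases "x = 0")
  case False
  then have "(x powr (1 / real m)) ^ m = (x powr (1 / real m)) powr real m"
    using assms by (subst powr_realpow) auto
  then show ?thesis using assms False by (simp add: powr_powr)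
qed (use assms in simp)

text \<open>A box sum in iterated form: coordinates outside the list stay as in \<open>k\<close>, so
  a partial sum is again a function on the lattice and the list serves for induction.\<close>

fun coord_sum :: "int set \<Rightarrow> 'n list \<Rightarrow> (('n \<Rightarrow> int) \<Rightarrow> real) \<Rightarrow> ('n \<Rightarrow> int) \<Rightarrow> real" where
  "coord_sum A [] F k = F k"
| "coord_sum A (j # js) F k = (\<Sum>a\<in>A. coord_sum A js F (k(j := a)))"

lemma coord_sum_nonneg: "(\<And>k. 0 \<le> F k) \<Longrightarrow> 0 \<le> coord_sum A js F k"
  by (induction js arbitrary: k) (auto intro: sum_nonneg)

lemma coord_sum_append: "coord_sum A (xs @ ys) F = coord_sum A xs (coord_sum A ys F)"
  by (induction xs) (auto simp: fun_eq_iff)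

lemma coord_sum_indep:
  assumes "\<And>k a. F (k(i := a)) = F k" "i \<notin> set js"
  shows "coord_sum A js F (k(i := a)) = coord_sum A js F k"
  using assms(2)
proof (induction js arbitrary: k)
  case (Cons j js)
  then have "coord_sum A js F (k(i := a, j := b)) = coord_sum A js F (k(j := b))" for b
    using Cons.IH[of "k(j := b)"] Cons.prems fun_upd_twist[of i j k a b] by (metis list.set_intros(1) list.set_intros(2))
  then show ?case by (simp only: coord_sum.simps)
qed (use assms in simp)

lemma coord_sum_box:
  fixes k :: "'n::finite \<Rightarrow> int"
  assumes "finite A" "distinct js"
  shows "finite {z. (\<forall>i\<in>set js. z i \<in> A) \<and> (\<forall>i. i \<notin> set js \<longrightarrow> z i = k i)} \<and>
    coord_sum A js F k = (\<Sum>z | (\<forall>i\<in>set js. z i \<in> A) \<and> (\<forall>i. i \<notin> set js \<longrightarrow> z i = k i). F z)"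
  using assms(2)
proof (induction js arbitrary: k)
  case Nil
  have "{z. \<forall>i. z i = k i} = {k}" by auto
  then show ?case by simp
next
  case (Cons j js)
  let ?S = "\<lambda>js k. {z. (\<forall>i\<in>set js. z i \<in> A) \<and> (\<forall>i. i \<notin> set js \<longrightarrow> z i = k i)}"
  have eq: "?S (j # js) k = (\<Union>a\<in>A. ?S js (k(j := a)))"
    using Cons.prems by (auto; metis)
  have fin: "finite (?S js (k(j := a)))" for a using Cons by simp
  have "coord_sum A (j # js) F k = (\<Sum>a\<in>A. \<Sum>z\<in>?S js (k(j := a)). F z)"
    using Cons by simp
  also have "\<dots> = (\<Sum>z\<in>(\<Union>a\<in>A. ?S js (k(j := a))). F z)"
  proof (rule sum.UNION_disjoint[symmetric])
    show "\<forall>a\<in>A. \<forall>b\<in>A. a \<noteq> b \<longrightarrow> ?S js (k(j := a)) \<inter> ?S js (k(j := b)) = {}"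
      using Cons.prems by (auto; metis fun_upd_same)
  qed (use fin assms in auto)
  finally show ?case unfolding eq using fin assms by auto
qed

text \<open>Coordinates are summed out one at a time. Summing over coordinate \<open>j\<close> does not affect \<open>G j\<close>,
  and the Hoelder inequality with \<open>n - 1\<close> factors applies to the others.\<close>

lemma Loomis_Whitney_coord:
  fixes G :: "'n::finite \<Rightarrow> ('n \<Rightarrow> int) \<Rightarrow> real"
  assumes n: "CARD('n) \<ge> 2" and A: "finite A"
    and G: "\<And>i k. 0 \<le> G i k" "\<And>i k a. G i (k(i := a)) = G i k" and js: "distinct js"
  shows "coord_sum A js (\<lambda>k. (\<Prod>i\<in>UNIV. G i k) powr (1 / (real CARD('n) - 1))) k \<le>
    (\<Prod>i\<in>UNIV. coord_sum A (filter (\<lambda>j. j \<noteq> i) js) (G i) k) powr (1 / (real CARD('n) - 1))"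
  using js
proof (induction js arbitrary: k)
  case (Cons j js)
  let ?c = "1 / (real CARD('n) - 1)"
  let ?H = "\<lambda>i. coord_sum A (filter (\<lambda>j. j \<noteq> i) js) (G i)"
  have H0: "0 \<le> ?H i k" for i k by (intro coord_sum_nonneg G)
  have card: "card (UNIV - {j}) = CARD('n) - 1" "real (CARD('n) - 1) = real CARD('n) - 1"
    using n by (auto simp: card_Diff_singleton of_nat_diff)
  have ne: "UNIV - {j} \<noteq> {}" using card(1) n by (intro notI) simp
  have split: "(\<Prod>i\<in>UNIV. f i) = f j * (\<Prod>i\<in>UNIV - {j}. f i)" for f :: "'n \<Rightarrow> real"
    by (rule prod.remove) auto
  have "coord_sum A (j # js) (\<lambda>k. (\<Prod>i\<in>UNIV. G i k) powr ?c) k \<le> (\<Sum>a\<in>A. (\<Prod>i\<in>UNIV. ?H i (k(j := a))) powr ?c)"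
    using Cons by (auto intro!: sum_mono)
  also have "\<dots> = (\<Sum>a\<in>A. ?H j k powr ?c * (\<Prod>i\<in>UNIV - {j}. ?H i (k(j := a))) powr ?c)"
  proof (rule sum.cong[OF refl])
    fix a
    have "?H j (k(j := a)) = ?H j k" by (rule coord_sum_indep) (use G in auto)
    then show "(\<Prod>i\<in>UNIV. ?H i (k(j := a))) powr ?c = ?H j k powr ?c * (\<Prod>i\<in>UNIV - {j}. ?H i (k(j := a))) powr ?c"
      by (simp add: split powr_mult H0 prod_nonneg)
  qed
  also have "\<dots> = ?H j k powr ?c * (\<Sum>a\<in>A. (\<Prod>i\<in>UNIV - {j}. ?H i (k(j := a))) powr ?c)"
    by (simp add: sum_distrib_left)
  also have "\<dots> \<le> ?H j k powr ?c * (\<Prod>i\<in>UNIV - {j}. \<Sum>a\<in>A. ?H i (k(j := a))) powr ?c"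
    using Hoelder_sum_prod[of "UNIV - {j}" A "\<lambda>i a. ?H i (k(j := a))"] ne A H0
    unfolding card by (intro mult_left_mono) auto
  also have "\<dots> = (?H j k * (\<Prod>i\<in>UNIV - {j}. \<Sum>a\<in>A. ?H i (k(j := a)))) powr ?c"
    by (simp add: powr_mult H0 prod_nonneg sum_nonneg)
  also have "?H j k * (\<Prod>i\<in>UNIV - {j}. \<Sum>a\<in>A. ?H i (k(j := a))) =
     (\<Prod>i\<in>UNIV. coord_sum A (filter (\<lambda>l. l \<noteq> i) (j # js)) (G i) k)"
    unfolding split by (auto intro!: prod.cong)
  finally show ?case .
qed simp

text \<open>The discrete embedding of W^{1,1} in L^(n/(n-1)), paired with an L^n weight
  \<open>a\<close>. Each line sum \<open>W i\<close> dominates \<open>V\<close> and does not depend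
  on coordinate \<open>i\<close>. So \<open>V ^ n\<close> is at most the product of the
  \<open>W i\<close>, and Loomis-Whitney bounds the sum of the (n-1)-th root of that
  product.\<close>

lemma discrete_Gagliardo:
  fixes V a :: "('n::finite \<Rightarrow> int) \<Rightarrow> real" and f :: "'n \<Rightarrow> ('n \<Rightarrow> int) \<Rightarrow> real"
  assumes n: "CARD('n) \<ge> 2" and A: "finite A"
    and a: "\<And>z. 0 \<le> a z" and V: "\<And>z. 0 \<le> V z" and f: "\<And>i z. 0 \<le> f i z"
    and Vf: "\<And>i z. (\<forall>j. z j \<in> A) \<Longrightarrow> V z \<le> (\<Sum>c\<in>A. f i (z(i := c)))"
    and cube_def: "cube = {z. \<forall>j. z j \<in> A}"
  shows "(\<Sum>z\<in>cube. a z * V z) \<le>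
    ((\<Sum>z\<in>cube. a z ^ CARD('n)) * (\<Prod>i\<in>UNIV. \<Sum>z\<in>cube. f i z)) powr (1 / CARD('n))"
proof -
  let ?n = "CARD('n)"
  obtain L :: "'n list" where L: "set L = UNIV" "distinct L"
    using finite_distinct_list[OF finite[of UNIV]] by blast
  have boxL: "finite cube" "coord_sum A js F k = (\<Sum>z\<in>cube. F z)" if "distinct js" "set js = UNIV" for js F k
    using coord_sum_box[OF A that(1), of k F] unfolding that(2) cube_def by auto
  have fin: "finite cube" using boxL(1)[OF L(2,1)] .
  define W where "W = (\<lambda>i. coord_sum A [i] (f i))"
  have W0: "0 \<le> W i z" for i z unfolding W_def by (intro coord_sum_nonneg f)
  define Q where "Q = (\<lambda>z. (\<Prod>i\<in>UNIV. W i z) powr (1 / (real ?n - 1)))"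
  have Q: "(\<Sum>z\<in>cube. Q z) \<le> (\<Prod>i\<in>UNIV. \<Sum>z\<in>cube. f i z) powr (1 / (real ?n - 1))"
  proof -
    have "coord_sum A (filter (\<lambda>j. j \<noteq> i) L) (W i) (\<lambda>_. 0) = (\<Sum>z\<in>cube. f i z)" for i
      unfolding W_def coord_sum_append[symmetric] by (rule boxL(2)) (use L in auto)
    then show ?thesis
      using Loomis_Whitney_coord[OF n A, of W L "\<lambda>_. 0"] W0 L
      unfolding Q_def boxL(2)[OF L(2,1)] by (simp add: W_def)
  qed
  have n1: "real ?n - 1 > 0" "real (?n - 1) = real ?n - 1" using n by auto
  have Qp: "Q z ^ (?n - 1) = (\<Prod>i\<in>UNIV. W i z)" for z
    unfolding Q_def n1(2)[symmetric] using W0 n by (intro powr_inverse_power prod_nonneg) auto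
  \<comment> \<open>An arbitrary index that labels the \<open>n\<close> Hoelder factors: the one at
    \<open>i0\<close> is \<open>a z ^ n\<close>, the remaining ones are copies of
    \<open>Q\<close>.\<close>
  define i0 :: 'n where "i0 = undefined"
  define x where "x = (\<lambda>i z. if i = i0 then a z ^ ?n else Q z)"
  have px: "(\<Prod>i\<in>UNIV. if i = i0 then s else t) = s * t ^ (?n - 1)" for s t :: real
    by (subst prod.remove[of _ i0]) (auto simp: card_Diff_singleton)
  have "(\<Sum>z\<in>cube. a z * V z) \<le> (\<Sum>z\<in>cube. (\<Prod>i\<in>UNIV. x i z) powr (1 / ?n))"
  proof (rule sum_mono)
    fix z assume z: "z \<in> cube"
    have "V z ^ ?n = (\<Prod>i\<in>(UNIV::'n set). V z)" by simp
    also have "\<dots> \<le> (\<Prod>i\<in>UNIV. W i z)"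
      using V Vf[of z] z by (intro prod_mono) (auto simp: W_def cube_def)
    finally have "(a z * V z) ^ ?n \<le> (\<Prod>i\<in>UNIV. x i z)"
      using a[of z] unfolding x_def px Qp power_mult_distrib by (intro mult_left_mono) auto
    then have "((a z * V z) ^ ?n) powr (1 / ?n) \<le> (\<Prod>i\<in>UNIV. x i z) powr (1 / ?n)"
      using a V by (intro powr_mono2) auto
    moreover have "((a z * V z) ^ ?n) powr (1 / ?n) = a z * V z"
      using a[of z] V[of z] n by (cases "a z * V z = 0") (auto simp: powr_powr simp flip: powr_realpow)
    ultimately show "a z * V z \<le> (\<Prod>i\<in>UNIV. x i z) powr (1 / ?n)" by simp
  qed
  also have "\<dots> \<le> (\<Prod>i\<in>UNIV. \<Sum>z\<in>cube. x i z) powr (1 / ?n)"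
    using Hoelder_sum_prod[of UNIV cube x] fin a by (auto simp: x_def Q_def)
  also have "(\<Prod>i\<in>UNIV. \<Sum>z\<in>cube. x i z) = (\<Sum>z\<in>cube. a z ^ ?n) * (\<Sum>z\<in>cube. Q z) ^ (?n - 1)"
    unfolding px[symmetric] by (intro prod.cong) (auto simp: x_def)
  also have "\<dots> powr (1 / ?n) \<le> ((\<Sum>z\<in>cube. a z ^ ?n) * (\<Prod>i\<in>UNIV. \<Sum>z\<in>cube. f i z)) powr (1 / ?n)"
  proof (intro powr_mono2 mult_left_mono)
    have "(\<Sum>z\<in>cube. Q z) ^ (?n - 1) \<le> ((\<Prod>i\<in>UNIV. \<Sum>z\<in>cube. f i z) powr (1 / (real ?n - 1))) ^ (?n - 1)"
      using Q by (intro power_mono sum_nonneg) (auto simp: Q_def)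
    also have "\<dots> = (\<Prod>i\<in>UNIV. \<Sum>z\<in>cube. f i z)"
      unfolding n1(2)[symmetric] using f n by (intro powr_inverse_power prod_nonneg sum_nonneg) auto
    finally show "(\<Sum>z\<in>cube. Q z) ^ (?n - 1) \<le> (\<Prod>i\<in>UNIV. \<Sum>z\<in>cube. f i z)" .
  qed (auto intro!: sum_nonneg mult_nonneg_nonneg zero_le_power a simp: Q_def)
  finally show ?thesis .
qed

section \<open>Calculus on the mesh\<close>

definition grid :: "real \<Rightarrow> ('n \<Rightarrow> int) \<Rightarrow> real ^ 'n" where
  "grid h z = (\<chi> i. h * of_int (z i))"

lemma grid_inj: "h \<noteq> 0 \<Longrightarrow> inj (grid h)"
  by (auto simp: inj_def grid_def vec_eq_iff)

lemma grid_upd: "grid h (z(i := z i + 1)) = grid h z + h *\<^sub>R axis i 1"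
  by (simp add: grid_def vec_eq_iff axis_def algebra_simps)

lemma grid_in_mesh_iff:
  assumes h: "h = 1 / (real N + 1)"
  shows "grid h z \<in> primal_mesh h \<longleftrightarrow> (\<forall>i. z i \<in> {1..int N})"
proof -
  have "0 < h * of_int k \<and> h * of_int k < 1 \<longleftrightarrow> k \<in> {1..int N}" for k :: int
  proof -
    have "h * of_int k < 1 \<longleftrightarrow> (of_int k :: real) < of_int (int N + 1)"
      unfolding h by (simp add: field_simps)
    moreover have "0 < h * of_int k \<longleftrightarrow> 0 < k" unfolding h by (simp add: zero_less_divide_iff)
    ultimately show ?thesis unfolding of_int_less_iff by auto
  qed
  then show ?thesis by (auto simp: primal_mesh_def unit_cube_def grid_def)
qed

lemma primal_mesh_eq_grid:
  assumes h: "h = 1 / (real N + 1)"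
  shows "(primal_mesh h :: (real ^ 'n) set) = grid h ` {z. \<forall>i. z i \<in> {1..int N}}"
proof
  show "(primal_mesh h :: (real ^ 'n) set) \<subseteq> grid h ` {z. \<forall>i. z i \<in> {1..int N}}"
  proof
    fix x :: "real ^ 'n" assume x: "x \<in> primal_mesh h"
    then obtain k where k: "\<And>i. x $ i = h * of_int (k i)" unfolding primal_mesh_def by (auto, metis)
    then have "x = grid h k" by (simp add: grid_def vec_eq_iff)
    then show "x \<in> grid h ` {z. \<forall>i. z i \<in> {1..int N}}" using x grid_in_mesh_iff[OF h, of k] by auto
  qed
qed (use grid_in_mesh_iff[OF h] in auto)

lemma card_int_cube: "card {z :: 'n::finite \<Rightarrow> int. \<forall>i. z i \<in> A i} = (\<Prod>i\<in>UNIV. card (A i))"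
  using card_PiE[of "UNIV :: 'n set" A] by (simp add: PiE_def Pi_def extensional_def)

lemma finite_primal_mesh:
  assumes h: "h = 1 / (real N + 1)" shows "finite (primal_mesh h :: (real ^ 'n) set)"
  unfolding primal_mesh_eq_grid[OF h]
  using finite_PiE[of "UNIV :: 'n set" "\<lambda>_. {1..int N}"] by (intro finite_imageI) (simp add: PiE_def Pi_def extensional_def)

lemma mesh_volume_le:
  assumes h: "h = 1 / (real N + 1)"
  shows "h ^ CARD('n) * real (card (primal_mesh h :: (real ^ 'n) set)) \<le> 1"
proof -
  have "card (primal_mesh h :: (real ^ 'n) set) = N ^ CARD('n)"
    unfolding primal_mesh_eq_grid[OF h]
    using card_image[OF inj_on_subset[OF grid_inj[of h]], of "{z :: 'n \<Rightarrow> int. \<forall>i. z i \<in> {1..int N}}"]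
      card_int_cube[where 'n='n, of "\<lambda>_. {1..int N}"] by (simp add: h)
  then have "h ^ CARD('n) * real (card (primal_mesh h :: (real ^ 'n) set)) = (h * real N) ^ CARD('n)"
    by (simp add: power_mult_distrib)
  also have "\<dots> \<le> 1" unfolding h by (intro power_le_one) auto
  finally show ?thesis .
qed

lemma finite_dual: "finite W \<Longrightarrow> finite (dual h i W)"
  by (simp add: dual_def)

lemma dual_volume_le:
  assumes h: "h = 1 / (real N + 1)"
  shows "h ^ CARD('n) * real (card (dual h i (primal_mesh h :: (real ^ 'n) set))) \<le> 2"
proof -
  have "card (dual h i (primal_mesh h :: (real ^ 'n) set)) \<le> 2 * card (primal_mesh h :: (real ^ 'n) set)"
    unfolding dual_def mult_2
    by (rule order_trans[OF card_Un_le add_mono[OF card_image_le card_image_le]];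
      rule finite_primal_mesh[OF h])
  then have "real (card (dual h i (primal_mesh h :: (real ^ 'n) set))) \<le> 2 * card (primal_mesh h :: (real ^ 'n) set)"
    by linarith
  then have "h ^ CARD('n) * real (card (dual h i (primal_mesh h :: (real ^ 'n) set)))
    \<le> h ^ CARD('n) * (2 * card (primal_mesh h :: (real ^ 'n) set))"
    by (intro mult_left_mono) (auto simp: h)
  with mesh_volume_le[OF h, where 'n='n] show ?thesis by linarith
qed

section \<open>Integration over mesh sets and summation by parts\<close>

lemma mesh_integral_add: "mesh_integral h W (\<lambda>x. f x + g x) = mesh_integral h W f + mesh_integral h W g"
  by (simp add: mesh_integral_def sum.distrib algebra_simps)

lemma mesh_integral_cmult: "mesh_integral h W (\<lambda>x. c * f x) = c * mesh_integral h W f"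
  by (simp add: mesh_integral_def flip: sum_distrib_left)

lemma mesh_integral_mono:
  "0 \<le> h \<Longrightarrow> (\<And>x. x \<in> W \<Longrightarrow> f x \<le> g x) \<Longrightarrow> mesh_integral h W f \<le> mesh_integral h W g"
  unfolding mesh_integral_def by (intro mult_left_mono sum_mono) auto

lemma mesh_integral_nonneg:
  "0 \<le> h \<Longrightarrow> (\<And>x. x \<in> W \<Longrightarrow> 0 \<le> f x) \<Longrightarrow> 0 \<le> mesh_integral h W f"
  unfolding mesh_integral_def by (intro mult_nonneg_nonneg sum_nonneg) auto

lemma mesh_integral_abs:
  "0 \<le> h \<Longrightarrow> \<bar>mesh_integral h W f\<bar> \<le> mesh_integral h W (\<lambda>x. \<bar>f x\<bar>)"
  unfolding mesh_integral_def abs_mult by (auto intro: mult_left_mono sum_abs)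

lemma mesh_integral_sum:
  "mesh_integral h W (\<lambda>x. \<Sum>i\<in>I. f i x) = (\<Sum>i\<in>I. mesh_integral h W (f i))"
  by (simp add: mesh_integral_def sum_distrib_left sum.swap[of _ W I])

lemma mesh_integral_cong:
  "(\<And>x. x \<in> W \<Longrightarrow> f x = g x) \<Longrightarrow> mesh_integral h W f = mesh_integral h W g"
  by (simp add: mesh_integral_def)

text \<open>A dual point that is not this shift of a mesh point is shifted back to a point of
  \<open>mesh_boundary\<close>, where \<open>f\<close> is zero, so the sum extends to the whole dual
  mesh. The sign \<open>s\<close> covers both directions.\<close>

lemma sum_shift_dual:
  fixes f F :: "real ^ 'n \<Rightarrow> real"
  assumes fin: "finite (primal_mesh h :: (real ^ 'n) set)" and f: "\<And>x. x \<in> mesh_boundary h \<Longrightarrow> f x = 0"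
    and s: "s = 1 \<or> s = -1"
  shows "(\<Sum>x\<in>primal_mesh h. f x * F (x + (s * h / 2) *\<^sub>R axis i 1)) =
    (\<Sum>y\<in>dual h i (primal_mesh h). f (y - (s * h / 2) *\<^sub>R axis i 1) * F y)"
proof -
  let ?t = "\<lambda>x. x + (s * h / 2) *\<^sub>R axis i 1 :: real ^ 'n"
  have "(\<Sum>x\<in>primal_mesh h. f x * F (?t x)) = (\<Sum>y\<in>?t ` primal_mesh h. f (y - (s * h / 2) *\<^sub>R axis i 1) * F y)"
    by (subst sum.reindex) (auto simp: inj_on_def)
  also have "\<dots> = (\<Sum>y\<in>dual h i (primal_mesh h). f (y - (s * h / 2) *\<^sub>R axis i 1) * F y)"
  proof (rule sum.mono_neutral_left)
    show "?t ` primal_mesh h \<subseteq> dual h i (primal_mesh h)"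
      using s by (auto simp: dual_def)
    show "\<forall>y\<in>dual h i (primal_mesh h) - ?t ` primal_mesh h. f (y - (s * h / 2) *\<^sub>R axis i 1) * F y = 0"
    proof
      fix y assume y: "y \<in> dual h i (primal_mesh h) - ?t ` primal_mesh h"
      let ?x = "y - (s * h / 2) *\<^sub>R axis i 1"
      have "?x \<notin> primal_mesh h" using y by (auto simp: image_iff algebra_simps)
      moreover have "?x \<in> dual h i (dual h i (primal_mesh h))"
        using y s by (auto simp: dual_def[of h i "dual h i (primal_mesh h)"])
      ultimately have "?x \<in> mesh_boundary h" by (auto simp: mesh_boundary_def)
      then show "f ?x * F y = 0" using f by simp
    qed
  qed (use fin finite_dual in auto)
  finally show ?thesis .
qed

text \<open>The two shifts of \<open>sum_shift_dual\<close> are subtracted or added. Only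
  \<open>f\<close> has to vanish on the boundary, so a factor carrying the cutoff can take its place
  while \<open>F\<close> is arbitrary.\<close>

lemma
  fixes f F :: "real ^ 'n \<Rightarrow> real"
  assumes fin: "finite (primal_mesh h :: (real ^ 'n) set)" and f: "\<And>x. x \<in> mesh_boundary h \<Longrightarrow> f x = 0"
  shows summation_by_parts_Dh: "mesh_integral h (primal_mesh h) (\<lambda>x. f x * Dh h i F x) =
      - mesh_integral h (dual h i (primal_mesh h)) (\<lambda>y. Dh h i f y * F y)"
    and summation_by_parts_Ah: "mesh_integral h (primal_mesh h) (\<lambda>x. f x * Ah h i F x) =
      mesh_integral h (dual h i (primal_mesh h)) (\<lambda>y. Ah h i f y * F y)"
proof -
  note p = sum_shift_dual[OF fin f, where s=1 and i=i and F=F] and m = sum_shift_dual[OF fin f, where s="-1" and i=i and F=F]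
  have "(\<Sum>x\<in>primal_mesh h. f x * Dh h i F x) = ((\<Sum>x\<in>primal_mesh h. f x * F (x + (1 * h / 2) *\<^sub>R axis i 1))
     - (\<Sum>x\<in>primal_mesh h. f x * F (x + (-1 * h / 2) *\<^sub>R axis i 1))) / h"
    by (simp add: Dh_def sum_subtractf sum_divide_distrib right_diff_distrib diff_divide_distrib)
  also have "\<dots> = - (\<Sum>y\<in>dual h i (primal_mesh h). Dh h i f y * F y)"
    using p m
    by (simp add: Dh_def sum_subtractf sum_divide_distrib left_diff_distrib diff_divide_distrib)
  finally show "mesh_integral h (primal_mesh h) (\<lambda>x. f x * Dh h i F x) =
      - mesh_integral h (dual h i (primal_mesh h)) (\<lambda>y. Dh h i f y * F y)"
    by (simp add: mesh_integral_def)
  have "(\<Sum>x\<in>primal_mesh h. f x * Ah h i F x) = ((\<Sum>x\<in>primal_mesh h. f x * F (x + (1 * h / 2) *\<^sub>R axis i 1))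
     + (\<Sum>x\<in>primal_mesh h. f x * F (x + (-1 * h / 2) *\<^sub>R axis i 1))) / 2"
    by (simp add: Ah_def sum.distrib sum_divide_distrib distrib_left add_divide_distrib)
  also have "\<dots> = (\<Sum>y\<in>dual h i (primal_mesh h). Ah h i f y * F y)"
    using p m
    by (simp add: Ah_def sum.distrib sum_divide_distrib distrib_right add_divide_distrib)
  finally show "mesh_integral h (primal_mesh h) (\<lambda>x. f x * Ah h i F x) =
      mesh_integral h (dual h i (primal_mesh h)) (\<lambda>y. Ah h i f y * F y)"
    by (simp add: mesh_integral_def)
qed

lemma mesh_pairing_square_le:
  fixes f \<phi> :: "real ^ 'n \<Rightarrow> real"
  assumes h: "h = 1 / (real N + 1)" and \<phi>: "\<And>x. \<bar>\<phi> x\<bar> \<le> 1"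
  shows "(mesh_integral h (primal_mesh h) (\<lambda>x. \<phi> x * f x))\<^sup>2 \<le> mesh_integral h (primal_mesh h) (\<lambda>x. (f x)\<^sup>2)"
proof -
  let ?M = "primal_mesh h :: (real ^ 'n) set"
  have h0: "0 \<le> h" by (simp add: h)
  have "(\<Sum>x\<in>?M. \<phi> x * f x)\<^sup>2 \<le> (\<Sum>x\<in>?M. (\<phi> x)\<^sup>2) * (\<Sum>x\<in>?M. (f x)\<^sup>2)"
    by (rule Cauchy_Schwarz_ineq_sum)
  then have "(mesh_integral h ?M (\<lambda>x. \<phi> x * f x))\<^sup>2 \<le> (h ^ CARD('n))\<^sup>2 * ((\<Sum>x\<in>?M. (\<phi> x)\<^sup>2) * (\<Sum>x\<in>?M. (f x)\<^sup>2))"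
    unfolding mesh_integral_def power_mult_distrib by (intro mult_left_mono) auto
  also have "\<dots> = mesh_integral h ?M (\<lambda>x. (\<phi> x)\<^sup>2) * mesh_integral h ?M (\<lambda>x. (f x)\<^sup>2)"
    by (simp add: mesh_integral_def power2_eq_square mult_ac)
  also have "\<dots> \<le> 1 * mesh_integral h ?M (\<lambda>x. (f x)\<^sup>2)"
  proof (intro mult_right_mono mesh_integral_nonneg h0)
    have "mesh_integral h ?M (\<lambda>x. (\<phi> x)\<^sup>2) \<le> mesh_integral h ?M (\<lambda>_. 1)"
      using \<phi> h0 by (intro mesh_integral_mono) (auto simp: abs_square_le_1)
    also have "\<dots> \<le> 1" using mesh_volume_le[OF h, where 'n='n] by (simp add: mesh_integral_def)
    finally show "mesh_integral h ?M (\<lambda>x. (\<phi> x)\<^sup>2) \<le> 1" .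
  qed auto
  finally show ?thesis by simp
qed

lemma Dh_mult: "Dh h i (\<lambda>x. f x * g x) y = Ah h i f y * Dh h i g y + Dh h i f y * Ah h i g y"
  by (cases "h = 0") (simp_all add: Dh_def Ah_def field_simps)

lemma Ah_square_le: "(Ah h i f y)\<^sup>2 \<le> Ah h i (\<lambda>x. (f x)\<^sup>2) y"
proof -
  have "0 \<le> ((f (y + (h / 2) *\<^sub>R axis i 1) - f (y - (h / 2) *\<^sub>R axis i 1)) / 2)\<^sup>2" by simp
  then show ?thesis unfolding Ah_def by (simp add: power2_eq_square field_simps)
qed

lemma Ah_nonneg: "(\<And>x. 0 \<le> f x) \<Longrightarrow> 0 \<le> Ah h i f y"
  by (simp add: Ah_def)

lemma scaleR_half_add_half: "(h / 2) *\<^sub>R x + (h / 2) *\<^sub>R x = h *\<^sub>R (x :: real ^ 'n)"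
  by (simp flip: scaleR_left_distrib)

text \<open>Since \<open>V\<close> vanishes off the mesh, it is the telescoping sum of its
  differences along every coordinate line. The powers of \<open>h\<close> balance: the n-th root of
  the cell volume in the weight norm is the \<open>h\<close> that turns difference quotients into
  differences.\<close>

lemma mesh_Gagliardo:
  fixes V a :: "real ^ 'n \<Rightarrow> real"
  assumes n: "CARD('n) \<ge> 2" and h: "h = 1 / (real N + 1)"
    and a: "\<And>x. 0 \<le> a x" and V: "\<And>x. 0 \<le> V x" "\<And>x. x \<notin> primal_mesh h \<Longrightarrow> V x = 0"
    and X: "\<And>i. mesh_integral h (dual h i (primal_mesh h)) (\<lambda>y. \<bar>Dh h i V y\<bar>) \<le> X"
  shows "mesh_integral h (primal_mesh h) (\<lambda>x. a x * V x) \<le>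
    mesh_integral h (primal_mesh h) (\<lambda>x. a x ^ CARD('n)) powr (1 / CARD('n)) * X"
proof -
  let ?n = "CARD('n)"
  let ?M = "primal_mesh h :: (real ^ 'n) set"
  have hpos: "0 < h" by (simp add: h)
  \<comment> \<open>The layer 0 lies outside the mesh: the telescoping sums start there from zero,
    and the difference across the lower boundary is included.\<close>
  define A where "A = {0..int N}"
  define cube where "cube = {z :: 'n \<Rightarrow> int. \<forall>j. z j \<in> A}"
  define f where "f = (\<lambda>i z. \<bar>V (grid h (z(i := z i + 1))) - V (grid h z)\<bar>)"
  define a' where "a' = (\<lambda>z. if grid h z \<in> ?M then a (grid h z) else 0)"
  have fin: "finite cube"
    unfolding cube_def using finite_PiE[of "UNIV :: 'n set" "\<lambda>_. A"]
    by (simp add: PiE_def Pi_def extensional_def A_def)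
  have vanish: "V (grid h (z(i := 0))) = 0" for z i
    using grid_in_mesh_iff[OF h, of "z(i := 0)"] by (intro V) auto
  have Vf: "V (grid h z) \<le> (\<Sum>c\<in>A. f i (z(i := c)))" if "\<forall>j. z j \<in> A" for i z
  proof -
    let ?F = "\<lambda>c. V (grid h (z(i := int c)))"
    define m where "m = nat (z i)"
    have m: "z i = int m" "m \<le> N" using that[rule_format, of i] by (auto simp: A_def m_def)
    have "V (grid h z) = ?F m - ?F 0" using vanish m(1) by (simp add: fun_upd_idem)
    also have "\<dots> = (\<Sum>c<m. ?F (Suc c) - ?F c)" by (rule sum_lessThan_telescope[symmetric])
    also have "\<dots> \<le> (\<Sum>c<m. f i (z(i := int c)))"
      by (intro sum_mono) (simp add: f_def add.commute)
    also have "\<dots> = (\<Sum>c\<in>int ` {..<m}. f i (z(i := c)))"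
      by (subst sum.reindex) auto
    also have "\<dots> \<le> (\<Sum>c\<in>A. f i (z(i := c)))"
      using m by (intro sum_mono2) (auto simp: A_def f_def)
    finally show ?thesis .
  qed
  have sub: "?M = grid h ` {z\<in>cube. grid h z \<in> ?M}"
  proof -
    have "{z\<in>cube. grid h z \<in> ?M} = {z. \<forall>i. z i \<in> {1..int N}}"
      unfolding grid_in_mesh_iff[OF h] cube_def A_def by (auto intro: order_trans[OF zero_le_one])
    then show ?thesis using primal_mesh_eq_grid[OF h] by simp
  qed
  have sum_mesh: "(\<Sum>x\<in>?M. F x) = (\<Sum>z\<in>cube. if grid h z \<in> ?M then F (grid h z) else 0)" for F :: "real ^ 'n \<Rightarrow> real"
  proof -
    have "(\<Sum>x\<in>?M. F x) = (\<Sum>z\<in>{z\<in>cube. grid h z \<in> ?M}. F (grid h z))"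
      by (subst sub, subst sum.reindex) (use grid_inj[of h] hpos in \<open>auto intro: inj_on_subset\<close>)
    then show ?thesis using fin by (simp add: sum.inter_filter)
  qed
  have le: "(\<Sum>z\<in>cube. f i z) \<le> h * (\<Sum>y\<in>dual h i ?M. \<bar>Dh h i V y\<bar>)" for i
  proof -
    let ?s = "\<lambda>z. grid h z + (h / 2) *\<^sub>R axis i 1"
    have fs: "f i z = h * \<bar>Dh h i V (?s z)\<bar>" for z
    proof -
      have "?s z + (h / 2) *\<^sub>R axis i 1 = grid h (z(i := z i + 1))"
        unfolding grid_upd scaleR_half_add_half[of h "axis i 1", symmetric] by (simp add: add.assoc)
      then show ?thesis unfolding f_def Dh_def using hpos by simp
    qed
    \<comment> \<open>Lattice points with zero difference are dropped, because their shifted point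
      need not belong to the dual mesh.\<close>
    have "(\<Sum>z\<in>cube. f i z) = (\<Sum>z\<in>{z\<in>cube. f i z \<noteq> 0}. f i z)"
      using fin by (intro sum.mono_neutral_right) auto
    also have "\<dots> = (\<Sum>y\<in>?s ` {z\<in>cube. f i z \<noteq> 0}. h * \<bar>Dh h i V y\<bar>)"
      by (subst sum.reindex) (use grid_inj[of h] hpos fs in \<open>auto simp: inj_on_def inj_def\<close>)
    also have "\<dots> \<le> (\<Sum>y\<in>dual h i ?M. h * \<bar>Dh h i V y\<bar>)"
    proof (rule sum_mono2)
      show "?s ` {z\<in>cube. f i z \<noteq> 0} \<subseteq> dual h i ?M"
      proof safe
        fix z assume "f i z \<noteq> 0"
        then have "grid h z \<in> ?M \<or> grid h (z(i := z i + 1)) \<in> ?M"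
          using V(2) unfolding f_def by force
        moreover have "?s z = grid h (z(i := z i + 1)) - (h / 2) *\<^sub>R axis i 1"
          unfolding grid_upd scaleR_half_add_half[of h "axis i 1", symmetric] by simp
        ultimately show "?s z \<in> dual h i ?M" unfolding dual_def by auto
      qed
    qed (use finite_dual[OF finite_primal_mesh[OF h]] hpos in auto)
    finally show ?thesis by (simp add: sum_distrib_left)
  qed
  have X0: "0 \<le> X"
    using X[of undefined] mesh_integral_nonneg[of h "dual h undefined ?M" "\<lambda>y. \<bar>Dh h undefined V y\<bar>"] hpos
    by linarith
  have le2: "(\<Sum>z\<in>cube. f i z) \<le> h * X / h ^ ?n" for i
  proof -
    have "(\<Sum>y\<in>dual h i ?M. \<bar>Dh h i V y\<bar>) \<le> X / h ^ ?n"
      using X[of i] hpos by (simp add: mesh_integral_def pos_le_divide_eq mult.commute)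
    then have "h * (\<Sum>y\<in>dual h i ?M. \<bar>Dh h i V y\<bar>) \<le> h * (X / h ^ ?n)"
      using hpos by (intro mult_left_mono) auto
    with le[of i] show ?thesis by simp
  qed
  have f0: "0 \<le> f i z" for i z by (simp add: f_def)
  have "(\<Sum>z\<in>cube. a' z * V (grid h z)) \<le>
    ((\<Sum>z\<in>cube. a' z ^ ?n) * (\<Prod>i\<in>UNIV. \<Sum>z\<in>cube. f i z)) powr (1 / ?n)"
    using Vf a V(1) by (intro discrete_Gagliardo[OF n, of A]) (auto simp: A_def f_def a'_def cube_def)
  also have "\<dots> \<le> ((\<Sum>z\<in>cube. a' z ^ ?n) * (h * X / h ^ ?n) ^ ?n) powr (1 / ?n)"
  proof (intro powr_mono2 mult_left_mono)
    have "(\<Prod>i\<in>UNIV. \<Sum>z\<in>cube. f i z) \<le> (\<Prod>i\<in>(UNIV::'n set). h * X / h ^ ?n)"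
      by (intro prod_mono) (use le2 f0 in \<open>auto intro: sum_nonneg\<close>)
    then show "(\<Prod>i\<in>UNIV. \<Sum>z\<in>cube. f i z) \<le> (h * X / h ^ ?n) ^ ?n" by simp
  qed (auto intro!: sum_nonneg mult_nonneg_nonneg prod_nonneg f0 simp: a'_def a)
  also have "\<dots> = (\<Sum>z\<in>cube. a' z ^ ?n) powr (1 / ?n) * (h * X / h ^ ?n)"
  proof -
    have "((h * X / h ^ ?n) ^ ?n) powr (1 / ?n) = h * X / h ^ ?n"
      using X0 hpos n by (cases "X = 0") (auto simp: powr_powr simp flip: powr_realpow)
    then show ?thesis using X0 hpos by (subst powr_mult) (auto intro!: sum_nonneg simp: a'_def a)
  qed
  finally have main: "(\<Sum>x\<in>?M. a x * V x) \<le> (\<Sum>x\<in>?M. a x ^ ?n) powr (1 / ?n) * (h * X / h ^ ?n)"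
    unfolding sum_mesh a'_def using n by (simp add: if_distrib if_distribR power_0_left cong: if_cong)
  have "(h ^ ?n) powr (1 / ?n) = h" using hpos n by (simp add: powr_powr flip: powr_realpow)
  then have "mesh_integral h ?M (\<lambda>x. a x ^ ?n) powr (1 / ?n) = h * (\<Sum>x\<in>?M. a x ^ ?n) powr (1 / ?n)"
    unfolding mesh_integral_def using hpos a by (subst powr_mult) (auto intro!: sum_nonneg)
  moreover have "mesh_integral h ?M (\<lambda>x. a x * V x) \<le> h ^ ?n * ((\<Sum>x\<in>?M. a x ^ ?n) powr (1 / ?n) * (h * X / h ^ ?n))"
    unfolding mesh_integral_def using main hpos by (intro mult_left_mono) auto
  ultimately show ?thesis using hpos by (simp add: mult_ac)
qed

section \<open>Localized estimate of the drift\<close>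

lemma Young_scaled:
  fixes x y \<epsilon> :: real assumes "0 < \<epsilon>"
  shows "2 * x * y \<le> \<epsilon> * x\<^sup>2 + y\<^sup>2 / \<epsilon>"
proof -
  have "0 \<le> (\<epsilon> * x - y)\<^sup>2 / \<epsilon>" using assms by simp
  also have "\<dots> = \<epsilon> * x\<^sup>2 + y\<^sup>2 / \<epsilon> - 2 * x * y"
    using assms by (simp add: power2_eq_square field_simps)
  finally show ?thesis by simp
qed

text \<open>In the uses, \<open>a\<close>, \<open>A\<close> and \<open>D\<close> are the average of
  the cutoff, the average of its square and the difference of its square, and \<open>d\<close> is a
  difference of the solution. Squaring the cutoff pays off here: the factor
  \<open>\<bar>a\<bar>\<close> from \<open>D\<close> is exactly what the energy weight
  \<open>A\<close> needs.\<close>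

lemma diffusion_cross_term:
  fixes q D g d a A c0 \<epsilon> :: real
  assumes "\<bar>D\<bar> \<le> 2 * \<bar>a\<bar>" "a\<^sup>2 \<le> A" "0 \<le> g" "g \<le> c0" "0 < \<epsilon>"
  shows "\<bar>q * (D * (g * d))\<bar> \<le> \<epsilon> * (A * d\<^sup>2) + c0\<^sup>2 / \<epsilon> * q\<^sup>2"
proof -
  have "\<bar>q * (D * (g * d))\<bar> = \<bar>q\<bar> * (\<bar>D\<bar> * (g * \<bar>d\<bar>))" using assms by (simp add: abs_mult)
  also have "\<dots> \<le> \<bar>q\<bar> * ((2 * \<bar>a\<bar>) * (c0 * \<bar>d\<bar>))"
    using assms by (intro mult_left_mono mult_mono) auto
  also have "\<dots> = 2 * (\<bar>a\<bar> * \<bar>d\<bar>) * (c0 * \<bar>q\<bar>)" by simp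
  also have "\<dots> \<le> \<epsilon> * (\<bar>a\<bar> * \<bar>d\<bar>)\<^sup>2 + (c0 * \<bar>q\<bar>)\<^sup>2 / \<epsilon>" by (rule Young_scaled) fact
  also have "\<dots> = \<epsilon> * (a\<^sup>2 * d\<^sup>2) + c0\<^sup>2 / \<epsilon> * q\<^sup>2" by (simp add: power_mult_distrib)
  also have "\<dots> \<le> \<epsilon> * (A * d\<^sup>2) + c0\<^sup>2 / \<epsilon> * q\<^sup>2"
    using assms by (intro add_right_mono mult_left_mono mult_right_mono) auto
  finally show ?thesis .
qed

text \<open>Of the two factors \<open>c\<close>, one stays with the gradient and the other, being at
  most 1, is dropped.\<close>

lemma advection_term:
  fixes q c \<beta> A R \<epsilon> :: real
  assumes "0 \<le> c" "c \<le> 1" "\<bar>\<beta>\<bar> \<le> R" "0 < \<epsilon>"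
  shows "\<bar>q * (c\<^sup>2 * (\<beta> * A))\<bar> \<le> \<epsilon> * (c\<^sup>2 * A\<^sup>2) + R\<^sup>2 / \<epsilon> * q\<^sup>2"
proof -
  have "\<bar>q * (c\<^sup>2 * (\<beta> * A))\<bar> = (c * \<bar>A\<bar>) * ((c * \<bar>\<beta>\<bar>) * \<bar>q\<bar>)"
    using assms by (simp add: abs_mult power2_eq_square)
  also have "\<dots> \<le> (c * \<bar>A\<bar>) * ((1 * R) * \<bar>q\<bar>)"
    using assms by (intro mult_left_mono mult_right_mono mult_mono) auto
  also have "\<dots> \<le> 2 * (c * \<bar>A\<bar>) * (R * \<bar>q\<bar>)" using assms by simp
  also have "\<dots> \<le> \<epsilon> * (c * \<bar>A\<bar>)\<^sup>2 + (R * \<bar>q\<bar>)\<^sup>2 / \<epsilon>" by (rule Young_scaled) fact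
  finally show ?thesis by (simp add: power_mult_distrib)
qed

text \<open>The deterministic setting at one time and one \<open>\<omega>\<close>. Here
  \<open>ch\<close> is the bump before squaring, and \<open>v\<close> will be the difference of the
  solutions set to zero outside \<open>G0\<close>. One \<open>K\<close> bounds both the L^n norm of
  the potential, for the energy term, and its squared L^2 norm, for the pairing term.\<close>

locale cutoff_estimate =
  fixes N :: nat and h c0 R K :: real and ch v :: "real ^ 'n \<Rightarrow> real"
    and \<gamma> :: "'n \<Rightarrow> real ^ 'n \<Rightarrow> real" and b1 :: "'n \<Rightarrow> real ^ 'n \<Rightarrow> real" and b2 :: "real ^ 'n \<Rightarrow> real"
  assumes n: "CARD('n) \<ge> 2" and h: "h = 1 / (real N + 1)" and c0: "0 < c0" and R: "0 \<le> R" and K: "0 < K"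
    and ch: "\<And>x. 0 \<le> ch x" "\<And>x. ch x \<le> 1" "\<And>x. x \<in> mesh_boundary h \<Longrightarrow> ch x = 0"
      "\<And>i y. \<bar>Dh h i ch y\<bar> \<le> 1"
    and v: "\<And>x. x \<notin> primal_mesh h \<Longrightarrow> v x = 0"
    and \<gamma>: "\<And>i y. y \<in> dual h i (primal_mesh h) \<Longrightarrow> 1 / c0 \<le> \<gamma> i y \<and> \<gamma> i y \<le> c0"
    and b1: "\<And>i x. x \<in> primal_mesh h \<Longrightarrow> \<bar>b1 i x\<bar> \<le> R"
    and b2: "mesh_integral h (primal_mesh h) (\<lambda>x. \<bar>b2 x\<bar> ^ CARD('n)) powr (1 / CARD('n)) \<le> K"
      "mesh_integral h (primal_mesh h) (\<lambda>x. (b2 x)\<^sup>2) \<le> K"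
begin

abbreviation "MI \<equiv> mesh_integral h (primal_mesh h :: (real ^ 'n) set)"
abbreviation "MD i \<equiv> mesh_integral h (dual h i (primal_mesh h :: (real ^ 'n) set))"
abbreviation "ch2 \<equiv> (\<lambda>x. (ch x)\<^sup>2)"

text \<open>The weight is the coefficient that the discrete Leibniz rule puts on the dissipation
  when \<open>ch\<^sup>2 * v\<close> is differenced.\<close>

definition "energy i = MD i (\<lambda>y. Ah h i ch2 y * (Dh h i v y)\<^sup>2)"
definition "mass = MI (\<lambda>x. (v x)\<^sup>2)"

lemma h0: "0 < h" by (simp add: h)
lemma h0': "0 \<le> h" by (simp add: h)

lemma fin: "finite (primal_mesh h :: (real ^ 'n) set)" by (rule finite_primal_mesh[OF h])

lemma boundary_notin: "x \<in> mesh_boundary h \<Longrightarrow> x \<notin> primal_mesh h"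
  by (auto simp: mesh_boundary_def)

lemma energy_nonneg: "0 \<le> energy i"
  unfolding energy_def by (intro mesh_integral_nonneg h0' mult_nonneg_nonneg Ah_nonneg) auto

lemma mass_nonneg: "0 \<le> mass"
  unfolding mass_def by (intro mesh_integral_nonneg h0') auto

text \<open>Convexity of the square, after which the average is moved onto the constant 1.\<close>

lemma MD_Ah_square:
  assumes "\<And>x. x \<notin> primal_mesh h \<Longrightarrow> u x = 0"
  shows "MD i (\<lambda>y. (Ah h i u y)\<^sup>2) \<le> MI (\<lambda>x. (u x)\<^sup>2)"
proof -
  have "MD i (\<lambda>y. (Ah h i u y)\<^sup>2) \<le> MD i (\<lambda>y. Ah h i (\<lambda>x. (u x)\<^sup>2) y * 1)"
    by (intro mesh_integral_mono h0') (simp add: Ah_square_le)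
  also have "\<dots> = MI (\<lambda>x. (u x)\<^sup>2 * Ah h i (\<lambda>_. 1) x)"
    by (rule summation_by_parts_Ah[OF fin, symmetric]) (use assms boundary_notin in auto)
  finally show ?thesis by (simp add: Ah_def)
qed

lemma MD_one: "MD i (\<lambda>_. 1) \<le> 2"
  using dual_volume_le[OF h, of i] by (simp add: mesh_integral_def)

lemma MI_one: "MI (\<lambda>_. 1) \<le> 1"
  using mesh_volume_le[OF h, where 'n='n] by (simp add: mesh_integral_def)

text \<open>Convexity of the square, after which the average is moved from the gradient to the
  cutoff; this produces the energy weight.\<close>

lemma MI_Ah_Dh: "MI (\<lambda>x. ch2 x * (Ah h i (Dh h i v) x)\<^sup>2) \<le> energy i"
proof -
  have "MI (\<lambda>x. ch2 x * (Ah h i (Dh h i v) x)\<^sup>2) \<le> MI (\<lambda>x. ch2 x * Ah h i (\<lambda>y. (Dh h i v y)\<^sup>2) x)"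
    by (intro mesh_integral_mono h0' mult_left_mono Ah_square_le) auto
  also have "\<dots> = energy i" unfolding energy_def
    by (rule summation_by_parts_Ah[OF fin]) (simp add: ch)
  finally show ?thesis .
qed

lemma Dh_ch2: "\<bar>Dh h i ch2 y\<bar> \<le> 2 * \<bar>Ah h i ch y\<bar>"
proof -
  have "Dh h i ch2 y = 2 * Ah h i ch y * Dh h i ch y"
    using Dh_mult[of h i ch ch y] by (simp add: power2_eq_square)
  then have "\<bar>Dh h i ch2 y\<bar> = 2 * \<bar>Ah h i ch y\<bar> * \<bar>Dh h i ch y\<bar>" by (simp add: abs_mult)
  also have "\<dots> \<le> 2 * \<bar>Ah h i ch y\<bar> * 1" by (intro mult_left_mono ch) auto
  finally show ?thesis by simp
qed

lemma \<gamma>_nonneg: "y \<in> dual h i (primal_mesh h) \<Longrightarrow> 0 \<le> \<gamma> i y"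
  using \<gamma>[of y i] c0 by (meson divide_nonneg_pos order_trans zero_le_one)

lemma MI_drift:
  "MI (\<lambda>x. \<phi> x * drift h \<gamma> b1 b2 v x) =
    (\<Sum>i\<in>UNIV. MI (\<lambda>x. \<phi> x * Dh h i (\<lambda>y. \<gamma> i y * Dh h i v y) x))
    + (\<Sum>i\<in>UNIV. MI (\<lambda>x. \<phi> x * (b1 i x * Ah h i (Dh h i v) x))) + MI (\<lambda>x. \<phi> x * (b2 x * v x))"
  unfolding drift_def distrib_left mesh_integral_add sum_distrib_left mesh_integral_sum by simp

text \<open>\<open>q\<close> will be the pairing of \<open>v\<close> with the squared cutoff.
  Summation by parts moves one difference onto the cutoff, so that \<open>v\<close> enters through
  first differences only. Diffusion and advection each spend \<open>\<epsilon>\<close> of the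
  energy, and the potential is paid for by \<open>mass\<close>.\<close>

lemma drift_pairing_bound:
  assumes \<epsilon>: "0 < \<epsilon>"
  shows "\<bar>q * MI (\<lambda>x. ch2 x * drift h \<gamma> b1 b2 v x)\<bar> \<le>
    2 * \<epsilon> * (\<Sum>i\<in>UNIV. energy i) + (CARD('n) * (2 * c0\<^sup>2 / \<epsilon> + R\<^sup>2 / \<epsilon>) + K) * q\<^sup>2 + mass"
proof -
  have t1: "\<bar>q * MI (\<lambda>x. ch2 x * Dh h i (\<lambda>y. \<gamma> i y * Dh h i v y) x)\<bar> \<le> \<epsilon> * energy i + (2 * c0\<^sup>2 / \<epsilon>) * q\<^sup>2" for i
  proof -
    have "q * MI (\<lambda>x. ch2 x * Dh h i (\<lambda>y. \<gamma> i y * Dh h i v y) x) =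
        - MD i (\<lambda>y. q * (Dh h i ch2 y * (\<gamma> i y * Dh h i v y)))"
      unfolding mesh_integral_cmult
      by (subst summation_by_parts_Dh[OF fin]) (auto simp: ch)
    then have "\<bar>q * MI (\<lambda>x. ch2 x * Dh h i (\<lambda>y. \<gamma> i y * Dh h i v y) x)\<bar> \<le>
        MD i (\<lambda>y. \<bar>q * (Dh h i ch2 y * (\<gamma> i y * Dh h i v y))\<bar>)"
      using mesh_integral_abs[OF h0', of "dual h i (primal_mesh h)" "\<lambda>y. q * (Dh h i ch2 y * (\<gamma> i y * Dh h i v y))"]
      by simp
    also have "\<dots> \<le> MD i (\<lambda>y. \<epsilon> * (Ah h i ch2 y * (Dh h i v y)\<^sup>2) + c0\<^sup>2 / \<epsilon> * q\<^sup>2 * 1)"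
      using \<gamma> \<gamma>_nonneg \<epsilon> diffusion_cross_term[OF Dh_ch2 Ah_square_le]
      by (intro mesh_integral_mono h0') auto
    also have "\<dots> = \<epsilon> * energy i + c0\<^sup>2 / \<epsilon> * q\<^sup>2 * MD i (\<lambda>_. 1)"
      unfolding mesh_integral_add mesh_integral_cmult energy_def ..
    also have "\<dots> \<le> \<epsilon> * energy i + c0\<^sup>2 / \<epsilon> * q\<^sup>2 * 2"
      using \<epsilon> by (intro add_left_mono mult_left_mono MD_one) auto
    finally show ?thesis by (simp add: mult_ac)
  qed
  have t2: "\<bar>q * MI (\<lambda>x. ch2 x * (b1 i x * Ah h i (Dh h i v) x))\<bar> \<le> \<epsilon> * energy i + R\<^sup>2 / \<epsilon> * q\<^sup>2" for i
  proof -
    have "\<bar>q * MI (\<lambda>x. ch2 x * (b1 i x * Ah h i (Dh h i v) x))\<bar> \<le>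
        MI (\<lambda>x. \<bar>q * (ch2 x * (b1 i x * Ah h i (Dh h i v) x))\<bar>)"
      using mesh_integral_abs[OF h0', of "primal_mesh h" "\<lambda>x. q * (ch2 x * (b1 i x * Ah h i (Dh h i v) x))"]
      unfolding mesh_integral_cmult .
    also have "\<dots> \<le> MI (\<lambda>x. \<epsilon> * (ch2 x * (Ah h i (Dh h i v) x)\<^sup>2) + R\<^sup>2 / \<epsilon> * q\<^sup>2 * 1)"
      using advection_term[OF ch(1,2) b1 \<epsilon>] by (intro mesh_integral_mono h0') auto
    also have "\<dots> = \<epsilon> * MI (\<lambda>x. ch2 x * (Ah h i (Dh h i v) x)\<^sup>2) + R\<^sup>2 / \<epsilon> * q\<^sup>2 * MI (\<lambda>_. 1)"
      unfolding mesh_integral_add mesh_integral_cmult ..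
    also have "\<dots> \<le> \<epsilon> * energy i + R\<^sup>2 / \<epsilon> * q\<^sup>2 * 1"
      using \<epsilon> by (intro add_mono mult_left_mono MI_one MI_Ah_Dh) auto
    finally show ?thesis by simp
  qed
  have t3: "\<bar>q * MI (\<lambda>x. ch2 x * (b2 x * v x))\<bar> \<le> K * q\<^sup>2 + mass"
  proof -
    have pw: "\<bar>q * (ch2 x * (b2 x * v x))\<bar> \<le> q\<^sup>2 * (b2 x)\<^sup>2 + (v x)\<^sup>2" for x
    proof -
      have "\<bar>q * (ch2 x * (b2 x * v x))\<bar> = ch2 x * (\<bar>q * b2 x\<bar> * \<bar>v x\<bar>)" by (simp add: abs_mult)
      also have "\<dots> \<le> 1 * (\<bar>q * b2 x\<bar> * \<bar>v x\<bar>)" using ch by (intro mult_right_mono power_le_one) auto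
      also have "\<dots> \<le> 2 * \<bar>q * b2 x\<bar> * \<bar>v x\<bar>" by simp
      also have "\<dots> \<le> 1 * \<bar>q * b2 x\<bar>\<^sup>2 + \<bar>v x\<bar>\<^sup>2 / 1" by (rule Young_scaled) simp
      finally show ?thesis by (simp add: power_mult_distrib)
    qed
    have "\<bar>q * MI (\<lambda>x. ch2 x * (b2 x * v x))\<bar> \<le> MI (\<lambda>x. \<bar>q * (ch2 x * (b2 x * v x))\<bar>)"
      using mesh_integral_abs[OF h0', of "primal_mesh h" "\<lambda>x. q * (ch2 x * (b2 x * v x))"]
      unfolding mesh_integral_cmult .
    also have "\<dots> \<le> MI (\<lambda>x. q\<^sup>2 * (b2 x)\<^sup>2 + (v x)\<^sup>2)" by (intro mesh_integral_mono h0' pw)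
    also have "\<dots> = q\<^sup>2 * MI (\<lambda>x. (b2 x)\<^sup>2) + mass" unfolding mesh_integral_add mesh_integral_cmult mass_def ..
    also have "\<dots> \<le> q\<^sup>2 * K + mass" by (intro add_right_mono mult_left_mono b2) auto
    finally show ?thesis by (simp add: mult.commute)
  qed
  have "\<bar>q * MI (\<lambda>x. ch2 x * drift h \<gamma> b1 b2 v x)\<bar> \<le>
     (\<Sum>i\<in>UNIV. \<bar>q * MI (\<lambda>x. ch2 x * Dh h i (\<lambda>y. \<gamma> i y * Dh h i v y) x)\<bar>)
    + (\<Sum>i\<in>UNIV. \<bar>q * MI (\<lambda>x. ch2 x * (b1 i x * Ah h i (Dh h i v) x))\<bar>) + \<bar>q * MI (\<lambda>x. ch2 x * (b2 x * v x))\<bar>"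
    unfolding MI_drift distrib_left sum_distrib_left
    by (intro order_trans[OF abs_triangle_ineq] add_mono sum_abs order_refl)
  also have "\<dots> \<le> (\<Sum>i\<in>(UNIV::'n set). \<epsilon> * energy i + (2 * c0\<^sup>2 / \<epsilon>) * q\<^sup>2)
     + (\<Sum>i\<in>(UNIV::'n set). \<epsilon> * energy i + R\<^sup>2 / \<epsilon> * q\<^sup>2) + (K * q\<^sup>2 + mass)"
    by (intro add_mono sum_mono t1 t2 t3)
  also have "\<dots> = 2 * \<epsilon> * (\<Sum>i\<in>UNIV. energy i) + (CARD('n) * (2 * c0\<^sup>2 / \<epsilon> + R\<^sup>2 / \<epsilon>) + K) * q\<^sup>2 + mass"
    by (simp add: sum.distrib flip: sum_distrib_left) (simp add: algebra_simps)
  finally show ?thesis .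
qed

text \<open>The Gagliardo inequality is applied to \<open>(ch * v)\<^sup>2\<close>, whose difference
  is twice the average times the difference of \<open>ch * v\<close>. Young's inequality with a free
  \<open>\<delta>\<close> makes the gradient part as small as desired, however large
  \<open>K\<close> is.\<close>

lemma potential_term:
  assumes \<delta>: "0 < \<delta>"
  shows "MI (\<lambda>x. ch2 x * v x * (b2 x * v x)) \<le>
    K * (2 * \<delta> * (\<Sum>i\<in>UNIV. energy i) + (2 * \<delta> + 1 / \<delta>) * mass)" (is "_ \<le> K * ?X")
proof -
  define u where "u = (\<lambda>x. ch x * v x)"
  have u: "u x = 0" if "x \<notin> primal_mesh h" for x using v[OF that] by (simp add: u_def)
  have u2: "MI (\<lambda>x. (u x)\<^sup>2) \<le> mass"
    unfolding mass_def u_def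
    using ch by (intro mesh_integral_mono h0') (auto simp: power_mult_distrib intro!: mult_left_le_one_le power_le_one)
  have bd: "MD i (\<lambda>y. \<bar>Dh h i (\<lambda>x. (u x)\<^sup>2) y\<bar>) \<le> ?X" for i
  proof -
    have pw: "\<bar>Dh h i (\<lambda>x. (u x)\<^sup>2) y\<bar> \<le>
        (2 * \<delta>) * (Ah h i ch2 y * (Dh h i v y)\<^sup>2) + (2 * \<delta> * (Ah h i v y)\<^sup>2 + 1 / \<delta> * (Ah h i u y)\<^sup>2)" for y
    proof -
      have "Dh h i (\<lambda>x. (u x)\<^sup>2) y = 2 * Dh h i u y * Ah h i u y"
        using Dh_mult[of h i u u y] by (simp add: power2_eq_square)
      then have "\<bar>Dh h i (\<lambda>x. (u x)\<^sup>2) y\<bar> = 2 * \<bar>Dh h i u y\<bar> * \<bar>Ah h i u y\<bar>" by (simp add: abs_mult)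
      also have "\<dots> \<le> \<delta> * \<bar>Dh h i u y\<bar>\<^sup>2 + \<bar>Ah h i u y\<bar>\<^sup>2 / \<delta>" by (rule Young_scaled) fact
      also have "\<dots> = \<delta> * (Dh h i u y)\<^sup>2 + 1 / \<delta> * (Ah h i u y)\<^sup>2" by simp
      also have "(Dh h i u y)\<^sup>2 \<le> 2 * (Ah h i ch2 y * (Dh h i v y)\<^sup>2) + 2 * (Ah h i v y)\<^sup>2"
      proof -
        have "(s + t)\<^sup>2 \<le> 2 * s\<^sup>2 + 2 * t\<^sup>2" for s t :: real
          using sum_squares_bound[of s t] by (simp add: power2_sum)
        from this[of "Ah h i ch y * Dh h i v y" "Dh h i ch y * Ah h i v y"]
        have "(Dh h i u y)\<^sup>2 \<le> 2 * ((Ah h i ch y)\<^sup>2 * (Dh h i v y)\<^sup>2) + 2 * ((Dh h i ch y)\<^sup>2 * (Ah h i v y)\<^sup>2)"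
          unfolding u_def Dh_mult by (simp add: power_mult_distrib)
        also have "\<dots> \<le> 2 * (Ah h i ch2 y * (Dh h i v y)\<^sup>2) + 2 * (1 * (Ah h i v y)\<^sup>2)"
          using ch(4)[of i y]
          by (intro add_mono mult_left_mono mult_right_mono Ah_square_le) (auto simp: abs_square_le_1)
        finally show ?thesis by simp
      qed
      finally show ?thesis using \<delta> by (simp add: algebra_simps)
    qed
    have "MD i (\<lambda>y. \<bar>Dh h i (\<lambda>x. (u x)\<^sup>2) y\<bar>) \<le>
      MD i (\<lambda>y. (2 * \<delta>) * (Ah h i ch2 y * (Dh h i v y)\<^sup>2) + (2 * \<delta> * (Ah h i v y)\<^sup>2 + 1 / \<delta> * (Ah h i u y)\<^sup>2))"
      by (intro mesh_integral_mono h0' pw)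
    also have "\<dots> = 2 * \<delta> * energy i + (2 * \<delta> * MD i (\<lambda>y. (Ah h i v y)\<^sup>2) + 1 / \<delta> * MD i (\<lambda>y. (Ah h i u y)\<^sup>2))"
      unfolding mesh_integral_add mesh_integral_cmult energy_def ..
    also have "\<dots> \<le> 2 * \<delta> * (\<Sum>i\<in>UNIV. energy i) + (2 * \<delta> * mass + 1 / \<delta> * mass)"
    proof (intro add_mono mult_left_mono)
      show "energy i \<le> (\<Sum>i\<in>UNIV. energy i)" by (rule member_le_sum) (auto simp: energy_nonneg)
      show "MD i (\<lambda>y. (Ah h i v y)\<^sup>2) \<le> mass" unfolding mass_def by (rule MD_Ah_square) (rule v)
      show "MD i (\<lambda>y. (Ah h i u y)\<^sup>2) \<le> mass" using MD_Ah_square[of u i, OF u] u2 by linarith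
    qed (use \<delta> in auto)
    finally show ?thesis by (simp add: algebra_simps)
  qed
  have X0: "0 \<le> ?X"
    using \<delta> mass_nonneg by (intro add_nonneg_nonneg mult_nonneg_nonneg sum_nonneg energy_nonneg) auto
  have "MI (\<lambda>x. ch2 x * v x * (b2 x * v x)) \<le> MI (\<lambda>x. \<bar>b2 x\<bar> * (u x)\<^sup>2)"
  proof (intro mesh_integral_mono h0')
    fix x
    have "ch2 x * v x * (b2 x * v x) = b2 x * (u x)\<^sup>2"
      by (simp add: u_def power_mult_distrib power2_eq_square[of "v x"])
    also have "\<dots> \<le> \<bar>b2 x\<bar> * (u x)\<^sup>2" by (intro mult_right_mono) auto
    finally show "ch2 x * v x * (b2 x * v x) \<le> \<bar>b2 x\<bar> * (u x)\<^sup>2" .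
  qed
  also have "\<dots> \<le> MI (\<lambda>x. \<bar>b2 x\<bar> ^ CARD('n)) powr (1 / CARD('n)) * ?X"
    by (rule mesh_Gagliardo[OF n h]) (use u bd in auto)
  also have "\<dots> \<le> K * ?X" by (intro mult_right_mono b2 X0)
  finally show ?thesis .
qed

text \<open>Ellipticity gives a dissipation of \<open>1 / c0\<close> times the energy. The cross
  term of the diffusion, the advection and the potential give back \<open>\<epsilon>\<close>,
  \<open>\<epsilon>\<close> and \<open>2 * \<delta> * K\<close> of it.\<close>

lemma drift_energy_bound:
  assumes \<epsilon>: "0 < \<epsilon>" and \<delta>: "0 < \<delta>"
  shows "MI (\<lambda>x. ch2 x * v x * drift h \<gamma> b1 b2 v x) \<le>
    (2 * \<epsilon> + 2 * \<delta> * K - 1 / c0) * (\<Sum>i\<in>UNIV. energy i)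
    + (CARD('n) * (c0\<^sup>2 / \<epsilon> + R\<^sup>2 / \<epsilon>) + K * (2 * \<delta> + 1 / \<delta>)) * mass"
proof -
  have t1: "MI (\<lambda>x. ch2 x * v x * Dh h i (\<lambda>y. \<gamma> i y * Dh h i v y) x) \<le>
      (\<epsilon> - 1 / c0) * energy i + c0\<^sup>2 / \<epsilon> * mass" for i
  proof -
    have pw: "- (Dh h i (\<lambda>x. ch2 x * v x) y * (\<gamma> i y * Dh h i v y)) \<le>
        (\<epsilon> - 1 / c0) * (Ah h i ch2 y * (Dh h i v y)\<^sup>2) + c0\<^sup>2 / \<epsilon> * (Ah h i v y)\<^sup>2"
      if y: "y \<in> dual h i (primal_mesh h)" for y
    proof -
      have "- (Dh h i (\<lambda>x. ch2 x * v x) y * (\<gamma> i y * Dh h i v y)) =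
         - (\<gamma> i y * (Ah h i ch2 y * (Dh h i v y)\<^sup>2)) - Ah h i v y * (Dh h i ch2 y * (\<gamma> i y * Dh h i v y))"
        unfolding Dh_mult by (simp add: algebra_simps power2_eq_square)
      moreover have "1 / c0 * (Ah h i ch2 y * (Dh h i v y)\<^sup>2) \<le> \<gamma> i y * (Ah h i ch2 y * (Dh h i v y)\<^sup>2)"
        using \<gamma>[OF y] by (intro mult_right_mono mult_nonneg_nonneg Ah_nonneg) auto
      moreover have "\<bar>Ah h i v y * (Dh h i ch2 y * (\<gamma> i y * Dh h i v y))\<bar> \<le>
          \<epsilon> * (Ah h i ch2 y * (Dh h i v y)\<^sup>2) + c0\<^sup>2 / \<epsilon> * (Ah h i v y)\<^sup>2"
        using \<gamma>[OF y] \<gamma>_nonneg[OF y] \<epsilon> by (intro diffusion_cross_term[OF Dh_ch2 Ah_square_le]) auto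
      ultimately show ?thesis unfolding left_diff_distrib by linarith
    qed
    have "MI (\<lambda>x. ch2 x * v x * Dh h i (\<lambda>y. \<gamma> i y * Dh h i v y) x) =
        - MD i (\<lambda>y. Dh h i (\<lambda>x. ch2 x * v x) y * (\<gamma> i y * Dh h i v y))"
      by (rule summation_by_parts_Dh[OF fin]) (simp add: ch)
    also have "\<dots> = MD i (\<lambda>y. - (Dh h i (\<lambda>x. ch2 x * v x) y * (\<gamma> i y * Dh h i v y)))"
      by (simp add: mesh_integral_def sum_negf)
    also have "\<dots> \<le> MD i (\<lambda>y. (\<epsilon> - 1 / c0) * (Ah h i ch2 y * (Dh h i v y)\<^sup>2) + c0\<^sup>2 / \<epsilon> * (Ah h i v y)\<^sup>2)"
      by (intro mesh_integral_mono h0' pw)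
    also have "\<dots> = (\<epsilon> - 1 / c0) * energy i + c0\<^sup>2 / \<epsilon> * MD i (\<lambda>y. (Ah h i v y)\<^sup>2)"
      unfolding mesh_integral_add mesh_integral_cmult energy_def ..
    also have "\<dots> \<le> (\<epsilon> - 1 / c0) * energy i + c0\<^sup>2 / \<epsilon> * mass"
      unfolding mass_def using \<epsilon> v by (intro add_left_mono mult_left_mono MD_Ah_square) auto
    finally show ?thesis .
  qed
  have t2: "MI (\<lambda>x. ch2 x * v x * (b1 i x * Ah h i (Dh h i v) x)) \<le> \<epsilon> * energy i + R\<^sup>2 / \<epsilon> * mass" for i
  proof -
    have "MI (\<lambda>x. ch2 x * v x * (b1 i x * Ah h i (Dh h i v) x)) \<le>
        MI (\<lambda>x. \<epsilon> * (ch2 x * (Ah h i (Dh h i v) x)\<^sup>2) + R\<^sup>2 / \<epsilon> * (v x)\<^sup>2)"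
    proof (intro mesh_integral_mono h0')
      fix x :: "real ^ 'n" assume "x \<in> primal_mesh h"
      from advection_term[OF ch(1,2) b1[OF this] \<epsilon>, of "v x" x i "Ah h i (Dh h i v) x"]
      show "ch2 x * v x * (b1 i x * Ah h i (Dh h i v) x) \<le> \<epsilon> * (ch2 x * (Ah h i (Dh h i v) x)\<^sup>2) + R\<^sup>2 / \<epsilon> * (v x)\<^sup>2"
        by (simp add: mult_ac)
    qed
    also have "\<dots> = \<epsilon> * MI (\<lambda>x. ch2 x * (Ah h i (Dh h i v) x)\<^sup>2) + R\<^sup>2 / \<epsilon> * mass"
      unfolding mesh_integral_add mesh_integral_cmult mass_def ..
    also have "\<dots> \<le> \<epsilon> * energy i + R\<^sup>2 / \<epsilon> * mass"
      using \<epsilon> by (intro add_right_mono mult_left_mono MI_Ah_Dh) auto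
    finally show ?thesis .
  qed
  have "MI (\<lambda>x. ch2 x * v x * drift h \<gamma> b1 b2 v x) \<le>
     (\<Sum>i\<in>(UNIV::'n set). (\<epsilon> - 1 / c0) * energy i + c0\<^sup>2 / \<epsilon> * mass)
     + (\<Sum>i\<in>(UNIV::'n set). \<epsilon> * energy i + R\<^sup>2 / \<epsilon> * mass)
     + K * (2 * \<delta> * (\<Sum>i\<in>UNIV. energy i) + (2 * \<delta> + 1 / \<delta>) * mass)"
    unfolding MI_drift by (intro add_mono sum_mono t1 t2 potential_term \<delta>)
  also have "\<dots> = (2 * \<epsilon> + 2 * \<delta> * K - 1 / c0) * (\<Sum>i\<in>UNIV. energy i)
    + (CARD('n) * (c0\<^sup>2 / \<epsilon> + R\<^sup>2 / \<epsilon>) + K * (2 * \<delta> + 1 / \<delta>)) * mass"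
    by (simp add: sum.distrib flip: sum_distrib_left) (simp add: algebra_simps)
  finally show ?thesis .
qed

lemma pairing_square_le: "(MI (\<lambda>x. ch2 x * v x))\<^sup>2 \<le> mass"
  unfolding mass_def using ch by (intro mesh_pairing_square_le[OF h]) (auto intro: power_le_one)

text \<open>\<open>\<epsilon>'\<close> and \<open>\<delta>\<close> each spend a quarter of the
  dissipation \<open>1 / c0\<close>, so half of it remains. Then \<open>\<epsilon>\<close> is fixed
  so that the energy \<open>4 * \<epsilon>\<close> of the pairing term equals the remaining
  \<open>\<theta> / c0\<close>, and the two cancel for every positive
  \<open>\<theta>\<close>.\<close>

lemma drift_quadratic_bound:
  assumes \<theta>: "0 < \<theta>"
  defines "\<epsilon> \<equiv> \<theta> / (4 * c0)" and "\<epsilon>' \<equiv> 1 / (8 * c0)" and "\<delta> \<equiv> 1 / (8 * c0 * K)"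
  shows "- 2 * MI (\<lambda>x. ch2 x * v x) * MI (\<lambda>x. ch2 x * drift h \<gamma> b1 b2 v x)
      + 2 * \<theta> * MI (\<lambda>x. ch2 x * v x * drift h \<gamma> b1 b2 v x) \<le>
    (2 * (CARD('n) * (2 * c0\<^sup>2 / \<epsilon> + R\<^sup>2 / \<epsilon>) + K + 1) +
      2 * \<theta> * (CARD('n) * (c0\<^sup>2 / \<epsilon>' + R\<^sup>2 / \<epsilon>') + K * (2 * \<delta> + 1 / \<delta>))) * mass"
proof -
  define p where "p = MI (\<lambda>x. ch2 x * v x)"
  define E where "E = (\<Sum>i\<in>UNIV. energy i)"
  define k where "k = CARD('n) * (2 * c0\<^sup>2 / \<epsilon> + R\<^sup>2 / \<epsilon>) + K"
  define k' where "k' = CARD('n) * (c0\<^sup>2 / \<epsilon>' + R\<^sup>2 / \<epsilon>') + K * (2 * \<delta> + 1 / \<delta>)"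
  have pos: "0 < \<epsilon>" "0 < \<epsilon>'" "0 < \<delta>" using \<theta> c0 K by (auto simp: \<epsilon>_def \<epsilon>'_def \<delta>_def)
  have "0 \<le> k" using pos K by (auto simp: k_def)
  then have kp: "k * p\<^sup>2 \<le> k * mass" unfolding p_def by (intro mult_left_mono pairing_square_le)
  have 1: "\<bar>p * MI (\<lambda>x. ch2 x * drift h \<gamma> b1 b2 v x)\<bar> \<le> 2 * \<epsilon> * E + k * p\<^sup>2 + mass"
    unfolding E_def k_def by (rule drift_pairing_bound[OF pos(1)])
  have 2: "MI (\<lambda>x. ch2 x * v x * drift h \<gamma> b1 b2 v x) \<le> (2 * \<epsilon>' + 2 * \<delta> * K - 1 / c0) * E + k' * mass"
    unfolding E_def k'_def by (rule drift_energy_bound[OF pos(2,3)])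
  have e: "2 * \<epsilon>' + 2 * \<delta> * K - 1 / c0 = - 1 / (2 * c0)"
    using c0 K by (simp add: \<epsilon>'_def \<delta>_def field_simps)
  have "\<theta> * MI (\<lambda>x. ch2 x * v x * drift h \<gamma> b1 b2 v x) \<le> \<theta> * ((- 1 / (2 * c0)) * E + k' * mass)"
    using 2 \<theta> unfolding e by (intro mult_left_mono) auto
  also have "\<dots> = - 2 * \<epsilon> * E + \<theta> * k' * mass" using c0 by (simp add: \<epsilon>_def field_simps)
  finally have 3: "\<theta> * MI (\<lambda>x. ch2 x * v x * drift h \<gamma> b1 b2 v x) \<le> - 2 * \<epsilon> * E + \<theta> * k' * mass" .
  have "- 2 * p * MI (\<lambda>x. ch2 x * drift h \<gamma> b1 b2 v x) = - 2 * (p * MI (\<lambda>x. ch2 x * drift h \<gamma> b1 b2 v x))"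
    by simp
  also have "\<dots> \<le> 2 * (2 * \<epsilon> * E + k * mass + mass)"
    using abs_le_D2[OF 1] kp by (simp add: algebra_simps)
  finally have "- 2 * p * MI (\<lambda>x. ch2 x * drift h \<gamma> b1 b2 v x) \<le> 2 * (2 * \<epsilon> * E + k * mass + mass)" .
  then have "- 2 * p * MI (\<lambda>x. ch2 x * drift h \<gamma> b1 b2 v x)
      + 2 * \<theta> * MI (\<lambda>x. ch2 x * v x * drift h \<gamma> b1 b2 v x) \<le> 2 * (k * mass + mass) + 2 * (\<theta> * k' * mass)"
    using 3 by (simp add: algebra_simps)
  then show ?thesis unfolding p_def k_def[symmetric] k'_def[symmetric] by (simp add: algebra_simps)
qed

end

section \<open>Harnack inequality and cutoff\<close>

text \<open>\<open>q\<close> will be \<open>C0 * h / 2\<close>. The bound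
  \<open>q \<le> 1 / 2\<close> excludes a change of sign and gives
  \<open>(1 + q) / (1 - q) \<le> 1 + 4 * q\<close>. The exponential form lets the costs of
  successive steps multiply.\<close>

lemma neighbour_ratio:
  fixes a b q :: real
  assumes "\<bar>a - b\<bar> \<le> q * \<bar>a + b\<bar>" "0 \<le> q" "q \<le> 1 / 2"
  shows "sgn a = sgn b" "\<bar>a\<bar> \<le> exp (4 * q) * \<bar>b\<bar>"
proof -
  have "q * \<bar>a + b\<bar> \<le> 1 / 2 * \<bar>a + b\<bar>" using assms by (intro mult_right_mono) auto
  then have "\<bar>a - b\<bar> \<le> 1 / 2 * \<bar>a + b\<bar>" using assms by linarith
  then show "sgn a = sgn b" by (auto simp: sgn_real_def abs_if split: if_splits)
  have "\<bar>a\<bar> - \<bar>b\<bar> \<le> q * \<bar>a + b\<bar>" using assms by linarith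
  also have "\<dots> \<le> q * (\<bar>a\<bar> + \<bar>b\<bar>)" using assms by (intro mult_left_mono) auto
  finally have "(1 - q) * \<bar>a\<bar> \<le> (1 + q) * \<bar>b\<bar>" by (simp add: algebra_simps)
  also have "\<dots> \<le> ((1 - q) * (1 + 4 * q)) * \<bar>b\<bar>"
  proof (intro mult_right_mono)
    have "0 \<le> 2 * q * (1 - 2 * q)" using assms by (intro mult_nonneg_nonneg) auto
    then show "1 + q \<le> (1 - q) * (1 + 4 * q)" by (simp add: algebra_simps)
  qed auto
  finally have "(1 - q) * \<bar>a\<bar> \<le> (1 - q) * ((1 + 4 * q) * \<bar>b\<bar>)" by (simp add: mult.assoc)
  then have "\<bar>a\<bar> \<le> (1 + 4 * q) * \<bar>b\<bar>" by (rule mult_left_le_imp_le) (use assms in auto)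
  also have "\<dots> \<le> exp (4 * q) * \<bar>b\<bar>" by (intro mult_right_mono) auto
  finally show "\<bar>a\<bar> \<le> exp (4 * q) * \<bar>b\<bar>" .
qed

text \<open>Induction on the l1 distance: one coordinate moves towards \<open>z'\<close>, which
  keeps the path inside the cube.\<close>

lemma lattice_path_Harnack:
  fixes G :: "('n::finite \<Rightarrow> int) \<Rightarrow> real"
  assumes step: "\<And>z i. \<forall>j. z j \<in> {1..m} \<Longrightarrow> z i + 1 \<le> m \<Longrightarrow>
      sgn (G z) = sgn (G (z(i := z i + 1))) \<and> \<bar>G z\<bar> \<le> exp c * \<bar>G (z(i := z i + 1))\<bar> \<and>
      \<bar>G (z(i := z i + 1))\<bar> \<le> exp c * \<bar>G z\<bar>"
    and z': "\<forall>j. z' j \<in> {1..m}"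
  shows "\<forall>j. z j \<in> {1..m} \<Longrightarrow> (\<Sum>i\<in>UNIV. \<bar>z i - z' i\<bar>) = int d \<Longrightarrow>
    sgn (G z) = sgn (G z') \<and> \<bar>G z\<bar> \<le> exp (c * real d) * \<bar>G z'\<bar>"
proof (induction d arbitrary: z)
  case 0
  then have "\<forall>i\<in>UNIV. \<bar>z i - z' i\<bar> = 0" by (subst (asm) of_nat_0, subst (asm) sum_nonneg_eq_0_iff) auto
  then have "z = z'" by auto
  then show ?case by simp
next
  case (Suc d)
  have "\<exists>i. z i \<noteq> z' i"
  proof (rule ccontr)
    assume "\<nexists>i. z i \<noteq> z' i"
    then show False using Suc.prems(2) by simp
  qed
  then obtain i where i: "z i \<noteq> z' i" by blast
  define y where "y = z(i := if z i < z' i then z i + 1 else z i - 1)"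
  have y: "\<forall>j. y j \<in> {1..m}" using Suc.prems(1) z' i by (auto simp: y_def) (smt (verit))+
  have rem: "(\<Sum>j\<in>UNIV. f j) = f i + (\<Sum>j\<in>UNIV - {i}. f j)" for f :: "'n \<Rightarrow> int"
    by (rule sum.remove) auto
  have "(\<Sum>j\<in>UNIV - {i}. \<bar>y j - z' j\<bar>) = (\<Sum>j\<in>UNIV - {i}. \<bar>z j - z' j\<bar>)"
    by (intro sum.cong) (auto simp: y_def)
  moreover have "\<bar>y i - z' i\<bar> = \<bar>z i - z' i\<bar> - 1" using i by (auto simp: y_def)
  ultimately have "(\<Sum>j\<in>UNIV. \<bar>y j - z' j\<bar>) = int d"
    using Suc.prems(2) unfolding rem by simp
  from Suc.IH[OF y this] have IH: "sgn (G y) = sgn (G z')" "\<bar>G y\<bar> \<le> exp (c * real d) * \<bar>G z'\<bar>" by auto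
  have st: "sgn (G z) = sgn (G y) \<and> \<bar>G z\<bar> \<le> exp c * \<bar>G y\<bar>"
  proof (cases "z i < z' i")
    case True
    then have "z i + 1 \<le> m" using z'[rule_format, of i] by simp
    then show ?thesis using step[OF Suc.prems(1), of i] True by (simp add: y_def)
  next
    case False
    then have "y(i := y i + 1) = z" "y i + 1 \<le> m" using Suc.prems(1) by (auto simp: y_def)
    then show ?thesis using step[OF y, of i] by simp
  qed
  have "\<bar>G z\<bar> \<le> exp c * (exp (c * real d) * \<bar>G z'\<bar>)"
    using st IH(2) by (meson exp_ge_zero mult_left_mono order_trans)
  then show ?case using st IH(1) by (simp add: exp_add algebra_simps)
qed

text \<open>Two mesh points are joined by at most \<open>CARD('n) * N\<close> steps of cost
  \<open>2 * C0 * h\<close>, and \<open>h * N\<close> is below 1, so the accumulated exponent has a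
  bound free of \<open>h\<close>.\<close>

lemma mesh_Harnack:
  fixes g :: "real ^ 'n \<Rightarrow> real"
  assumes h: "h = 1 / (real N + 1)" and C0: "0 < C0" "C0 * h \<le> 1"
    and g: "\<And>i y. y \<in> dual h i (primal_mesh h) \<Longrightarrow> \<bar>Dh h i g y\<bar> \<le> C0 * \<bar>Ah h i g y\<bar>"
    and x: "x \<in> primal_mesh h" "x' \<in> primal_mesh h"
  shows "sgn (g x) = sgn (g x')" "\<bar>g x\<bar> \<le> exp (2 * C0 * CARD('n)) * \<bar>g x'\<bar>"
proof -
  have hpos: "0 < h" by (simp add: h)
  obtain z z' where z: "x = grid h z" "\<forall>j. z j \<in> {1..int N}" and z': "x' = grid h z'" "\<forall>j. z' j \<in> {1..int N}"
    using x unfolding primal_mesh_eq_grid[OF h] by blast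
  let ?G = "\<lambda>z. g (grid h z)"
  have step: "sgn (?G z) = sgn (?G (z(i := z i + 1))) \<and> \<bar>?G z\<bar> \<le> exp (2 * C0 * h) * \<bar>?G (z(i := z i + 1))\<bar> \<and>
      \<bar>?G (z(i := z i + 1))\<bar> \<le> exp (2 * C0 * h) * \<bar>?G z\<bar>"
    if "\<forall>j. z j \<in> {1..int N}" for z i
  proof -
    let ?y = "grid h z + (h / 2) *\<^sub>R axis i 1"
    have yp: "?y + (h / 2) *\<^sub>R axis i 1 = grid h (z(i := z i + 1))"
      unfolding grid_upd scaleR_half_add_half[of h "axis i 1", symmetric] by (simp add: add.assoc)
    have "grid h z \<in> primal_mesh h" using that grid_in_mesh_iff[OF h] by blast
    then have "?y \<in> dual h i (primal_mesh h)" by (auto simp: dual_def)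
    from g[OF this] have d: "\<bar>?G (z(i := z i + 1)) - ?G z\<bar> / h \<le> C0 * (\<bar>?G (z(i := z i + 1)) + ?G z\<bar> / 2)"
      unfolding Dh_def Ah_def yp using hpos by simp
    let ?a = "?G (z(i := z i + 1))" and ?b = "?G z"
    have q: "\<bar>?a - ?b\<bar> \<le> (C0 * h / 2) * \<bar>?a + ?b\<bar>"
      using d hpos by (simp add: field_simps)
    then have q': "\<bar>?b - ?a\<bar> \<le> (C0 * h / 2) * \<bar>?b + ?a\<bar>" by (simp add: abs_minus_commute add.commute)
    have e: "4 * (C0 * h / 2) = 2 * C0 * h" by simp
    have b: "0 \<le> C0 * h / 2" "C0 * h / 2 \<le> 1 / 2" using C0 hpos by auto
    show ?thesis using neighbour_ratio[OF q b] neighbour_ratio[OF q' b] unfolding e by simp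
  qed
  define d where "d = nat (\<Sum>i\<in>UNIV. \<bar>z i - z' i\<bar>)"
  have d: "(\<Sum>i\<in>UNIV. \<bar>z i - z' i\<bar>) = int d" by (simp add: d_def sum_nonneg)
  have "(\<Sum>i\<in>UNIV. \<bar>z i - z' i\<bar>) \<le> (\<Sum>i\<in>(UNIV :: 'n set). int N)"
  proof (rule sum_mono)
    fix i show "\<bar>z i - z' i\<bar> \<le> int N" using z(2)[rule_format, of i] z'(2)[rule_format, of i] by auto
  qed
  then have "int d \<le> int (CARD('n) * N)" unfolding d by simp
  then have "real d \<le> real CARD('n) * real N" by (metis of_nat_le_iff of_nat_mult)
  then have "h * real d \<le> h * (real CARD('n) * real N)" using hpos by (intro mult_left_mono) auto
  also have "\<dots> \<le> real CARD('n)" unfolding h by (simp add: field_simps)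
  finally have dn: "2 * C0 * h * real d \<le> 2 * C0 * CARD('n)"
    using C0 by (simp add: mult.assoc)
  have *: "sgn (?G z) = sgn (?G z') \<and> \<bar>?G z\<bar> \<le> exp (2 * C0 * h * real d) * \<bar>?G z'\<bar>"
    by (rule lattice_path_Harnack[of "int N" ?G "2 * C0 * h", OF _ z'(2) z(2) d]) (use step in blast)
  then show "sgn (g x) = sgn (g x')" using z z' by simp
  have "exp (2 * C0 * h * real d) * \<bar>?G z'\<bar> \<le> exp (2 * C0 * CARD('n)) * \<bar>?G z'\<bar>"
    using dn by (intro mult_right_mono) auto
  then show "\<bar>g x\<bar> \<le> exp (2 * C0 * CARD('n)) * \<bar>g x'\<bar>" using * z z' by simp
qed

text \<open>A lower bound uniform in \<open>h\<close>. In the cube of half side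
  \<open>\<delta> = r / (2 * n)\<close> around \<open>x0\<close>, bounding the norm by the l1 norm
  keeps the distance at most \<open>r / 2\<close>, so the bump is at least \<open>r / 2\<close>.
  Each axis carries at least \<open>2 * \<delta> / h - 1\<close> lattice coordinates, and the
  assumption on \<open>h\<close> makes this at least \<open>\<delta> / h\<close>.\<close>

lemma cutoff_volume:
  fixes x0 :: "real ^ 'n"
  assumes r: "0 < r" and sub: "ball x0 r \<subseteq> unit_cube" and h: "h = 1 / (real N + 1)"
    and hr: "h \<le> r / (2 * CARD('n))"
  shows "(r / (2 * CARD('n))) ^ CARD('n) * (r / 2)\<^sup>2 \<le>
    mesh_integral h (primal_mesh h) (\<lambda>x. (max 0 (r - dist x x0))\<^sup>2)"
proof -
  let ?n = "CARD('n)"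
  define \<delta> where "\<delta> = r / (2 * ?n)"
  have hpos: "0 < h" by (simp add: h)
  define A where "A = (\<lambda>i. {\<lceil>(x0 $ i - \<delta>) / h\<rceil>..\<lfloor>(x0 $ i + \<delta>) / h\<rfloor>})"
  let ?Z = "{z. \<forall>i. z i \<in> A i}"
  have dist: "dist (grid h z) x0 \<le> r / 2" if "z \<in> ?Z" for z
  proof -
    have c: "\<bar>h * of_int (z i) - x0 $ i\<bar> \<le> \<delta>" for i
    proof -
      have "z i \<in> A i" using that by simp
      then have "(x0 $ i - \<delta>) / h \<le> of_int (z i)" "of_int (z i) \<le> (x0 $ i + \<delta>) / h"
        unfolding A_def by (simp_all add: ceiling_le_iff le_floor_iff)
      then show ?thesis using hpos by (simp add: field_simps abs_le_iff)
    qed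
    have "dist (grid h z) x0 \<le> (\<Sum>i\<in>UNIV. \<bar>(grid h z - x0) $ i\<bar>)"
      unfolding dist_norm by (rule norm_le_l1_cart)
    also have "\<dots> \<le> (\<Sum>i\<in>(UNIV :: 'n set). \<delta>)" using c by (intro sum_mono) (simp add: grid_def)
    also have "\<dots> = r / 2" by (simp add: \<delta>_def)
    finally show ?thesis .
  qed
  have sub': "grid h ` ?Z \<subseteq> primal_mesh h"
  proof
    fix x assume "x \<in> grid h ` ?Z"
    then obtain z where z: "x = grid h z" "z \<in> ?Z" by blast
    then have "x \<in> ball x0 r" using dist[OF z(2)] r by (simp add: dist_commute)
    then show "x \<in> primal_mesh h" using sub z(1) by (auto simp: primal_mesh_def grid_def)
  qed
  have cardA: "\<delta> / h \<le> real (card (A i))" for i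
  proof -
    have "2 * \<delta> / h = (x0 $ i + \<delta>) / h - (x0 $ i - \<delta>) / h" by (simp flip: diff_divide_distrib)
    also have "\<dots> \<le> (of_int \<lfloor>(x0 $ i + \<delta>) / h\<rfloor> + 1) - (of_int \<lceil>(x0 $ i - \<delta>) / h\<rceil> - 1)"
      by (intro diff_mono) linarith+
    also have "\<dots> \<le> real (card (A i)) + 1" unfolding A_def by simp
    finally have "2 * \<delta> / h \<le> real (card (A i)) + 1" .
    moreover have "1 \<le> \<delta> / h" using hr hpos le_divide_eq_1_pos[of h \<delta>] by (simp only: \<delta>_def)
    moreover have "2 * \<delta> / h = \<delta> / h + \<delta> / h" by (simp add: add_divide_distrib[symmetric])
    ultimately show ?thesis by linarith
  qed
  have \<delta>0: "0 \<le> \<delta>" using r by (simp add: \<delta>_def)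
  have "(\<delta> / h) ^ ?n = (\<Prod>i\<in>(UNIV :: 'n set). \<delta> / h)" by simp
  also have "\<dots> \<le> (\<Prod>i\<in>UNIV. real (card (A i)))" using cardA \<delta>0 hpos by (intro prod_mono) auto
  also have "\<dots> = real (card (grid h ` ?Z))"
    using card_image[OF inj_on_subset[OF grid_inj[of h]], of ?Z] hpos card_int_cube[of A] by simp
  finally have card: "(\<delta> / h) ^ ?n \<le> real (card (grid h ` ?Z))" .
  have "\<delta> ^ ?n * (r / 2)\<^sup>2 = h ^ ?n * ((\<delta> / h) ^ ?n * (r / 2)\<^sup>2)" using hpos by (simp add: power_divide)
  also have "\<dots> \<le> h ^ ?n * (real (card (grid h ` ?Z)) * (r / 2)\<^sup>2)"
    using card hpos by (intro mult_left_mono mult_right_mono) auto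
  also have "\<dots> = h ^ ?n * (\<Sum>x\<in>grid h ` ?Z. (r / 2)\<^sup>2)" by simp
  also have "\<dots> \<le> h ^ ?n * (\<Sum>x\<in>grid h ` ?Z. (max 0 (r - dist x x0))\<^sup>2)"
    using dist hpos r by (intro mult_left_mono sum_mono power_mono) (auto, smt (verit, best) mem_Collect_eq)
  also have "\<dots> \<le> h ^ ?n * (\<Sum>x\<in>primal_mesh h. (max 0 (r - dist x x0))\<^sup>2)"
    using sub' finite_primal_mesh[OF h] hpos by (intro mult_left_mono sum_mono2) auto
  finally show ?thesis by (simp add: mesh_integral_def \<delta>_def)
qed

text \<open>\<open>reg\<close> controls the coefficients almost everywhere, while the scheme samples
  them at points. By continuity the set where the bound fails is open, and an open null set is
  empty.\<close>

lemma diffusion_coeffs_bounds: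
  fixes \<gamma> :: "'n::finite \<Rightarrow> real ^ 'n \<Rightarrow> real"
  assumes d: "diffusion_coeffs \<gamma>" and reg: "reg \<gamma> < ereal c0" and x: "x \<in> unit_cube"
  shows "1 / c0 \<le> \<gamma> i x" "\<gamma> i x \<le> c0"
proof -
  let ?f = "\<lambda>x. \<gamma> i x + 1 / \<gamma> i x"
  let ?F = "\<lambda>x. ereal (?f x + (\<Sum>j\<in>UNIV. \<bar>weak_partial unit_cube j (\<gamma> i) x\<bar>\<^sup>2))"
  have cont: "continuous_on unit_cube (\<gamma> i)" and pos: "\<And>x. x \<in> unit_cube \<Longrightarrow> 0 < \<gamma> i x"
    using d by (auto simp: diffusion_coeffs_def)
  have op: "open (unit_cube :: (real ^ 'n) set)"
  proof -
    have "(unit_cube :: (real ^ 'n) set) = box 0 1" by (auto simp: unit_cube_def mem_box_cart)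
    then show ?thesis by (metis open_box)
  qed
  have "esssup (lebesgue_on unit_cube) ?F \<le> reg \<gamma>"
    unfolding reg_def by (rule SUP_upper) simp
  then have le: "esssup (lebesgue_on unit_cube) ?F < ereal c0" using reg by simp
  have "AE x in lebesgue_on unit_cube. ?F x \<le> esssup (lebesgue_on unit_cube) ?F" by (rule esssup_AE)
  then have ae: "AE x in lebesgue_on unit_cube. ?f x \<le> c0"
  proof eventually_elim
    case (elim x)
    then have "?F x < ereal c0" using le by (rule order_le_less_trans)
    then have "?f x + (\<Sum>j\<in>UNIV. \<bar>weak_partial unit_cube j (\<gamma> i) x\<bar>\<^sup>2) < c0" by simp
    moreover have "0 \<le> (\<Sum>j\<in>UNIV. \<bar>weak_partial unit_cube j (\<gamma> i) x\<bar>\<^sup>2)" by (intro sum_nonneg) auto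
    ultimately show ?case by linarith
  qed
  have um: "unit_cube \<in> sets (lebesgue :: (real ^ 'n) measure)" using op by (simp add: lebesgue_openin)
  let ?S = "{x \<in> unit_cube. c0 < ?f x}"
  have "continuous_on unit_cube ?f"
    using pos by (intro continuous_intros cont) (auto simp: less_le)
  then have "openin (top_of_set unit_cube) (unit_cube \<inter> ?f -` {c0<..})"
    by (rule continuous_openin_preimage_gen) simp
  moreover have "unit_cube \<inter> ?f -` {c0<..} = ?S" by auto
  ultimately have opS: "open ?S" using op openin_open_trans by fastforce
  have "AE x in lebesgue. x \<in> unit_cube \<longrightarrow> ?f x \<le> c0"
    using ae um by (subst (asm) AE_restrict_space_iff) auto
  then have "AE x in lebesgue. x \<notin> ?S" by eventually_elim auto
  then have "?S \<in> null_sets lebesgue"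
    using AE_iff_null_sets[of ?S lebesgue] opS by auto
  then have "negligible ?S" by (simp add: negligible_iff_null_sets)
  then have "?S = {}" using opS open_not_negligible by blast
  then have f: "?f x \<le> c0" using x by force
  have p: "0 < \<gamma> i x" using pos[OF x] .
  then show "\<gamma> i x \<le> c0" using f by (smt (verit) divide_pos_pos)
  have inv: "1 / \<gamma> i x \<le> c0" using f p by linarith
  have "0 < c0" using p \<open>\<gamma> i x \<le> c0\<close> by linarith
  then show "1 / c0 \<le> \<gamma> i x" using inv p by (simp add: field_simps)
qed

lemma dual_subset_unit_cube:
  assumes h: "h = 1 / (real N + 1)"
  shows "dual h i (primal_mesh h) \<subseteq> (unit_cube :: (real ^ 'n) set)"
proof
  fix y :: "real ^ 'n" assume "y \<in> dual h i (primal_mesh h)"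
  then obtain z s where z: "\<forall>j. z j \<in> {1..int N}" and s: "s = h / 2 \<or> s = - h / 2" and y: "y = grid h z + s *\<^sub>R axis i 1"
    unfolding dual_def primal_mesh_eq_grid[OF h] by fastforce
  have hpos: "0 < h" by (simp add: h)
  have "0 < y $ j \<and> y $ j < 1" for j
  proof -
    have "1 \<le> z j" "z j \<le> int N" using z by auto
    then have "1 \<le> real_of_int (z j)" "real_of_int (z j) \<le> real N" by linarith+
    then have "h * 1 \<le> h * of_int (z j)" "h * of_int (z j) \<le> h * real N"
      using hpos by (simp_all del: mult_1_right)
    moreover have "h * real N = 1 - h" unfolding h by (simp add: field_simps)
    moreover have "y $ j = h * of_int (z j) + (if j = i then s else 0)" unfolding y grid_def by (simp add: axis_def)
    moreover have "- h / 2 \<le> (if j = i then s else 0)" "(if j = i then s else 0) \<le> h / 2" using s hpos by auto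
    ultimately show ?thesis using hpos by linarith
  qed
  then show "y \<in> unit_cube" by (simp add: unit_cube_def)
qed

section \<open>The semi-discrete equation\<close>

lemma drift_cong_local:
  assumes "f x = f' x"
    and "\<And>i. f (x + (h / 2) *\<^sub>R axis i 1 + (h / 2) *\<^sub>R axis i 1) = f' (x + (h / 2) *\<^sub>R axis i 1 + (h / 2) *\<^sub>R axis i 1)"
    and "\<And>i. f (x - (h / 2) *\<^sub>R axis i 1 - (h / 2) *\<^sub>R axis i 1) = f' (x - (h / 2) *\<^sub>R axis i 1 - (h / 2) *\<^sub>R axis i 1)"
  shows "drift h \<gamma> b1 b2 f x = drift h \<gamma> b1 b2 f' x"
  using assms by (simp add: drift_def Dh_def Ah_def)

lemma drift_cong:
  assumes f: "\<And>y. y \<in> primal_mesh h \<union> mesh_boundary h \<Longrightarrow> f y = f' y" and x: "x \<in> primal_mesh h"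
  shows "drift h \<gamma> b1 b2 f x = drift h \<gamma> b1 b2 f' x"
proof (rule drift_cong_local)
  fix i
  have "x + (h / 2) *\<^sub>R axis i 1 + (h / 2) *\<^sub>R axis i 1 \<in> dual h i (dual h i (primal_mesh h))"
    "x - (h / 2) *\<^sub>R axis i 1 - (h / 2) *\<^sub>R axis i 1 \<in> dual h i (dual h i (primal_mesh h))"
    using x unfolding dual_def by blast+
  then have "x + (h / 2) *\<^sub>R axis i 1 + (h / 2) *\<^sub>R axis i 1 \<in> primal_mesh h \<union> mesh_boundary h"
    "x - (h / 2) *\<^sub>R axis i 1 - (h / 2) *\<^sub>R axis i 1 \<in> primal_mesh h \<union> mesh_boundary h"
    by (auto simp: mesh_boundary_def)
  then show "f (x + (h / 2) *\<^sub>R axis i 1 + (h / 2) *\<^sub>R axis i 1) = f' (x + (h / 2) *\<^sub>R axis i 1 + (h / 2) *\<^sub>R axis i 1)"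
    "f (x - (h / 2) *\<^sub>R axis i 1 - (h / 2) *\<^sub>R axis i 1) = f' (x - (h / 2) *\<^sub>R axis i 1 - (h / 2) *\<^sub>R axis i 1)"
    using f by blast+
qed (use f x in blast)

lemma drift_diff: "drift h \<gamma> b1 b2 (\<lambda>y. f y - f' y) x = drift h \<gamma> b1 b2 f x - drift h \<gamma> b1 b2 f' x"
proof -
  have D: "Dh h i (\<lambda>y. p y - q y) z = Dh h i p z - Dh h i q z" for i p q and z :: "real ^ 'a"
    by (simp add: Dh_def diff_divide_distrib[symmetric])
  have A: "Ah h i (\<lambda>y. p y - q y) z = Ah h i p z - Ah h i q z" for i p q and z :: "real ^ 'a"
    by (simp add: Ah_def field_simps)
  have D': "Dh h i (\<lambda>y. p y - q y) = (\<lambda>z. Dh h i p z - Dh h i q z)" for i and p q :: "real ^ 'a \<Rightarrow> real"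
    using D by blast
  show ?thesis unfolding drift_def D' right_diff_distrib D A sum_subtractf by simp
qed

lemma drift_measurable:
  assumes f: "\<And>y. (\<lambda>p. f p y) \<in> borel_measurable Q"
    and b: "\<And>i. (\<lambda>p. b1 p i x) \<in> borel_measurable Q" "(\<lambda>p. b2 p x) \<in> borel_measurable Q"
  shows "(\<lambda>p. drift h \<gamma> (b1 p) (b2 p) (f p) x) \<in> borel_measurable Q"
  unfolding drift_def Dh_def Ah_def
  by (intro borel_measurable_add borel_measurable_sum borel_measurable_times borel_measurable_divide
      borel_measurable_diff borel_measurable_const f b)

lemma drift_square_integrable:
  assumes f: "\<And>y. square_integrable Q (\<lambda>p. f p y)"
    and b: "\<And>i. (\<lambda>p. b1 p i x) \<in> borel_measurable Q" "(\<lambda>p. b2 p x) \<in> borel_measurable Q"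
    and bd: "\<And>i. AE p in Q. \<bar>b1 p i x\<bar> \<le> k" "AE p in Q. \<bar>b2 p x\<bar> \<le> k"
  shows "square_integrable Q (\<lambda>p. drift h \<gamma> (b1 p) (b2 p) (f p) x)"
proof -
  have D: "square_integrable Q (\<lambda>p. Dh h i (F p) y)" if "\<And>y. square_integrable Q (\<lambda>p. F p y)" for F i y
    using square_integrable_cmult[OF square_integrable_diff[OF that that], of "1 / h"] by (simp add: Dh_def)
  have A: "square_integrable Q (\<lambda>p. Ah h i (F p) y)" if "\<And>y. square_integrable Q (\<lambda>p. F p y)" for F i y
    using square_integrable_cmult[OF square_integrable_add[OF that that], of "1 / 2"] by (simp add: Ah_def)
  show ?thesis unfolding drift_def
    by (intro square_integrable_add square_integrable_sum D A f square_integrable_cmult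
        square_integrable_mult_bounded[of _ _ _ k] b bd)
qed

lemma L2_norm_square: "0 \<le> h \<Longrightarrow> (L2_norm h W f)\<^sup>2 = mesh_integral h W (\<lambda>x. (f x)\<^sup>2)"
  unfolding L2_norm_def by (simp add: mesh_integral_nonneg)

lemma component_le_L2_norm:
  fixes f :: "real ^ 'n \<Rightarrow> real"
  assumes "0 \<le> h" "finite W" "x \<in> W"
  shows "h ^ CARD('n) * (f x)\<^sup>2 \<le> (L2_norm h W f)\<^sup>2"
  unfolding L2_norm_square[OF assms(1)] mesh_integral_def using assms
  by (intro mult_left_mono member_le_sum) auto

lemma L2_norm_le_H1_norm: "0 \<le> h \<Longrightarrow> (L2_norm h (primal_mesh h) f)\<^sup>2 \<le> (H1_norm h f)\<^sup>2"
  unfolding H1_norm_def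
  by (subst real_sqrt_pow2) (auto intro!: add_nonneg_nonneg sum_nonneg mesh_integral_nonneg)

context brownian
begin

text \<open>The constant \<open>c\<close> may degenerate with \<open>h\<close>, since only
  finiteness is extracted.\<close>

lemma L2F_component_square_integrable:
  fixes u :: "real \<Rightarrow> 'w \<Rightarrow> real ^ 'n \<Rightarrow> real"
  assumes u: "u \<in> L2F M F T P nrm" and x: "x \<in> P" and c: "0 < c" "\<And>f. c * (f x)\<^sup>2 \<le> (nrm f)\<^sup>2"
  shows "square_integrable (PT T) (\<lambda>(t, \<omega>). u t \<omega> x)"
  unfolding square_integrable_iff_nn
proof
  show m: "(\<lambda>(t, \<omega>). u t \<omega> x) \<in> borel_measurable (PT T)"
    using u x by (auto simp: L2F_def adapted_process_def)
  have m2: "(\<lambda>(t, \<omega>). ennreal ((u t \<omega> x)\<^sup>2)) \<in> borel_measurable (PT T)"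
    using m unfolding case_prod_unfold by measurable
  have "(\<integral>\<^sup>+p. ennreal ((case p of (t, \<omega>) \<Rightarrow> u t \<omega> x)\<^sup>2) \<partial>PT T) = (\<integral>\<^sup>+(t, \<omega>). ennreal ((u t \<omega> x)\<^sup>2) \<partial>PT T)"
    by (simp add: case_prod_unfold)
  also have "\<dots> = (\<integral>\<^sup>+\<omega>. (\<integral>\<^sup>+t\<in>{0..T}. ennreal ((u t \<omega> x)\<^sup>2) \<partial>lborel) \<partial>M)"
    by (rule nn_integral_PT[OF m2, symmetric])
  also have "ennreal c * \<dots> = (\<integral>\<^sup>+(t, \<omega>). ennreal c * ennreal ((u t \<omega> x)\<^sup>2) \<partial>PT T)"
    unfolding nn_integral_PT[OF m2] case_prod_unfold
    by (rule nn_integral_cmult[symmetric]) (use m2 in \<open>simp add: case_prod_unfold\<close>)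
  also have "\<dots> = (\<integral>\<^sup>+\<omega>. (\<integral>\<^sup>+t\<in>{0..T}. ennreal c * ennreal ((u t \<omega> x)\<^sup>2) \<partial>lborel) \<partial>M)"
    by (rule nn_integral_PT[symmetric]) (use m2 in \<open>simp add: case_prod_unfold\<close>)
  also have "\<dots> \<le> L2F_sq M T nrm u"
    unfolding L2F_sq_def using c
    by (intro nn_integral_mono mult_right_mono) (auto simp flip: ennreal_mult intro!: ennreal_leI)
  also have "\<dots> < \<infinity>" using u by (simp add: L2F_def)
  finally show "(\<integral>\<^sup>+p. ennreal ((case p of (t, \<omega>) \<Rightarrow> u t \<omega> x)\<^sup>2) \<partial>PT T) < \<infinity>"
    using c by (auto simp: ennreal_mult_less_top case_prod_unfold)
qed

end

text \<open>\<open>kb\<close> is a pointwise bound on the lower order coefficients that may depend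
  on \<open>h\<close>. It serves integrability only and does not enter the final constant.\<close>

locale semidiscrete_problem = brownian M B for M :: "'w measure" and B +
  fixes N :: nat and h T kb :: real and \<gamma> :: "'n::finite \<Rightarrow> real ^ 'n \<Rightarrow> real"
    and a1 :: "'n \<Rightarrow> real \<Rightarrow> 'w \<Rightarrow> real ^ 'n \<Rightarrow> real" and a2 :: "real \<Rightarrow> 'w \<Rightarrow> real ^ 'n \<Rightarrow> real"
  assumes h: "h = 1 / (real N + 1)" and T: "0 < T"
    and a1: "\<And>i. adapted_process M Filt T (primal_mesh h) (a1 i)"
      "\<And>i x. x \<in> primal_mesh h \<Longrightarrow> AE (t, \<omega>) in PT T. \<bar>a1 i t \<omega> x\<bar> \<le> kb"
    and a2: "adapted_process M Filt T (primal_mesh h) a2"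
      "\<And>x. x \<in> primal_mesh h \<Longrightarrow> AE (t, \<omega>) in PT T. \<bar>a2 t \<omega> x\<bar> \<le> kb"
begin

definition zero_ext :: "(real ^ 'n \<Rightarrow> real) \<Rightarrow> real ^ 'n \<Rightarrow> real" where
  "zero_ext f x = (if x \<in> primal_mesh h then f x else 0)"

abbreviation "dr t \<omega> f \<equiv> drift h \<gamma> (\<lambda>i. a1 i t \<omega>) (a2 t \<omega>) f"

lemma h0: "0 < h" by (simp add: h)

lemma dr_square_integrable:
  assumes f: "\<And>y. square_integrable (PT T) (\<lambda>(t, \<omega>). f t \<omega> y)" and x: "x \<in> primal_mesh h"
  shows "square_integrable (PT T) (\<lambda>(t, \<omega>). dr t \<omega> (f t \<omega>) x)"
proof -
  have "square_integrable (PT T) (\<lambda>p. drift h \<gamma> (\<lambda>i. a1 i (fst p) (snd p)) (a2 (fst p) (snd p)) (f (fst p) (snd p)) x)"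
    by (rule drift_square_integrable[of _ _ _ _ _ kb])
      (use f a1 a2 x in \<open>auto simp: adapted_process_def case_prod_unfold\<close>)
  then show ?thesis by (simp add: case_prod_unfold)
qed

lemma dr_adapted:
  assumes "\<And>y. f y \<in> borel_measurable (Filt t)" and x: "x \<in> primal_mesh h" and t: "t \<in> {0..T}"
  shows "(\<lambda>\<omega>. dr t \<omega> (\<lambda>y. f y \<omega>) x) \<in> borel_measurable (Filt t)"
  by (rule drift_measurable) (use assms a1 a2 in \<open>auto simp: adapted_process_def\<close>)

text \<open>The values of a solution on the boundary are zero only on the open time interval and need not be
  measurable, so the solution is replaced by its extension by zero from the mesh.\<close>

lemma solution_zero_ext:
  assumes sol: "is_solution M B T h \<gamma> a1 a2 g w0 w"
  shows "square_integrable (PT T) (\<lambda>(t, \<omega>). zero_ext (w t \<omega>) y)"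
    and "t \<in> {0..T} \<Longrightarrow> (\<lambda>\<omega>. zero_ext (w t \<omega>) y) \<in> borel_measurable (Filt t)"
    and "\<exists>Y. \<forall>t\<in>{0..T}. \<forall>x\<in>primal_mesh h. has_ito_integral M Filt B t (\<lambda>s \<omega>. g s \<omega> x) (Y t x) \<and>
      (AE \<omega> in M. w t \<omega> x = w0 \<omega> x + (LINT s:{0..t}|lborel. dr s \<omega> (zero_ext (w s \<omega>)) x) + Y t x \<omega>)"
proof -
  have L2: "w \<in> L2F M Filt T (primal_mesh h) (L2_norm h (primal_mesh h))"
    and bd: "AE \<omega> in M. \<forall>t\<in>{0<..<T}. \<forall>x\<in>mesh_boundary h. w t \<omega> x = 0"
    and init: "AE \<omega> in M. \<forall>x\<in>primal_mesh h. w 0 \<omega> x = w0 \<omega> x"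
    and eq: "\<forall>t\<in>{0..T}. \<forall>x\<in>primal_mesh h. \<exists>Y. has_ito_integral M Filt B t (\<lambda>s \<omega>. g s \<omega> x) Y \<and>
        (AE \<omega> in M. w t \<omega> x = w 0 \<omega> x + (LINT s:{0..t}|lborel. dr s \<omega> (w s \<omega>) x) + Y \<omega>)"
    using sol unfolding is_solution_def by auto
  show "square_integrable (PT T) (\<lambda>(t, \<omega>). zero_ext (w t \<omega>) y)"
  proof (cases "y \<in> primal_mesh h")
    case True
    then show ?thesis using L2F_component_square_integrable[OF L2 True, of "h ^ CARD('n)"]
        component_le_L2_norm[OF _ finite_primal_mesh[OF h] True] h0 by (simp add: zero_ext_def)
  next
    case False
    then show ?thesis using square_integrable_zero[of "PT T"] by (simp add: zero_ext_def case_prod_unfold)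
  qed
  show "(\<lambda>\<omega>. zero_ext (w t \<omega>) y) \<in> borel_measurable (Filt t)" if "t \<in> {0..T}"
    using L2 that by (cases "y \<in> primal_mesh h") (auto simp: zero_ext_def L2F_def adapted_process_def)
  obtain Y where Y: "\<And>t x. t \<in> {0..T} \<Longrightarrow> x \<in> primal_mesh h \<Longrightarrow>
      has_ito_integral M Filt B t (\<lambda>s \<omega>. g s \<omega> x) (Y t x) \<and>
      (AE \<omega> in M. w t \<omega> x = w 0 \<omega> x + (LINT s:{0..t}|lborel. dr s \<omega> (w s \<omega>) x) + Y t x \<omega>)"
  proof -
    have "\<exists>Y. \<forall>t\<in>{0..T}. \<forall>x\<in>primal_mesh h. has_ito_integral M Filt B t (\<lambda>s \<omega>. g s \<omega> x) (Y t x) \<and>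
      (AE \<omega> in M. w t \<omega> x = w 0 \<omega> x + (LINT s:{0..t}|lborel. dr s \<omega> (w s \<omega>) x) + Y t x \<omega>)"
      by (rule bchoice, rule ballI, rule bchoice, rule bspec[OF eq])
    then show ?thesis using that by blast
  qed
  have int: "(LINT s:{0..t}|lborel. dr s \<omega> (w s \<omega>) x) = (LINT s:{0..t}|lborel. dr s \<omega> (zero_ext (w s \<omega>)) x)"
    if "t \<in> {0..T}" "x \<in> primal_mesh h" "\<forall>t\<in>{0<..<T}. \<forall>x\<in>mesh_boundary h. w t \<omega> x = 0" for t x \<omega>
    unfolding set_lebesgue_integral_def
  \<comment> \<open>The boundary values are known to vanish only strictly between \<open>0\<close>
    and \<open>T\<close>; the two end points form a null set.\<close>
  proof (rule integral_discrete_difference[of "{0, T}"])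
    fix s assume s: "s \<in> space lborel" "s \<notin> {0, T}"
    show "indicator {0..t} s *\<^sub>R dr s \<omega> (w s \<omega>) x = indicator {0..t} s *\<^sub>R dr s \<omega> (zero_ext (w s \<omega>)) x"
    proof (cases "s \<in> {0..t}")
      case True
      then have "s \<in> {0<..<T}" using s that(1) by auto
      then have "dr s \<omega> (w s \<omega>) x = dr s \<omega> (zero_ext (w s \<omega>)) x"
        using that(2,3) by (intro drift_cong) (auto simp: zero_ext_def)
      then show ?thesis by simp
    qed simp
  qed auto
  show "\<exists>Y. \<forall>t\<in>{0..T}. \<forall>x\<in>primal_mesh h. has_ito_integral M Filt B t (\<lambda>s \<omega>. g s \<omega> x) (Y t x) \<and>
      (AE \<omega> in M. w t \<omega> x = w0 \<omega> x + (LINT s:{0..t}|lborel. dr s \<omega> (zero_ext (w s \<omega>)) x) + Y t x \<omega>)"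
  proof (intro exI[of _ Y] ballI conjI)
    fix t x assume tx: "t \<in> {0..T}" "(x :: real ^ 'n) \<in> primal_mesh h"
    show "has_ito_integral M Filt B t (\<lambda>s \<omega>. g s \<omega> x) (Y t x)" using Y[OF tx] by blast
    show "AE \<omega> in M. w t \<omega> x = w0 \<omega> x + (LINT s:{0..t}|lborel. dr s \<omega> (zero_ext (w s \<omega>)) x) + Y t x \<omega>"
      using Y[OF tx, THEN conjunct2] bd init
    proof eventually_elim
      case (elim \<omega>)
      then show ?case using int[OF tx elim(2)] tx(2) by simp
    qed
  qed
qed

text \<open>Stated for pairs of mesh points, so that the squared pairing with a weight and the
  weighted sum of squares are both linear combinations of it. The common datum \<open>w0\<close>
  cancels, hence there is no initial term.\<close>

lemma difference_ito_identity:
  assumes sol: "is_solution M B T h \<gamma> a1 a2 g1 w0 w1" "is_solution M B T h \<gamma> a1 a2 g2 w0 w2"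
    and gB: "\<forall>x\<in>primal_mesh h. square_integrable (PT T) (\<lambda>(t, \<omega>). g1 t \<omega> x)"
      "\<forall>x\<in>primal_mesh h. square_integrable (PT T) (\<lambda>(t, \<omega>). g2 t \<omega> x)"
  defines "u \<equiv> (\<lambda>t \<omega>. zero_ext (\<lambda>x. w1 t \<omega> x - w2 t \<omega> x))"
  shows "square_integrable (PT T) (\<lambda>(t, \<omega>). u t \<omega> y)"
    and "x \<in> primal_mesh h \<Longrightarrow> square_integrable (PT T) (\<lambda>(t, \<omega>). dr t \<omega> (u t \<omega>) x)"
    and "x \<in> primal_mesh h \<Longrightarrow> square_integrable M (\<lambda>\<omega>. u T \<omega> x)"
    and "x \<in> primal_mesh h \<Longrightarrow> y \<in> primal_mesh h \<Longrightarrow>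
      (\<integral>\<omega>. u T \<omega> x * u T \<omega> y \<partial>M) =
      (\<integral>(t, \<omega>). (g1 t \<omega> x - g2 t \<omega> x) * (g1 t \<omega> y - g2 t \<omega> y) \<partial>PT T) +
      (\<integral>(t, \<omega>). u t \<omega> x * dr t \<omega> (u t \<omega>) y + u t \<omega> y * dr t \<omega> (u t \<omega>) x \<partial>PT T)"
proof -
  interpret P: pair_sigma_finite "Time T" M by (rule pair_Time)
  note g = gB(1)[rule_format] gB(2)[rule_format]
  note s1 = solution_zero_ext[OF sol(1)] and s2 = solution_zero_ext[OF sol(2)]
  have u_eq: "u t \<omega> = (\<lambda>y. zero_ext (w1 t \<omega>) y - zero_ext (w2 t \<omega>) y)" for t \<omega>
    by (auto simp: u_def zero_ext_def fun_eq_iff)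
  have dr_eq: "dr t \<omega> (u t \<omega>) x = dr t \<omega> (zero_ext (w1 t \<omega>)) x - dr t \<omega> (zero_ext (w2 t \<omega>)) x" for t \<omega> x
    unfolding u_eq by (rule drift_diff)
  show usq: "square_integrable (PT T) (\<lambda>(t, \<omega>). u t \<omega> y)" for y
    unfolding u_eq using square_integrable_diff[OF s1(1) s2(1)] by (simp add: case_prod_unfold)
  show bsq: "square_integrable (PT T) (\<lambda>(t, \<omega>). dr t \<omega> (u t \<omega>) x)" if "x \<in> primal_mesh h" for x
    by (rule dr_square_integrable[OF usq that])
  obtain Y1 where Y1: "\<And>t x. t \<in> {0..T} \<Longrightarrow> x \<in> primal_mesh h \<Longrightarrow> has_ito_integral M Filt B t (\<lambda>s \<omega>. g1 s \<omega> x) (Y1 t x)"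
    "\<And>t x. t \<in> {0..T} \<Longrightarrow> x \<in> primal_mesh h \<Longrightarrow>
      (AE \<omega> in M. w1 t \<omega> x = w0 \<omega> x + (LINT s:{0..t}|lborel. dr s \<omega> (zero_ext (w1 s \<omega>)) x) + Y1 t x \<omega>)"
    using s1(3) by blast
  obtain Y2 where Y2: "\<And>t x. t \<in> {0..T} \<Longrightarrow> x \<in> primal_mesh h \<Longrightarrow> has_ito_integral M Filt B t (\<lambda>s \<omega>. g2 s \<omega> x) (Y2 t x)"
    "\<And>t x. t \<in> {0..T} \<Longrightarrow> x \<in> primal_mesh h \<Longrightarrow>
      (AE \<omega> in M. w2 t \<omega> x = w0 \<omega> x + (LINT s:{0..t}|lborel. dr s \<omega> (zero_ext (w2 s \<omega>)) x) + Y2 t x \<omega>)"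
    using s2(3) by blast
  define Y where "Y = (\<lambda>t x \<omega>. Y1 t x \<omega> - Y2 t x \<omega>)"
  have Ysq1: "square_integrable M (Y1 t x)" "square_integrable M (Y2 t x)" if "t \<in> {0..T}" "x \<in> primal_mesh h" for t x
    using ito_square_integrable[OF Y1(1)[OF that] square_integrable_PT_mono[OF g(1)[OF that(2)]]]
      ito_square_integrable[OF Y2(1)[OF that] square_integrable_PT_mono[OF g(2)[OF that(2)]]] that by auto
  have Ysq: "square_integrable M (Y t x)" if "t \<in> {0..T}" "x \<in> primal_mesh h" for t x
    unfolding Y_def by (intro square_integrable_diff Ysq1 that)
  have eq: "AE \<omega> in M. u t \<omega> x = (LINT s:{0..t}|lborel. dr s \<omega> (u s \<omega>) x) + Y t x \<omega>"
    if t: "t \<in> {0..T}" and x: "x \<in> primal_mesh h" for t x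
  proof -
    have d1: "square_integrable (PT T) (\<lambda>(t, \<omega>). dr t \<omega> (zero_ext (w1 t \<omega>)) x)"
      by (rule dr_square_integrable[OF s1(1) x])
    have d2: "square_integrable (PT T) (\<lambda>(t, \<omega>). dr t \<omega> (zero_ext (w2 t \<omega>)) x)"
      by (rule dr_square_integrable[OF s2(1) x])
    show ?thesis
      using Y1(2)[OF that] Y2(2)[OF that] time_integral_abs_square_integrable(2)[OF d1]
        time_integral_abs_square_integrable(2)[OF d2]
    proof eventually_elim
      case (elim \<omega>)
      let ?f = "\<lambda>k s. dr s \<omega> (zero_ext (k s \<omega>)) x"
      have [measurable]: "indicator {..t} \<in> borel_measurable (Time T)" by (intro measurable_restrict_space1) simp
      have i: "integrable (Time T) (\<lambda>s. indicator {..t} s * ?f k s)" if "square_integrable (Time T) (?f k)" for k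
        using square_integrable_mult[OF bounded_square_integrable[OF finite_measure_Time, of "indicator {..t}" T 1] that]
        by (simp add: indicator_def)
      have "(LINT s:{0..t}|lborel. dr s \<omega> (u s \<omega>) x) = (LINT s:{0..t}|lborel. ?f w1 s) - (LINT s:{0..t}|lborel. ?f w2 s)"
        using t i[of w1, OF elim(3)] i[of w2, OF elim(4)]
        by (simp add: set_integral_time_integral[where T=T and b="\<lambda>s \<omega>. dr s \<omega> (zero_ext (w1 s \<omega>)) x - dr s \<omega> (zero_ext (w2 s \<omega>)) x"]
            set_integral_time_integral[where T=T and b="\<lambda>s \<omega>. dr s \<omega> (zero_ext (w1 s \<omega>)) x"]
            set_integral_time_integral[where T=T and b="\<lambda>s \<omega>. dr s \<omega> (zero_ext (w2 s \<omega>)) x"]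
            time_integral_def dr_eq right_diff_distrib)
      then show ?case using elim(1,2) x by (simp add: u_def zero_ext_def Y_def)
    qed
  qed
  have um: "(\<lambda>\<omega>. u T \<omega> x) \<in> borel_measurable M" for x
    unfolding u_eq using Filt_measurable[OF s1(2)[of T]] Filt_measurable[OF s2(2)[of T]] T by simp
  have TT: "T \<in> {0..T}" using T by simp
  show uT: "square_integrable M (\<lambda>\<omega>. u T \<omega> x)" if "x \<in> primal_mesh h" for x
  proof (rule square_integrable_cong_AE)
    show "square_integrable M (\<lambda>\<omega>. time_integral T (\<lambda>s \<omega>. dr s \<omega> (u s \<omega>) x) T \<omega> + Y T x \<omega>)"
      by (intro square_integrable_add time_integral_square_integrable(2) bsq Ysq TT that)
    show "AE \<omega> in M. u T \<omega> x = time_integral T (\<lambda>s \<omega>. dr s \<omega> (u s \<omega>) x) T \<omega> + Y T x \<omega>"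
      using eq[OF TT that] set_integral_time_integral[of T T "\<lambda>s \<omega>. dr s \<omega> (u s \<omega>) x"] T by simp
  qed (rule um)
  \<comment> \<open>Only almost every \<open>t\<close> is available: by Fubini the drift at time
    \<open>t\<close> is square integrable over the sample space for almost every
    \<open>t\<close>.\<close>
  have mart: "AE t in Time T. (\<integral>\<omega>. Y T x \<omega> * dr t \<omega> (u t \<omega>) y \<partial>M) = (\<integral>\<omega>. Y t x \<omega> * dr t \<omega> (u t \<omega>) y \<partial>M)"
    if x: "x \<in> primal_mesh h" and y: "y \<in> primal_mesh h" for x y
  proof -
    have "integrable (PT T) (\<lambda>(t, \<omega>). (dr t \<omega> (u t \<omega>) y)\<^sup>2)"
      using bsq[OF y] by (simp add: square_integrable_def case_prod_unfold)
    from P.AE_integrable_fst[OF this] AE_space show ?thesis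
    proof eventually_elim
      case (elim t)
      then have t: "t \<in> {0..T}" by (simp add: space_restrict_space)
      have ad: "(\<lambda>\<omega>. dr t \<omega> (u t \<omega>) y) \<in> borel_measurable (Filt t)"
        by (rule dr_adapted[OF _ y t]) (use s1(2)[OF t] s2(2)[OF t] in \<open>simp add: u_eq\<close>)
      have Z: "square_integrable M (\<lambda>\<omega>. dr t \<omega> (u t \<omega>) y)"
        using elim Filt_measurable[OF ad] by (simp add: square_integrable_def)
      have "(\<integral>\<omega>. Y1 T x \<omega> * dr t \<omega> (u t \<omega>) y \<partial>M) = (\<integral>\<omega>. Y1 t x \<omega> * dr t \<omega> (u t \<omega>) y \<partial>M)"
        "(\<integral>\<omega>. Y2 T x \<omega> * dr t \<omega> (u t \<omega>) y \<partial>M) = (\<integral>\<omega>. Y2 t x \<omega> * dr t \<omega> (u t \<omega>) y \<partial>M)"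
        using t ito_martingale[OF _ _ g(1)[OF x] Y1(1)[OF TT x] Y1(1)[OF t x] ad Z]
          ito_martingale[OF _ _ g(2)[OF x] Y2(1)[OF TT x] Y2(1)[OF t x] ad Z] by auto
      then show ?case unfolding Y_def left_diff_distrib
        using square_integrable_mult[OF Ysq1(1)[OF TT x] Z] square_integrable_mult[OF Ysq1(2)[OF TT x] Z]
          square_integrable_mult[OF Ysq1(1)[OF t x] Z] square_integrable_mult[OF Ysq1(2)[OF t x] Z] by simp
    qed
  qed
  show "(\<integral>\<omega>. u T \<omega> x * u T \<omega> y \<partial>M) =
      (\<integral>(t, \<omega>). (g1 t \<omega> x - g2 t \<omega> x) * (g1 t \<omega> y - g2 t \<omega> y) \<partial>PT T) +
      (\<integral>(t, \<omega>). u t \<omega> x * dr t \<omega> (u t \<omega>) y + u t \<omega> y * dr t \<omega> (u t \<omega>) x \<partial>PT T)"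
    if x: "x \<in> primal_mesh h" and y: "y \<in> primal_mesh h"
  proof -
    have "(\<integral>\<omega>. Y T x \<omega> * Y T y \<omega> \<partial>M) = (\<integral>(t, \<omega>). (g1 t \<omega> x - g2 t \<omega> x) * (g1 t \<omega> y - g2 t \<omega> y) \<partial>PT T)"
    proof -
      have expand: "(a - b) * (c - d) = a * c - a * d - b * c + b * d" for a b c d :: real
        by (simp add: algebra_simps)
      note iso = ito_isometry[OF Y1(1)[OF TT x] g(1)[OF x] Y1(1)[OF TT y] g(1)[OF y]]
        ito_isometry[OF Y1(1)[OF TT x] g(1)[OF x] Y2(1)[OF TT y] g(2)[OF y]]
        ito_isometry[OF Y2(1)[OF TT x] g(2)[OF x] Y1(1)[OF TT y] g(1)[OF y]]
        ito_isometry[OF Y2(1)[OF TT x] g(2)[OF x] Y2(1)[OF TT y] g(2)[OF y]]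
      show ?thesis unfolding Y_def expand
        using iso square_integrable_mult[OF Ysq1(1)[OF TT x] Ysq1(1)[OF TT y]]
          square_integrable_mult[OF Ysq1(1)[OF TT x] Ysq1(2)[OF TT y]]
          square_integrable_mult[OF Ysq1(2)[OF TT x] Ysq1(1)[OF TT y]]
          square_integrable_mult[OF Ysq1(2)[OF TT x] Ysq1(2)[OF TT y]]
          square_integrable_mult[OF g(1)[OF x] g(1)[OF y]] square_integrable_mult[OF g(1)[OF x] g(2)[OF y]]
          square_integrable_mult[OF g(2)[OF x] g(1)[OF y]] square_integrable_mult[OF g(2)[OF x] g(2)[OF y]]
        by (simp add: case_prod_unfold)
    qed
    moreover have "(\<integral>\<omega>. u T \<omega> x * u T \<omega> y \<partial>M) = (\<integral>\<omega>. Y T x \<omega> * Y T y \<omega> \<partial>M) +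
      (\<integral>(t, \<omega>). u t \<omega> x * dr t \<omega> (u t \<omega>) y + u t \<omega> y * dr t \<omega> (u t \<omega>) x \<partial>PT T)"
      by (rule ito_product_rule[where p="\<lambda>t \<omega>. u t \<omega> x" and p'="\<lambda>t \<omega>. u t \<omega> y" and Y="\<lambda>t. Y t x" and Y'="\<lambda>t. Y t y"
            and b="\<lambda>t \<omega>. dr t \<omega> (u t \<omega>) x" and b'="\<lambda>t \<omega>. dr t \<omega> (u t \<omega>) y"])
        (use T bsq[OF x] bsq[OF y] usq um eq[OF _ x] eq[OF _ y] Ysq[OF _ x] Ysq[OF _ y] mart[OF x y] mart[OF y x] in auto)
    ultimately show ?thesis by simp
  qed
qed

end

section \<open>The stability estimate\<close>

text \<open>The combination of the two Ito identities as one quadratic form on mesh values: the rank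
  one part is the squared pairing, the diagonal part the subtracted weighted sum of squares.\<close>

lemma double_sum_quadratic:
  fixes \<phi> \<alpha> \<beta> :: "real ^ 'n \<Rightarrow> real" and h \<theta> :: real
  assumes "finite W"
  defines "m \<equiv> h ^ CARD('n)"
  shows "(\<Sum>x\<in>W. \<Sum>y\<in>W. (m\<^sup>2 * \<phi> x * \<phi> y - (if x = y then \<theta> * m * \<phi> x else 0)) * (\<alpha> x * \<beta> y)) =
    mesh_integral h W (\<lambda>x. \<phi> x * \<alpha> x) * mesh_integral h W (\<lambda>x. \<phi> x * \<beta> x)
      - \<theta> * mesh_integral h W (\<lambda>x. \<phi> x * \<alpha> x * \<beta> x)"
proof -
  have "(\<Sum>x\<in>W. \<Sum>y\<in>W. (m\<^sup>2 * \<phi> x * \<phi> y - (if x = y then \<theta> * m * \<phi> x else 0)) * (\<alpha> x * \<beta> y)) =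
    (\<Sum>x\<in>W. \<Sum>y\<in>W. m\<^sup>2 * ((\<phi> x * \<alpha> x) * (\<phi> y * \<beta> y))) - (\<Sum>x\<in>W. \<Sum>y\<in>W. if x = y then \<theta> * m * (\<phi> x * \<alpha> x * \<beta> x) else 0)"
    unfolding sum_subtractf[symmetric] by (intro sum.cong refl) (auto simp: algebra_simps)
  also have "(\<Sum>x\<in>W. \<Sum>y\<in>W. m\<^sup>2 * ((\<phi> x * \<alpha> x) * (\<phi> y * \<beta> y))) =
      m\<^sup>2 * ((\<Sum>x\<in>W. \<phi> x * \<alpha> x) * (\<Sum>x\<in>W. \<phi> x * \<beta> x))"
    by (subst sum_product) (simp only: sum_distrib_left)
  also have "(\<Sum>x\<in>W. \<Sum>y\<in>W. if x = y then \<theta> * m * (\<phi> x * \<alpha> x * \<beta> x) else 0) = \<theta> * (m * (\<Sum>x\<in>W. \<phi> x * \<alpha> x * \<beta> x))"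
    using assms(1) by (simp add: sum_distrib_left mult_ac)
  finally show ?thesis by (simp add: mesh_integral_def m_def power2_eq_square mult_ac)
qed

context semidiscrete_problem
begin

abbreviation "MI \<equiv> mesh_integral h (primal_mesh h :: (real ^ 'n) set)"

text \<open>Separates the probability from the mesh analysis, which enters through
  \<open>coercive\<close> and \<open>dissipative\<close>. The former is an iterated statement, as is
  the hypothesis on the sources; the latter lives on the product space, as do the bounds on the
  coefficients.\<close>

lemma stability_estimate:
  fixes \<phi> :: "real ^ 'n \<Rightarrow> real"
  assumes sol: "is_solution M B T h \<gamma> a1 a2 g1 w0 w1" "is_solution M B T h \<gamma> a1 a2 g2 w0 w2"
    and gB: "\<forall>x\<in>primal_mesh h. square_integrable (PT T) (\<lambda>(t, \<omega>). g1 t \<omega> x)"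
      "\<forall>x\<in>primal_mesh h. square_integrable (PT T) (\<lambda>(t, \<omega>). g2 t \<omega> x)"
  defines "u \<equiv> (\<lambda>t \<omega>. zero_ext (\<lambda>x. w1 t \<omega> x - w2 t \<omega> x))"
    and "gd \<equiv> (\<lambda>t \<omega> x. g1 t \<omega> x - g2 t \<omega> x)"
  assumes \<phi>: "\<And>x. 0 \<le> \<phi> x" "\<And>x. \<phi> x \<le> 1" and \<theta>: "0 \<le> \<theta>"
    and coercive: "AE \<omega> in M. AE t in Time T. \<theta> * MI (\<lambda>x. (gd t \<omega> x)\<^sup>2) \<le>
      (MI (\<lambda>x. \<phi> x * gd t \<omega> x))\<^sup>2 - \<theta> * MI (\<lambda>x. \<phi> x * gd t \<omega> x * gd t \<omega> x)"
    and dissipative: "AE (t, \<omega>) in PT T.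
      - 2 * MI (\<lambda>x. \<phi> x * u t \<omega> x) * MI (\<lambda>x. \<phi> x * dr t \<omega> (u t \<omega>) x)
      + 2 * \<theta> * MI (\<lambda>x. \<phi> x * u t \<omega> x * dr t \<omega> (u t \<omega>) x)
      \<le> K * mesh_integral h (G0 \<inter> primal_mesh h) (\<lambda>x. (u t \<omega> x)\<^sup>2)"
  shows "\<theta> * (\<integral>(t, \<omega>). MI (\<lambda>x. (gd t \<omega> x)\<^sup>2) \<partial>PT T) \<le>
    (\<integral>\<omega>. MI (\<lambda>x. (u T \<omega> x)\<^sup>2) \<partial>M) + K * (\<integral>(t, \<omega>). mesh_integral h (G0 \<inter> primal_mesh h) (\<lambda>x. (u t \<omega> x)\<^sup>2) \<partial>PT T)"
proof -
  interpret P: pair_sigma_finite "Time T" M by (rule pair_Time)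
  let ?W = "primal_mesh h :: (real ^ 'n) set"
  let ?m = "h ^ CARD('n)"
  have fin: "finite ?W" by (rule finite_primal_mesh[OF h])
  define q where "q = (\<lambda>x y. ?m\<^sup>2 * \<phi> x * \<phi> y - (if x = y then \<theta> * ?m * \<phi> x else 0))"
  define Q where "Q = (\<lambda>\<alpha> \<beta>. MI (\<lambda>x. \<phi> x * \<alpha> x) * MI (\<lambda>x. \<phi> x * \<beta> x) - \<theta> * MI (\<lambda>x. \<phi> x * \<alpha> x * \<beta> x))"
  have Q: "(\<Sum>x\<in>?W. \<Sum>y\<in>?W. q x y * (\<alpha> x * \<beta> y)) = Q \<alpha> \<beta>" for \<alpha> \<beta>
    unfolding q_def Q_def by (rule double_sum_quadratic[OF fin])
  have Qsym: "Q \<alpha> \<beta> = Q \<beta> \<alpha>" for \<alpha> \<beta> unfolding Q_def by (simp add: mult_ac)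
  note g = gB(1)[rule_format] gB(2)[rule_format]
  have u_fold: "zero_ext (\<lambda>x. w1 t \<omega> x - w2 t \<omega> x) = u t \<omega>" for t \<omega> by (simp add: u_def)
  note D = difference_ito_identity[OF sol gB, unfolded u_fold]
  have gsq: "square_integrable (PT T) (\<lambda>(t, \<omega>). gd t \<omega> x)" if "x \<in> ?W" for x
    unfolding gd_def using square_integrable_diff[OF g(1)[OF that] g(2)[OF that]] by (simp add: case_prod_unfold)
  have i1: "integrable M (\<lambda>\<omega>. q x y * (u T \<omega> x * u T \<omega> y))" if "x \<in> ?W" "y \<in> ?W" for x y
    using square_integrable_mult[OF D(3)[OF that(1)] D(3)[OF that(2)]] by simp
  have i2: "integrable (PT T) (\<lambda>p. q x y * (gd (fst p) (snd p) x * gd (fst p) (snd p) y))" if "x \<in> ?W" "y \<in> ?W" for x y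
    using square_integrable_mult[OF gsq[OF that(1)] gsq[OF that(2)]] by (simp add: case_prod_unfold)
  have i3: "integrable (PT T) (\<lambda>p. u (fst p) (snd p) x * dr (fst p) (snd p) (u (fst p) (snd p)) y)" if "y \<in> ?W" for x y
    using square_integrable_mult[OF D(1)[of x] D(2)[OF that]] by (simp add: case_prod_unfold)
  let ?b = "\<lambda>p. dr (fst p) (snd p) (u (fst p) (snd p))" and ?u = "\<lambda>p. u (fst p) (snd p)" and ?g = "\<lambda>p. gd (fst p) (snd p)"
  have iQT: "integrable M (\<lambda>\<omega>. Q (u T \<omega>) (u T \<omega>))"
    unfolding Q[symmetric] by (intro Bochner_Integration.integrable_sum i1)
  have iQg: "integrable (PT T) (\<lambda>p. Q (?g p) (?g p))"
    unfolding Q[symmetric] by (intro Bochner_Integration.integrable_sum i2)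
  have iQb: "integrable (PT T) (\<lambda>p. Q (?u p) (?b p))"
    unfolding Q[symmetric] by (intro Bochner_Integration.integrable_sum integrable_mult_right i3)
  have "(\<integral>\<omega>. Q (u T \<omega>) (u T \<omega>) \<partial>M) = (\<Sum>x\<in>?W. \<Sum>y\<in>?W. q x y * (\<integral>\<omega>. u T \<omega> x * u T \<omega> y \<partial>M))"
    unfolding Q[symmetric] by (subst integral_sum_sum) (use i1 in auto)
  also have "\<dots> = (\<Sum>x\<in>?W. \<Sum>y\<in>?W. (\<integral>p. q x y * (?g p x * ?g p y) \<partial>PT T) + (\<integral>p. q x y * (?u p x * ?b p y + ?u p y * ?b p x) \<partial>PT T))"
  proof (intro sum.cong refl)
    fix x y assume "x \<in> ?W" "y \<in> ?W"
    from D(4)[OF this] show "q x y * (\<integral>\<omega>. u T \<omega> x * u T \<omega> y \<partial>M) =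
      (\<integral>p. q x y * (?g p x * ?g p y) \<partial>PT T) + (\<integral>p. q x y * (?u p x * ?b p y + ?u p y * ?b p x) \<partial>PT T)"
      unfolding integral_mult_right_zero distrib_left[symmetric] by (simp add: gd_def case_prod_unfold)
  qed
  also have "\<dots> = (\<Sum>x\<in>?W. \<Sum>y\<in>?W. \<integral>p. q x y * (?g p x * ?g p y) \<partial>PT T)
     + (\<Sum>x\<in>?W. \<Sum>y\<in>?W. \<integral>p. q x y * (?u p x * ?b p y + ?u p y * ?b p x) \<partial>PT T)"
    by (simp add: sum.distrib)
  also have "(\<Sum>x\<in>?W. \<Sum>y\<in>?W. \<integral>p. q x y * (?g p x * ?g p y) \<partial>PT T) = (\<integral>p. Q (?g p) (?g p) \<partial>PT T)"
    unfolding Q[symmetric] by (rule integral_sum_sum[symmetric]) (rule i2)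
  also have "(\<Sum>x\<in>?W. \<Sum>y\<in>?W. \<integral>p. q x y * (?u p x * ?b p y + ?u p y * ?b p x) \<partial>PT T) = (\<integral>p. 2 * Q (?u p) (?b p) \<partial>PT T)"
  proof -
    have "2 * Q \<alpha> \<beta> = (\<Sum>x\<in>?W. \<Sum>y\<in>?W. q x y * (\<alpha> x * \<beta> y + \<alpha> y * \<beta> x))" for \<alpha> \<beta>
    proof -
      have "(\<Sum>x\<in>?W. \<Sum>y\<in>?W. q x y * (\<alpha> x * \<beta> y + \<alpha> y * \<beta> x)) = Q \<alpha> \<beta> + Q \<beta> \<alpha>"
        unfolding Q[symmetric] by (simp add: distrib_left sum.distrib mult.commute)
      then show ?thesis using Qsym[of \<beta> \<alpha>] by simp
    qed
    then have "(\<integral>p. 2 * Q (?u p) (?b p) \<partial>PT T) = (\<integral>p. (\<Sum>x\<in>?W. \<Sum>y\<in>?W. q x y * (?u p x * ?b p y + ?u p y * ?b p x)) \<partial>PT T)"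
      by (simp only:)
    also have "\<dots> = (\<Sum>x\<in>?W. \<Sum>y\<in>?W. \<integral>p. q x y * (?u p x * ?b p y + ?u p y * ?b p x) \<partial>PT T)"
      by (rule integral_sum_sum) (intro integrable_mult_right Bochner_Integration.integrable_add i3)
    finally show ?thesis by simp
  qed
  finally have id: "(\<integral>p. Q (?g p) (?g p) \<partial>PT T) = (\<integral>\<omega>. Q (u T \<omega>) (u T \<omega>) \<partial>M) + (\<integral>p. - 2 * Q (?u p) (?b p) \<partial>PT T)"
    by simp
  have ig: "integrable (PT T) (\<lambda>p. MI (\<lambda>x. (?g p x)\<^sup>2))"
    unfolding mesh_integral_def using gsq
    by (intro integrable_mult_right Bochner_Integration.integrable_sum) (simp add: square_integrable_def case_prod_unfold)
  have iS: "integrable (PT T) (\<lambda>p. mesh_integral h (G0 \<inter> ?W) (\<lambda>x. (?u p x)\<^sup>2))"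
    unfolding mesh_integral_def using D(1)
    by (intro integrable_mult_right Bochner_Integration.integrable_sum) (simp add: square_integrable_def case_prod_unfold)
  have iT: "integrable M (\<lambda>\<omega>. MI (\<lambda>x. (u T \<omega> x)\<^sup>2))"
    unfolding mesh_integral_def using D(3)
    by (intro integrable_mult_right Bochner_Integration.integrable_sum) (simp add: square_integrable_def)
  have c1: "\<theta> * (\<integral>p. MI (\<lambda>x. (?g p x)\<^sup>2) \<partial>PT T) \<le> (\<integral>p. Q (?g p) (?g p) \<partial>PT T)"
  proof -
    define F where "F = (\<lambda>t \<omega>. Q (gd t \<omega>) (gd t \<omega>) - \<theta> * MI (\<lambda>x. (gd t \<omega> x)\<^sup>2))"
    have iF: "integrable (PT T) (\<lambda>(t, \<omega>). F t \<omega>)"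
      using iQg ig by (simp add: F_def case_prod_unfold)
    \<comment> \<open>Integrating over time first matches the iterated form of
      \<open>coercive\<close>, so its exceptional set need not be jointly measurable.\<close>
    have "0 \<le> (\<integral>\<omega>. (\<integral>t. F t \<omega> \<partial>Time T) \<partial>M)"
    proof (rule integral_nonneg_AE)
      show "AE \<omega> in M. 0 \<le> (\<integral>t. F t \<omega> \<partial>Time T)"
        using coercive by eventually_elim
          (rule integral_nonneg_AE, auto elim!: eventually_mono simp: F_def Q_def power2_eq_square)
    qed
    also have "\<dots> = (\<integral>(t, \<omega>). F t \<omega> \<partial>PT T)" by (rule P.integral_snd[OF iF])
    also have "\<dots> = (\<integral>p. Q (?g p) (?g p) \<partial>PT T) - \<theta> * (\<integral>p. MI (\<lambda>x. (?g p x)\<^sup>2) \<partial>PT T)"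
      using iQg ig by (simp add: F_def case_prod_unfold)
    finally show ?thesis by simp
  qed
  have c2: "(\<integral>p. - 2 * Q (?u p) (?b p) \<partial>PT T) \<le> K * (\<integral>p. mesh_integral h (G0 \<inter> ?W) (\<lambda>x. (?u p x)\<^sup>2) \<partial>PT T)"
  proof -
    have "(\<integral>p. - 2 * Q (?u p) (?b p) \<partial>PT T) \<le> (\<integral>p. K * mesh_integral h (G0 \<inter> ?W) (\<lambda>x. (?u p x)\<^sup>2) \<partial>PT T)"
    proof (rule integral_mono_AE)
      show "AE p in PT T. - 2 * Q (?u p) (?b p) \<le> K * mesh_integral h (G0 \<inter> ?W) (\<lambda>x. (?u p x)\<^sup>2)"
        using dissipative by eventually_elim (simp add: Q_def case_prod_unfold algebra_simps)
    qed (use iQb iS in auto)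
    then show ?thesis by simp
  qed
  \<comment> \<open>At time \<open>T\<close> the subtracted part of the form has the favourable sign
    and is dropped.\<close>
  have c3: "(\<integral>\<omega>. Q (u T \<omega>) (u T \<omega>) \<partial>M) \<le> (\<integral>\<omega>. MI (\<lambda>x. (u T \<omega> x)\<^sup>2) \<partial>M)"
  proof (rule integral_mono[OF iQT iT])
    fix \<omega>
    have "\<bar>\<phi> x\<bar> \<le> 1" for x using \<phi>[of x] by simp
    then have "(MI (\<lambda>x. \<phi> x * u T \<omega> x))\<^sup>2 \<le> MI (\<lambda>x. (u T \<omega> x)\<^sup>2)" by (rule mesh_pairing_square_le[OF h])
    moreover have "0 \<le> MI (\<lambda>x. \<phi> x * u T \<omega> x * u T \<omega> x)"
      using h0 \<phi> by (intro mesh_integral_nonneg) (auto simp: mult.assoc intro!: mult_nonneg_nonneg)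
    then have "0 \<le> \<theta> * MI (\<lambda>x. \<phi> x * u T \<omega> x * u T \<omega> x)" using \<theta> by simp
    ultimately show "Q (u T \<omega>) (u T \<omega>) \<le> MI (\<lambda>x. (u T \<omega> x)\<^sup>2)" unfolding Q_def power2_eq_square by linarith
  qed
  show ?thesis using c1 c2 c3 id by (simp add: case_prod_unfold)
qed

end

text \<open>Rests on \<open>\<bar>s\<bar> ^ k \<le> 1 + \<bar>s\<bar> powr p\<close> and on the mesh
  volume being at most 1. It is used for the exponents n and 2, both at most \<open>nstar\<close>;
  \<open>max R 1\<close> keeps the base positive whatever \<open>R\<close> is.\<close>

lemma Lp_norm_power_bound:
  fixes f :: "real ^ 'n \<Rightarrow> real"
  assumes h: "h = 1 / (real N + 1)" and p: "real k \<le> p" "0 < k" and f: "Lp_norm p h (primal_mesh h) f \<le> R"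
  shows "mesh_integral h (primal_mesh h) (\<lambda>x. \<bar>f x\<bar> ^ k) \<le> 1 + (max R 1) powr p"
proof -
  let ?MI = "mesh_integral h (primal_mesh h :: (real ^ 'n) set)"
  have h0: "0 \<le> h" by (simp add: h)
  have pp: "0 < p" using p by linarith
  have J0: "0 \<le> ?MI (\<lambda>x. \<bar>f x\<bar> powr p)" by (intro mesh_integral_nonneg h0) auto
  have "?MI (\<lambda>x. \<bar>f x\<bar> powr p) = (?MI (\<lambda>x. \<bar>f x\<bar> powr p) powr (1 / p)) powr p"
    using J0 pp by (simp add: powr_powr)
  also have "\<dots> \<le> (max R 1) powr p"
    using f pp by (intro powr_mono2) (auto simp: Lp_norm_def)
  finally have J: "?MI (\<lambda>x. \<bar>f x\<bar> powr p) \<le> (max R 1) powr p" .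
  have "\<bar>s\<bar> ^ k \<le> 1 + \<bar>s\<bar> powr p" for s :: real
  proof (cases "\<bar>s\<bar> \<le> 1")
    case True
    then have "\<bar>s\<bar> ^ k \<le> 1" by (intro power_le_one) auto
    then show ?thesis by (smt (verit) powr_ge_zero)
  next
    case False
    then have "\<bar>s\<bar> ^ k = \<bar>s\<bar> powr real k" by (subst powr_realpow) auto
    also have "\<dots> \<le> \<bar>s\<bar> powr p" using False p by (intro powr_mono) auto
    finally show ?thesis by simp
  qed
  then have "?MI (\<lambda>x. \<bar>f x\<bar> ^ k) \<le> ?MI (\<lambda>x. 1 + \<bar>f x\<bar> powr p)" by (intro mesh_integral_mono h0)
  also have "\<dots> = ?MI (\<lambda>_. 1) + ?MI (\<lambda>x. \<bar>f x\<bar> powr p)" by (rule mesh_integral_add)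
  also have "?MI (\<lambda>_. 1) \<le> 1" using mesh_volume_le[OF h, where 'n='n] by (simp add: mesh_integral_def)
  finally show ?thesis using J by simp
qed

text \<open>With \<open>L = 2 * C0 * n\<close>, \<open>g\<close> has one sign and its absolute
  values lie between \<open>exp (- L) * G\<close> and \<open>exp L * G\<close>. The squared pairing
  is thus at least \<open>(\<kappa> * (exp (- L) * G))\<^sup>2\<close>, while each of the two terms
  with \<open>\<theta>\<close> is at most \<open>\<theta> * (exp L * G)\<^sup>2\<close>. The value
  of \<open>\<theta>\<close> is the one for which the two upper bounds add up to the lower
  bound.\<close>

lemma Harnack_coercivity:
  fixes g \<phi> :: "real ^ 'n \<Rightarrow> real"
  assumes h: "h = 1 / (real N + 1)" and C0: "0 < C0" "C0 * h \<le> 1"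
    and g: "\<And>i y. y \<in> dual h i (primal_mesh h) \<Longrightarrow> \<bar>Dh h i g y\<bar> \<le> C0 * \<bar>Ah h i g y\<bar>"
    and \<phi>: "\<And>x. 0 \<le> \<phi> x" "\<And>x. \<phi> x \<le> 1" and \<kappa>: "0 \<le> \<kappa>" "\<kappa> \<le> mesh_integral h (primal_mesh h) \<phi>"
  defines "\<theta> \<equiv> \<kappa>\<^sup>2 * exp (- 4 * (2 * C0 * CARD('n))) / 2"
  shows "\<theta> * mesh_integral h (primal_mesh h) (\<lambda>x. (g x)\<^sup>2) \<le>
    (mesh_integral h (primal_mesh h) (\<lambda>x. \<phi> x * g x))\<^sup>2
    - \<theta> * mesh_integral h (primal_mesh h) (\<lambda>x. \<phi> x * g x * g x)"
proof (cases "primal_mesh h = ({} :: (real ^ 'n) set)")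
  case True
  then show ?thesis by (simp add: mesh_integral_def)
next
  case False
  let ?W = "primal_mesh h :: (real ^ 'n) set"
  let ?MI = "mesh_integral h ?W"
  define L where "L = 2 * C0 * CARD('n)"
  have h0: "0 \<le> h" by (simp add: h)
  obtain x0 where x0: "x0 \<in> ?W" using False by blast
  define G where "G = \<bar>g x0\<bar>"
  have H: "sgn (g x) = sgn (g x0)" "\<bar>g x\<bar> \<le> exp L * G" "exp (- L) * G \<le> \<bar>g x\<bar>" if "x \<in> ?W" for x
  proof -
    note A = mesh_Harnack[OF h C0 g that x0] and B = mesh_Harnack[OF h C0 g x0 that]
    show "sgn (g x) = sgn (g x0)" "\<bar>g x\<bar> \<le> exp L * G" using A by (auto simp: L_def G_def)
    have "exp (- L) * G \<le> exp (- L) * (exp L * \<bar>g x\<bar>)"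
      using B(2) by (intro mult_left_mono) (auto simp: L_def G_def)
    then show "exp (- L) * G \<le> \<bar>g x\<bar>" by (simp add: exp_minus mult.assoc[symmetric])
  qed
  have \<theta>0: "0 \<le> \<theta>" by (simp add: \<theta>_def)
  have g2: "?MI (\<lambda>x. (g x)\<^sup>2) \<le> (exp L * G)\<^sup>2"
  proof -
    have "?MI (\<lambda>x. (g x)\<^sup>2) \<le> ?MI (\<lambda>x. (exp L * G)\<^sup>2 * 1)"
    proof (intro mesh_integral_mono h0)
      fix x assume "x \<in> ?W"
      then have "\<bar>g x\<bar>\<^sup>2 \<le> (exp L * G)\<^sup>2" using H(2) by (intro power_mono) auto
      then show "(g x)\<^sup>2 \<le> (exp L * G)\<^sup>2 * 1" by simp
    qed
    also have "\<dots> = (exp L * G)\<^sup>2 * ?MI (\<lambda>_. 1)" by (rule mesh_integral_cmult)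
    also have "\<dots> \<le> (exp L * G)\<^sup>2 * 1"
      using mesh_volume_le[OF h, where 'n='n] by (intro mult_left_mono) (auto simp: mesh_integral_def)
    finally show ?thesis by simp
  qed
  have \<phi>g: "?MI (\<lambda>x. \<phi> x * g x * g x) \<le> ?MI (\<lambda>x. (g x)\<^sup>2)"
  proof (intro mesh_integral_mono h0)
    fix x
    have "\<phi> x * g x * g x = \<phi> x * (g x)\<^sup>2" by (simp add: power2_eq_square)
    also have "\<dots> \<le> 1 * (g x)\<^sup>2" by (intro mult_right_mono \<phi>) auto
    finally show "\<phi> x * g x * g x \<le> (g x)\<^sup>2" by simp
  qed
  have low: "(\<kappa> * (exp (- L) * G))\<^sup>2 \<le> (?MI (\<lambda>x. \<phi> x * g x))\<^sup>2"
  proof -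
    have "\<kappa> * (exp (- L) * G) \<le> ?MI \<phi> * (exp (- L) * G)" using \<kappa> by (intro mult_right_mono) (auto simp: G_def)
    also have "\<dots> = ?MI (\<lambda>x. (exp (- L) * G) * \<phi> x)" unfolding mesh_integral_cmult by (rule mult.commute)
    also have "\<dots> \<le> ?MI (\<lambda>x. sgn (g x0) * (\<phi> x * g x))"
    proof (intro mesh_integral_mono h0)
      fix x assume x: "x \<in> ?W"
      have "(exp (- L) * G) * \<phi> x \<le> \<bar>g x\<bar> * \<phi> x" using H(3)[OF x] \<phi> by (intro mult_right_mono)
      also have "\<dots> = sgn (g x0) * (\<phi> x * g x)" unfolding H(1)[OF x, symmetric] by (simp add: abs_sgn mult_ac)
      finally show "(exp (- L) * G) * \<phi> x \<le> sgn (g x0) * (\<phi> x * g x)" .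
    qed
    also have "\<dots> = sgn (g x0) * ?MI (\<lambda>x. \<phi> x * g x)" by (rule mesh_integral_cmult)
    also have "\<dots> \<le> \<bar>?MI (\<lambda>x. \<phi> x * g x)\<bar>" by (auto simp: sgn_real_def)
    finally have "(\<kappa> * (exp (- L) * G))\<^sup>2 \<le> \<bar>?MI (\<lambda>x. \<phi> x * g x)\<bar>\<^sup>2"
      using \<kappa> by (intro power_mono) (auto simp: G_def)
    then show ?thesis by simp
  qed
  have "2 * \<theta> * (exp L * G)\<^sup>2 = (\<kappa> * (exp (- L) * G))\<^sup>2"
  proof -
    have "exp (- 4 * L) * (exp L)\<^sup>2 = (exp (- L))\<^sup>2"
      by (simp add: power2_eq_square flip: exp_add)
    then show ?thesis unfolding \<theta>_def L_def[symmetric] by (simp add: power_mult_distrib mult_ac)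
  qed
  moreover have "\<theta> * ?MI (\<lambda>x. (g x)\<^sup>2) \<le> \<theta> * (exp L * G)\<^sup>2" using g2 \<theta>0 by (rule mult_left_mono)
  moreover have "\<theta> * ?MI (\<lambda>x. \<phi> x * g x * g x) \<le> \<theta> * (exp L * G)\<^sup>2"
    using \<phi>g g2 \<theta>0 by (intro mult_left_mono) auto
  ultimately show ?thesis using low by linarith
qed

text \<open>The bump has radius \<open>r\<close> and \<open>h \<le> r\<close>, so the stencil of
  \<open>drift\<close> at a point of its support stays in \<open>cball x0 (2 * r)\<close>, inside
  \<open>G0\<close>. Hence \<open>u\<close> may be replaced by its restriction \<open>v\<close> to
  \<open>G0\<close>, and the mass that remains is the observed one.\<close>

lemma cutoff_dissipativity:
  fixes u :: "real ^ 'n \<Rightarrow> real" and x0 :: "real ^ 'n"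
  assumes n: "CARD('n) \<ge> 2" and h: "h = 1 / (real N + 1)" and c0: "0 < c0" and R: "0 \<le> R" and K: "0 < K"
    and G0: "G0 \<subseteq> unit_cube" and r: "0 < r" "r \<le> 1" "cball x0 (2 * r) \<subseteq> G0" and hr: "h \<le> r"
    and u: "\<And>x. x \<notin> primal_mesh h \<Longrightarrow> u x = 0"
    and \<gamma>: "\<And>i y. y \<in> dual h i (primal_mesh h) \<Longrightarrow> 1 / c0 \<le> \<gamma> i y \<and> \<gamma> i y \<le> c0"
    and b1: "\<And>i x. x \<in> primal_mesh h \<Longrightarrow> \<bar>b1 i x\<bar> \<le> R"
    and b2: "mesh_integral h (primal_mesh h) (\<lambda>x. \<bar>b2 x\<bar> ^ CARD('n)) powr (1 / CARD('n)) \<le> K"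
      "mesh_integral h (primal_mesh h) (\<lambda>x. (b2 x)\<^sup>2) \<le> K"
    and \<theta>: "0 < \<theta>"
  defines "\<phi> \<equiv> (\<lambda>x. (max 0 (r - dist x x0))\<^sup>2)"
    and "\<epsilon> \<equiv> \<theta> / (4 * c0)" and "\<epsilon>' \<equiv> 1 / (8 * c0)" and "\<delta> \<equiv> 1 / (8 * c0 * K)"
  shows "- 2 * mesh_integral h (primal_mesh h) (\<lambda>x. \<phi> x * u x) * mesh_integral h (primal_mesh h) (\<lambda>x. \<phi> x * drift h \<gamma> b1 b2 u x)
      + 2 * \<theta> * mesh_integral h (primal_mesh h) (\<lambda>x. \<phi> x * u x * drift h \<gamma> b1 b2 u x) \<le>
    (2 * (CARD('n) * (2 * c0\<^sup>2 / \<epsilon> + R\<^sup>2 / \<epsilon>) + K + 1) +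
      2 * \<theta> * (CARD('n) * (c0\<^sup>2 / \<epsilon>' + R\<^sup>2 / \<epsilon>') + K * (2 * \<delta> + 1 / \<delta>)))
    * mesh_integral h (G0 \<inter> primal_mesh h) (\<lambda>x. (u x)\<^sup>2)"
proof -
  define ch where "ch = (\<lambda>x. max 0 (r - dist x x0))"
  define v where "v = (\<lambda>x. if x \<in> G0 then u x else 0)"
  have h0: "0 < h" by (simp add: h)
  have supp: "dist x x0 < r" if "ch x \<noteq> 0" for x using that by (auto simp: ch_def max_def split: if_splits)
  have inG: "x \<in> G0" if "dist x x0 \<le> 2 * r" for x using r(3) that by (auto simp: dist_commute)
  interpret cutoff_estimate N h c0 R K ch v \<gamma> b1 b2
  proof
    show "0 \<le> ch x" for x by (simp add: ch_def)
    show "ch x \<le> 1" for x using r by (simp add: ch_def) (smt (verit) zero_le_dist)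
    \<comment> \<open>A point of \<open>mesh_boundary\<close> has coordinates in \<open>h\<close>
      times the integers without being in the mesh, so it lies outside the open cube and hence
      outside the support of the bump.\<close>
    show "ch x = 0" if xb: "x \<in> mesh_boundary h" for x
    proof (rule ccontr)
      assume "ch x \<noteq> 0"
      then have "x \<in> unit_cube" using supp[of x] inG[of x] G0 r by auto
      moreover obtain k where k: "x \<in> dual h k (dual h k (primal_mesh h))" "x \<notin> primal_mesh h"
        using xb by (auto simp: mesh_boundary_def)
      have "\<exists>y\<in>primal_mesh h. \<exists>s\<in>{-1, 0, 1 :: int}. x = y + (h * of_int s) *\<^sub>R axis k 1"
      proof -
        from k(1) obtain y where y: "y \<in> primal_mesh h" and
          "x = y + (h/2) *\<^sub>R axis k 1 + (h/2) *\<^sub>R axis k 1 \<or> x = y \<or> x = y - (h/2) *\<^sub>R axis k 1 - (h/2) *\<^sub>R axis k 1"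
          unfolding dual_def by auto
        then have "x = y + h *\<^sub>R axis k 1 \<or> x = y \<or> x = y - h *\<^sub>R axis k 1"
          using scaleR_half_add_half[of h "axis k 1"] by (auto simp: add.assoc diff_diff_eq)
        then show ?thesis using y by (intro bexI[of _ y]) auto
      qed
      then obtain y s where y: "y \<in> primal_mesh h" and s: "x = y + (h * of_int s) *\<^sub>R axis k 1" by blast
      have "\<exists>l::int. x $ i = h * of_int l" for i
      proof -
        obtain l where "y $ i = h * of_int l" using y by (auto simp: primal_mesh_def)
        then have "x $ i = h * of_int (l + (if i = k then s else 0))"
          unfolding s by (simp add: axis_def algebra_simps)
        then show ?thesis by blast
      qed
      ultimately have "x \<in> primal_mesh h" by (simp add: primal_mesh_def)
      then show False using k(2) by blast
    qed
    show "\<bar>Dh h i ch y\<bar> \<le> 1" for i y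
    proof -
      let ?a = "y + (h / 2) *\<^sub>R axis i 1" and ?b = "y - (h / 2) *\<^sub>R axis i 1"
      have "\<bar>ch ?a - ch ?b\<bar> \<le> \<bar>dist ?a x0 - dist ?b x0\<bar>" by (auto simp: ch_def max_def)
      also have "\<dots> \<le> dist ?a ?b" using dist_triangle[of ?a x0 ?b] dist_triangle[of ?b x0 ?a]
        by (simp add: dist_commute abs_le_iff)
      also have "\<dots> = h"
      proof -
        have "?a - ?b = h *\<^sub>R axis i 1" using scaleR_half_add_half[of h "axis i (1::real)"] by simp
        then show ?thesis using h0 by (simp add: dist_norm norm_axis_1)
      qed
      finally show ?thesis using h0 by (simp add: Dh_def)
    qed
    show "v x = 0" if "x \<notin> primal_mesh h" for x using u[OF that] by (simp add: v_def)
  qed (use n h c0 R K \<gamma> b1 b2 in auto)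
  have drv: "\<phi> x * drift h \<gamma> b1 b2 u x = ch2 x * drift h \<gamma> b1 b2 v x \<and> \<phi> x * u x = ch2 x * v x" for x
  proof (cases "ch x = 0")
    case False
    have near: "x + s *\<^sub>R axis i 1 \<in> G0" if "\<bar>s\<bar> \<le> h" for s i
    proof (rule inG)
      have "dist (x + s *\<^sub>R axis i 1) x0 \<le> dist (x + s *\<^sub>R axis i 1) x + dist x x0" by (rule dist_triangle)
      also have "dist (x + s *\<^sub>R axis i 1) x = \<bar>s\<bar>" by (simp add: dist_norm norm_axis_1)
      finally show "dist (x + s *\<^sub>R axis i 1) x0 \<le> 2 * r" using that hr supp[OF False] by simp
    qed
    have "x \<in> G0" using near[of 0] h0 by simp
    moreover have "drift h \<gamma> b1 b2 u x = drift h \<gamma> b1 b2 v x"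
    proof (rule drift_cong_local)
      show "u x = v x" using \<open>x \<in> G0\<close> by (simp add: v_def)
      fix i
      have e: "x + (h / 2) *\<^sub>R axis i 1 + (h / 2) *\<^sub>R axis i 1 = x + h *\<^sub>R axis i 1"
        "x - (h / 2) *\<^sub>R axis i 1 - (h / 2) *\<^sub>R axis i 1 = x + (- h) *\<^sub>R axis i 1"
        using scaleR_half_add_half[of h "axis i (1::real)"] by (simp_all add: add.assoc diff_diff_eq)
      show "u (x + (h / 2) *\<^sub>R axis i 1 + (h / 2) *\<^sub>R axis i 1) = v (x + (h / 2) *\<^sub>R axis i 1 + (h / 2) *\<^sub>R axis i 1)"
        unfolding e v_def using near[of h i] h0 by simp
      show "u (x - (h / 2) *\<^sub>R axis i 1 - (h / 2) *\<^sub>R axis i 1) = v (x - (h / 2) *\<^sub>R axis i 1 - (h / 2) *\<^sub>R axis i 1)"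
        unfolding e v_def using near[of "- h" i] h0 by simp
    qed
    ultimately show ?thesis by (simp add: v_def \<phi>_def ch_def)
  qed (simp add: \<phi>_def ch_def)
  have m: "mass = mesh_integral h (G0 \<inter> primal_mesh h) (\<lambda>x. (u x)\<^sup>2)"
  proof -
    have "(v x)\<^sup>2 = (if x \<in> G0 then (u x)\<^sup>2 else 0)" for x by (simp add: v_def)
    then show ?thesis unfolding mass_def mesh_integral_def using fin
      by (simp add: sum.inter_restrict[symmetric] Int_commute)
  qed
  have uvd: "\<phi> x * u x * drift h \<gamma> b1 b2 u x = ch2 x * v x * drift h \<gamma> b1 b2 v x" for x
  proof (cases "ch x = 0")
    case False
    then have "\<phi> x \<noteq> 0" by (simp add: \<phi>_def ch_def)
    then show ?thesis using drv[of x] by (auto simp: \<phi>_def ch_def)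
  qed (simp add: \<phi>_def ch_def)
  have "MI (\<lambda>x. \<phi> x * u x) = MI (\<lambda>x. ch2 x * v x)"
    "MI (\<lambda>x. \<phi> x * drift h \<gamma> b1 b2 u x) = MI (\<lambda>x. ch2 x * drift h \<gamma> b1 b2 v x)"
    "MI (\<lambda>x. \<phi> x * u x * drift h \<gamma> b1 b2 u x) = MI (\<lambda>x. ch2 x * v x * drift h \<gamma> b1 b2 v x)"
    by (intro mesh_integral_cong; use drv uvd in blast)+
  then show ?thesis
    using drift_quadratic_bound[OF \<theta>] unfolding m \<epsilon>_def \<epsilon>'_def \<delta>_def by (simp only:)
qed

context brownian
begin

section \<open>The norms of the statement as integrals of mesh sums\<close>

lemma L2F_norm_eq:
  fixes f :: "real \<Rightarrow> 'w \<Rightarrow> real ^ 'n \<Rightarrow> real"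
  assumes h: "0 \<le> h" and f: "\<And>x. x \<in> W \<Longrightarrow> square_integrable (PT T) (\<lambda>(t, \<omega>). f t \<omega> x)"
  shows "L2F_norm M T (L2_norm h W) f = sqrt (\<integral>(t, \<omega>). mesh_integral h W (\<lambda>x. (f t \<omega> x)\<^sup>2) \<partial>PT T)"
proof -
  have i: "integrable (PT T) (\<lambda>(t, \<omega>). mesh_integral h W (\<lambda>x. (f t \<omega> x)\<^sup>2))"
    unfolding mesh_integral_def case_prod_unfold using f
    by (intro integrable_mult_right Bochner_Integration.integrable_sum) (simp add: square_integrable_def case_prod_unfold)
  have "L2F_sq M T (L2_norm h W) f = (\<integral>\<^sup>+(t, \<omega>). ennreal (mesh_integral h W (\<lambda>x. (f t \<omega> x)\<^sup>2)) \<partial>PT T)"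
    unfolding L2F_sq_def L2_norm_square[OF h]
    by (rule nn_integral_PT) (use borel_measurable_integrable[OF i] in \<open>simp add: case_prod_unfold\<close>)
  also have "\<dots> = ennreal (\<integral>(t, \<omega>). mesh_integral h W (\<lambda>x. (f t \<omega> x)\<^sup>2) \<partial>PT T)"
    using nn_integral_eq_integral[OF i] h by (simp add: case_prod_unfold mesh_integral_nonneg)
  finally show ?thesis unfolding L2F_norm_def
    using h by (simp add: case_prod_unfold mesh_integral_nonneg)
qed

text \<open>For functions that are not square integrable the norms below have the junk value 0.\<close>

lemma L2Omega_norm_eq:
  fixes f :: "'w \<Rightarrow> real ^ 'n \<Rightarrow> real"
  assumes h: "0 \<le> h" and f: "\<And>x. x \<in> W \<Longrightarrow> square_integrable M (\<lambda>\<omega>. f \<omega> x)"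
  shows "L2Omega_norm M (L2_norm h W) f = sqrt (\<integral>\<omega>. mesh_integral h W (\<lambda>x. (f \<omega> x)\<^sup>2) \<partial>M)"
proof -
  have i: "integrable M (\<lambda>\<omega>. mesh_integral h W (\<lambda>x. (f \<omega> x)\<^sup>2))"
    unfolding mesh_integral_def using f
    by (intro integrable_mult_right Bochner_Integration.integrable_sum) (simp add: square_integrable_def)
  show ?thesis unfolding L2Omega_norm_def L2Omega_sq_def L2_norm_square[OF h]
    using nn_integral_eq_integral[OF i] h by (simp add: mesh_integral_nonneg)
qed

text \<open>\<open>Lambda1\<close> records the solution on the open time interval only; the end
  points have measure zero.\<close>

lemma L2F_norm_cong_open:
  assumes "\<And>t \<omega>. t \<in> {0<..<T} \<Longrightarrow> nrm (f t \<omega>) = nrm (f' t \<omega>)"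
  shows "L2F_norm M T nrm f = L2F_norm M T nrm f'"
proof -
  have "(\<integral>\<^sup>+t\<in>{0..T}. ennreal ((nrm (f t \<omega>))\<^sup>2) \<partial>lborel) = (\<integral>\<^sup>+t\<in>{0..T}. ennreal ((nrm (f' t \<omega>))\<^sup>2) \<partial>lborel)" for \<omega>
  proof (rule nn_integral_cong_AE)
    show "AE t in lborel. ennreal ((nrm (f t \<omega>))\<^sup>2) * indicator {0..T} t = ennreal ((nrm (f' t \<omega>))\<^sup>2) * indicator {0..T} t"
      using AE_lborel_singleton[of 0] AE_lborel_singleton[of T]
      by eventually_elim (use assms in \<open>auto simp: indicator_def\<close>)
  qed
  then show ?thesis by (simp add: L2F_norm_def L2F_sq_def)
qed

end

text \<open>The constants are in closed form to exhibit that they depend only on \<open>r\<close>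
  and the fixed data: they can be chosen before the probability space, the diffusion coefficients
  and the mesh.\<close>

lemma localized_stability:
  fixes G0 :: "(real ^ 'n) set" and M :: "'w measure" and \<gamma> :: "'n \<Rightarrow> real ^ 'n \<Rightarrow> real"
    and T c0 nstar C0 r h R :: real
  assumes n: "CARD('n) \<ge> 2" and T: "T > 0" and G0: "G0 \<subseteq> unit_cube" and c0: "c0 > 0"
    and nstar: "2 \<le> nstar" "real CARD('n) \<le> nstar" and C0: "C0 > 0"
    and r: "0 < r" "r \<le> 1" "cball x0 (2 * r) \<subseteq> G0"
    and h: "h = 1 / (real N + 1)" and N: "0 < N" and hs: "C0 * h \<le> 1" "h \<le> r" "h \<le> r / (2 * CARD('n))"
    and basis: "brownian_basis M B" and \<gamma>: "diffusion_coeffs \<gamma>" "reg \<gamma> < ereal c0"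
    and a1: "\<And>i. a1 i \<in> LinfF M (aug_filtration M B) T (primal_mesh h) (Linf_norm (primal_mesh h))"
      "\<And>i. LinfF_norm M T (Linf_norm (primal_mesh h)) (a1 i) \<le> ereal R"
    and a2: "a2 \<in> LinfF M (aug_filtration M B) T (primal_mesh h) (Lp_norm nstar h (primal_mesh h))"
      "LinfF_norm M T (Lp_norm nstar h (primal_mesh h)) a2 \<le> ereal R"
    and g: "g1 \<in> L2F M (aug_filtration M B) T (primal_mesh h \<union> mesh_boundary h) (H1_norm h)"
      "g2 \<in> L2F M (aug_filtration M B) T (primal_mesh h \<union> mesh_boundary h) (H1_norm h)"
    and gD: "\<And>i. AE \<omega> in M. AE t in lborel. t \<in> {0<..<T} \<longrightarrow>
             (\<forall>x\<in>dual h i (primal_mesh h).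
                \<bar>Dh h i (\<lambda>y. g1 t \<omega> y - g2 t \<omega> y) x\<bar>
                  \<le> C0 * \<bar>Ah h i (\<lambda>y. g1 t \<omega> y - g2 t \<omega> y) x\<bar>)"
    and sol: "is_solution M B T h \<gamma> a1 a2 g1 w0 w1" "is_solution M B T h \<gamma> a1 a2 g2 w0 w2"
  defines "\<kappa> \<equiv> (r / (2 * CARD('n))) ^ CARD('n) * (r / 2)\<^sup>2"
  defines "\<theta> \<equiv> \<kappa>\<^sup>2 * exp (- 4 * (2 * C0 * CARD('n))) / 2"
    and "R' \<equiv> max R 1"
  defines "K \<equiv> 1 + R' powr nstar"
  defines "Kc \<equiv> 2 * (CARD('n) * (2 * c0\<^sup>2 / (\<theta> / (4 * c0)) + R'\<^sup>2 / (\<theta> / (4 * c0))) + K + 1) +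
      2 * \<theta> * (CARD('n) * (c0\<^sup>2 / (1 / (8 * c0)) + R'\<^sup>2 / (1 / (8 * c0)))
        + K * (2 * (1 / (8 * c0 * K)) + 1 / (1 / (8 * c0 * K))))"
  shows "L2F_norm M T (L2_norm h (primal_mesh h)) (\<lambda>t \<omega> x. g1 t \<omega> x - g2 t \<omega> x)
    \<le> sqrt ((1 + Kc) / \<theta>) * X1_norm M T h G0 (Lambda1 T h G0 w1 - Lambda1 T h G0 w2)"
proof -
  interpret brownian M B
    using basis by (simp add: brownian_basis_def brownian_def brownian_axioms_def)
  let ?W = "primal_mesh h :: (real ^ 'n) set"
  have h0: "0 < h" by (simp add: h)
  have fin: "finite ?W" by (rule finite_primal_mesh[OF h])
  \<comment> \<open>Bounds can be read off \<open>Linf_norm\<close>, which is a \<open>Max\<close>,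
    only on a nonempty mesh.\<close>
  have ne: "?W \<noteq> {}"
    unfolding primal_mesh_eq_grid[OF h] using N by (auto intro!: exI[of _ "\<lambda>_. 1"])
  have \<kappa>0: "0 < \<kappa>" using r by (simp add: \<kappa>_def)
  have \<theta>0: "0 < \<theta>" using \<kappa>0 by (simp add: \<theta>_def)
  have K1: "1 \<le> K" by (simp add: K_def)
  have R'0: "0 \<le> R'" by (simp add: R'_def)
  have Kc0: "0 \<le> Kc" unfolding Kc_def using \<theta>0 K1 c0 by (intro add_nonneg_nonneg mult_nonneg_nonneg) auto
  define \<phi> where "\<phi> = (\<lambda>x. (max 0 (r - dist x x0))\<^sup>2)"
  have \<phi>: "0 \<le> \<phi> x" "\<phi> x \<le> 1" for x
  proof -
    have "max 0 (r - dist x x0) \<le> 1" using r(2) zero_le_dist[of x x0] by linarith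
    then show "0 \<le> \<phi> x" "\<phi> x \<le> 1" unfolding \<phi>_def by (auto intro: power_le_one)
  qed
  have \<kappa>: "\<kappa> \<le> mesh_integral h ?W \<phi>"
    unfolding \<kappa>_def \<phi>_def
  proof (rule cutoff_volume[OF r(1) _ h hs(3)])
    show "ball x0 r \<subseteq> unit_cube" using r G0 by (auto simp: subset_eq dist_commute)
  qed
  have b1: "AE p in PT T. \<forall>x\<in>?W. \<bar>a1 i (fst p) (snd p) x\<bar> \<le> R" for i
  proof -
    have "AE p in PT T. (case p of (t, \<omega>) \<Rightarrow> ereal (Linf_norm ?W (a1 i t \<omega>))) \<le> LinfF_norm M T (Linf_norm ?W) (a1 i)"
      unfolding LinfF_norm_def by (rule esssup_AE)
    then show ?thesis
    proof eventually_elim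
      case (elim p)
      from order_trans[OF this[unfolded case_prod_unfold] a1(2)[of i]]
      have "Max ((\<lambda>x. \<bar>a1 i (fst p) (snd p) x\<bar>) ` ?W) \<le> R" by (simp add: Linf_norm_def)
      then show ?case using fin ne by (subst (asm) Max_le_iff) auto
    qed
  qed
  have b2: "AE p in PT T. Lp_norm nstar h ?W (a2 (fst p) (snd p)) \<le> R"
  proof -
    have "AE p in PT T. (case p of (t, \<omega>) \<Rightarrow> ereal (Lp_norm nstar h ?W (a2 t \<omega>))) \<le> LinfF_norm M T (Lp_norm nstar h ?W) a2"
      unfolding LinfF_norm_def by (rule esssup_AE)
    then show ?thesis
    proof eventually_elim
      case (elim p)
      from order_trans[OF this[unfolded case_prod_unfold] a2(2)] show ?case by simp
    qed
  qed
  have b2n: "mesh_integral h ?W (\<lambda>x. \<bar>f x\<bar> ^ CARD('n)) powr (1 / CARD('n)) \<le> K"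
    and b22: "mesh_integral h ?W (\<lambda>x. (f x)\<^sup>2) \<le> K" if "Lp_norm nstar h ?W f \<le> R" for f :: "real ^ 'n \<Rightarrow> real"
  proof -
    have "mesh_integral h ?W (\<lambda>x. \<bar>f x\<bar> ^ CARD('n)) \<le> K"
      unfolding K_def R'_def using n by (intro Lp_norm_power_bound[OF h nstar(2) _ that]) auto
    moreover have "0 \<le> mesh_integral h ?W (\<lambda>x. \<bar>f x\<bar> ^ CARD('n))" using h0 by (intro mesh_integral_nonneg) auto
    ultimately have "mesh_integral h ?W (\<lambda>x. \<bar>f x\<bar> ^ CARD('n)) powr (1 / CARD('n)) \<le> K powr (1 / CARD('n))"
      by (intro powr_mono2) auto
    also have "\<dots> \<le> K powr 1" using n K1 by (intro powr_mono) auto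
    finally show "mesh_integral h ?W (\<lambda>x. \<bar>f x\<bar> ^ CARD('n)) powr (1 / CARD('n)) \<le> K" using K1 by simp
    have "mesh_integral h ?W (\<lambda>x. \<bar>f x\<bar> ^ 2) \<le> K"
      unfolding K_def R'_def using nstar by (intro Lp_norm_power_bound[OF h _ _ that]) auto
    then show "mesh_integral h ?W (\<lambda>x. (f x)\<^sup>2) \<le> K" by simp
  qed
  \<comment> \<open>One mesh value of the potential is at most its L^2 norm divided by the square
    root of the cell volume. This blows up as \<open>h\<close> tends to zero, which is harmless
    because \<open>kb\<close> serves integrability only.\<close>
  define kb where "kb = \<bar>R\<bar> + sqrt (K / h ^ CARD('n))"
  interpret semidiscrete_problem M B N h T kb \<gamma> a1 a2
  proof
    have kb: "\<bar>R\<bar> \<le> kb" "sqrt (K / h ^ CARD('n)) \<le> kb" using K1 h0 by (auto simp: kb_def)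
    show "adapted_process M Filt T (primal_mesh h) (a1 i)" for i using a1(1)[of i] by (simp add: LinfF_def)
    show "adapted_process M Filt T (primal_mesh h) a2" using a2(1) by (simp add: LinfF_def)
    show "AE (t, \<omega>) in PT T. \<bar>a1 i t \<omega> x\<bar> \<le> kb" if "x \<in> primal_mesh h" for i x
      using b1[of i] by eventually_elim (use that kb in \<open>fastforce simp: case_prod_unfold\<close>)
    show "AE (t, \<omega>) in PT T. \<bar>a2 t \<omega> x\<bar> \<le> kb" if x: "x \<in> primal_mesh h" for x
      using b2
    proof eventually_elim
      case (elim p)
      have "h ^ CARD('n) * (a2 (fst p) (snd p) x)\<^sup>2 \<le> (L2_norm h ?W (a2 (fst p) (snd p)))\<^sup>2"
        using component_le_L2_norm[OF _ fin x] h0 by simp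
      also have "\<dots> \<le> K" using b22[OF elim] h0 by (simp add: L2_norm_square)
      finally have "(a2 (fst p) (snd p) x)\<^sup>2 \<le> K / h ^ CARD('n)" using h0 by (simp add: field_simps)
      then have "\<bar>a2 (fst p) (snd p) x\<bar> \<le> sqrt (K / h ^ CARD('n))"
        by (metis real_sqrt_abs real_sqrt_le_iff)
      then show ?case using kb by (simp add: case_prod_unfold)
    qed
  qed (use h T in auto)
  define u where "u = (\<lambda>t \<omega>. zero_ext (\<lambda>x. w1 t \<omega> x - w2 t \<omega> x))"
  have gsq: "\<forall>x\<in>?W. square_integrable (PT T) (\<lambda>(t, \<omega>). g1 t \<omega> x)" "\<forall>x\<in>?W. square_integrable (PT T) (\<lambda>(t, \<omega>). g2 t \<omega> x)"
  proof -
    have c: "h ^ CARD('n) * (f x)\<^sup>2 \<le> (H1_norm h f)\<^sup>2" if "x \<in> ?W" for x and f :: "real ^ 'n \<Rightarrow> real"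
      using component_le_L2_norm[OF _ fin that, of h f] L2_norm_le_H1_norm[of h f] h0 by simp
    show "\<forall>x\<in>?W. square_integrable (PT T) (\<lambda>(t, \<omega>). g1 t \<omega> x)" "\<forall>x\<in>?W. square_integrable (PT T) (\<lambda>(t, \<omega>). g2 t \<omega> x)"
      using L2F_component_square_integrable[OF g(1), of _ "h ^ CARD('n)"]
        L2F_component_square_integrable[OF g(2), of _ "h ^ CARD('n)"] c h0 by auto
  qed
  have u_fold: "zero_ext (\<lambda>x. w1 t \<omega> x - w2 t \<omega> x) = u t \<omega>" for t \<omega> by (simp add: u_def)
  note D = difference_ito_identity[OF sol gsq, unfolded u_fold]
  let ?G = "\<integral>(t, \<omega>). MI (\<lambda>x. (g1 t \<omega> x - g2 t \<omega> x)\<^sup>2) \<partial>PT T"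
  let ?S = "\<integral>(t, \<omega>). mesh_integral h (G0 \<inter> ?W) (\<lambda>x. (u t \<omega> x)\<^sup>2) \<partial>PT T"
  let ?E = "\<integral>\<omega>. MI (\<lambda>x. (u T \<omega> x)\<^sup>2) \<partial>M"
  have est: "\<theta> * ?G \<le> ?E + Kc * ?S"
    unfolding u_def
  proof (rule stability_estimate[OF sol gsq \<phi>])
    show "0 \<le> \<theta>" using \<theta>0 by simp
    have "AE \<omega> in M. \<forall>i. AE t in lborel. t \<in> {0<..<T} \<longrightarrow>
             (\<forall>x\<in>dual h i (primal_mesh h).
                \<bar>Dh h i (\<lambda>y. g1 t \<omega> y - g2 t \<omega> y) x\<bar>
                  \<le> C0 * \<bar>Ah h i (\<lambda>y. g1 t \<omega> y - g2 t \<omega> y) x\<bar>)"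
      using gD by (simp add: AE_all_countable)
    then show "AE \<omega> in M. AE t in Time T. \<theta> * MI (\<lambda>x. (g1 t \<omega> x - g2 t \<omega> x)\<^sup>2) \<le>
      (MI (\<lambda>x. \<phi> x * (g1 t \<omega> x - g2 t \<omega> x)))\<^sup>2 - \<theta> * MI (\<lambda>x. \<phi> x * (g1 t \<omega> x - g2 t \<omega> x) * (g1 t \<omega> x - g2 t \<omega> x))"
    proof eventually_elim
      case (elim \<omega>)
      then have "AE t in lborel. \<forall>i. t \<in> {0<..<T} \<longrightarrow>
             (\<forall>x\<in>dual h i (primal_mesh h).
                \<bar>Dh h i (\<lambda>y. g1 t \<omega> y - g2 t \<omega> y) x\<bar>
                  \<le> C0 * \<bar>Ah h i (\<lambda>y. g1 t \<omega> y - g2 t \<omega> y) x\<bar>)"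
        by (subst AE_all_countable)
      then have "AE t in lborel. t \<in> {0..T} \<longrightarrow> \<theta> * MI (\<lambda>x. (g1 t \<omega> x - g2 t \<omega> x)\<^sup>2) \<le>
        (MI (\<lambda>x. \<phi> x * (g1 t \<omega> x - g2 t \<omega> x)))\<^sup>2 - \<theta> * MI (\<lambda>x. \<phi> x * (g1 t \<omega> x - g2 t \<omega> x) * (g1 t \<omega> x - g2 t \<omega> x))"
        using AE_lborel_singleton[of 0] AE_lborel_singleton[of T]
      proof eventually_elim
        case (elim t)
        show ?case
        proof
          assume "t \<in> {0..T}"
          then have "t \<in> {0<..<T}" using elim(2,3) by auto
          then show "\<theta> * MI (\<lambda>x. (g1 t \<omega> x - g2 t \<omega> x)\<^sup>2) \<le>
            (MI (\<lambda>x. \<phi> x * (g1 t \<omega> x - g2 t \<omega> x)))\<^sup>2 - \<theta> * MI (\<lambda>x. \<phi> x * (g1 t \<omega> x - g2 t \<omega> x) * (g1 t \<omega> x - g2 t \<omega> x))"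
            unfolding \<theta>_def using elim(1) \<kappa>0
            by (intro Harnack_coercivity[OF h C0 hs(1) _ \<phi> _ \<kappa>]) auto
        qed
      qed
      then show ?case by (subst AE_restrict_space_iff) auto
    qed
    have "AE p in PT T. \<forall>i. \<forall>x\<in>?W. \<bar>a1 i (fst p) (snd p) x\<bar> \<le> R"
      using b1 by (simp add: AE_all_countable)
    then have "AE p in PT T. - 2 * MI (\<lambda>x. \<phi> x * u (fst p) (snd p) x) * MI (\<lambda>x. \<phi> x * dr (fst p) (snd p) (u (fst p) (snd p)) x)
      + 2 * \<theta> * MI (\<lambda>x. \<phi> x * u (fst p) (snd p) x * dr (fst p) (snd p) (u (fst p) (snd p)) x)
      \<le> Kc * mesh_integral h (G0 \<inter> ?W) (\<lambda>x. (u (fst p) (snd p) x)\<^sup>2)"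
      using b2
    proof eventually_elim
      case (elim p)
      show ?case unfolding \<phi>_def Kc_def
      proof (rule cutoff_dissipativity[OF n h c0 R'0 _ G0 r hs(2) _ _ _ b2n[OF elim(2)] b22[OF elim(2)] \<theta>0])
        show "0 < K" using K1 by simp
        show "u (fst p) (snd p) x = 0" if "x \<notin> ?W" for x using that by (simp add: u_def zero_ext_def)
        show "1 / c0 \<le> \<gamma> i y \<and> \<gamma> i y \<le> c0" if "y \<in> dual h i ?W" for i y
          using diffusion_coeffs_bounds[OF \<gamma>] dual_subset_unit_cube[OF h] that by blast
        show "\<bar>a1 i (fst p) (snd p) x\<bar> \<le> R'" if "x \<in> ?W" for i x
          using elim(1) that unfolding R'_def by (simp add: le_max_iff_disj)
      qed
    qed
    then show "AE (t, \<omega>) in PT T. - 2 * MI (\<lambda>x. \<phi> x * zero_ext (\<lambda>x. w1 t \<omega> x - w2 t \<omega> x) x) * MI (\<lambda>x. \<phi> x * dr t \<omega> (zero_ext (\<lambda>x. w1 t \<omega> x - w2 t \<omega> x)) x)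
      + 2 * \<theta> * MI (\<lambda>x. \<phi> x * zero_ext (\<lambda>x. w1 t \<omega> x - w2 t \<omega> x) x * dr t \<omega> (zero_ext (\<lambda>x. w1 t \<omega> x - w2 t \<omega> x)) x)
      \<le> Kc * mesh_integral h (G0 \<inter> ?W) (\<lambda>x. (zero_ext (\<lambda>x. w1 t \<omega> x - w2 t \<omega> x) x)\<^sup>2)"
      unfolding u_fold case_prod_unfold .
  qed
  have LG: "L2F_norm M T (L2_norm h ?W) (\<lambda>t \<omega> x. g1 t \<omega> x - g2 t \<omega> x) = sqrt ?G"
  proof (rule L2F_norm_eq)
    fix x assume x: "x \<in> ?W"
    show "square_integrable (PT T) (\<lambda>(t, \<omega>). g1 t \<omega> x - g2 t \<omega> x)"
      using square_integrable_diff[OF gsq(1)[rule_format, OF x] gsq(2)[rule_format, OF x]] by (simp add: case_prod_unfold)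
  qed (use h0 in simp)
  have LS: "L2F_norm M T (L2_norm h (G0 \<inter> ?W)) (fst (Lambda1 T h G0 w1 - Lambda1 T h G0 w2)) = sqrt ?S"
  proof -
    have "L2F_norm M T (L2_norm h (G0 \<inter> ?W)) (fst (Lambda1 T h G0 w1 - Lambda1 T h G0 w2)) =
      L2F_norm M T (L2_norm h (G0 \<inter> ?W)) u"
    proof (rule L2F_norm_cong_open)
      fix t \<omega> assume t: "t \<in> {0<..<T}"
      show "L2_norm h (G0 \<inter> ?W) (fst (Lambda1 T h G0 w1 - Lambda1 T h G0 w2) t \<omega>) = L2_norm h (G0 \<inter> ?W) (u t \<omega>)"
        unfolding L2_norm_def using t
        by (intro arg_cong[of _ _ sqrt] mesh_integral_cong) (auto simp: Lambda1_def u_def zero_ext_def)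
    qed
    also have "\<dots> = sqrt ?S" using h0 D(1) by (intro L2F_norm_eq) auto
    finally show ?thesis .
  qed
  have LE: "L2Omega_norm M (L2_norm h ?W) (snd (Lambda1 T h G0 w1 - Lambda1 T h G0 w2)) = sqrt ?E"
  proof -
    have "L2Omega_norm M (L2_norm h ?W) (snd (Lambda1 T h G0 w1 - Lambda1 T h G0 w2)) = L2Omega_norm M (L2_norm h ?W) (u T)"
    proof -
      have "L2_norm h ?W (snd (Lambda1 T h G0 w1 - Lambda1 T h G0 w2) \<omega>) = L2_norm h ?W (u T \<omega>)" for \<omega>
        unfolding L2_norm_def
        by (intro arg_cong[of _ _ sqrt] mesh_integral_cong) (auto simp: Lambda1_def u_def zero_ext_def)
      then show ?thesis by (simp add: L2Omega_norm_def L2Omega_sq_def)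
    qed
    also have "\<dots> = sqrt ?E" using h0 D(3) by (intro L2Omega_norm_eq) auto
    finally show ?thesis .
  qed
  have S0: "0 \<le> ?S" and E0: "0 \<le> ?E"
    using h0 by (auto intro!: Bochner_Integration.integral_nonneg mesh_integral_nonneg simp: case_prod_unfold)
  have "?G \<le> (1 + Kc) / \<theta> * (sqrt ?S + sqrt ?E)\<^sup>2"
  proof -
    have "?E + Kc * ?S \<le> (1 + Kc) * (?S + ?E)" using S0 E0 Kc0 by (simp add: algebra_simps)
    also have "\<dots> \<le> (1 + Kc) * (sqrt ?S + sqrt ?E)\<^sup>2"
      using S0 E0 Kc0 by (intro mult_left_mono) (auto simp: power2_sum)
    finally have "\<theta> * ?G \<le> (1 + Kc) * (sqrt ?S + sqrt ?E)\<^sup>2" using est by linarith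
    then show ?thesis using \<theta>0 by (simp add: field_simps)
  qed
  then have "sqrt ?G \<le> sqrt ((1 + Kc) / \<theta> * (sqrt ?S + sqrt ?E)\<^sup>2)" by simp
  also have "\<dots> = sqrt ((1 + Kc) / \<theta>) * (sqrt ?S + sqrt ?E)"
    using S0 E0 by (subst real_sqrt_mult) (simp del: real_sqrt_divide)
  finally show ?thesis unfolding LG X1_norm_def LS LE .
qed

theorem theorem1p1:
  fixes G0 :: "(real ^ 'n) set" and T c0 nstar R C0 :: real
  assumes "CARD('n) \<ge> 2" and "T > 0"
    and "open G0" and "G0 \<noteq> {}" and "G0 \<subseteq> unit_cube"
    and "c0 > 0"
    and "CARD('n) = 2 \<longrightarrow> nstar > 2" and "CARD('n) \<ge> 3 \<longrightarrow> nstar \<ge> real CARD('n)"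
    and "C0 > 0"
  shows "\<exists>C>0. \<exists>N0::nat.
    \<forall>(M :: 'w measure) B (\<gamma> :: 'n \<Rightarrow> real ^ 'n \<Rightarrow> real).
      brownian_basis M B \<and> diffusion_coeffs \<gamma> \<and> reg \<gamma> < ereal c0 \<longrightarrow>
      (\<forall>N\<ge>N0. \<forall>h. h = 1 / (real N + 1) \<longrightarrow>
        (\<forall>a1 a2 g1 g2 w0 w1 w2.
          (\<forall>i. a1 i \<in> LinfF M (aug_filtration M B) T (primal_mesh h) (Linf_norm (primal_mesh h)) \<and>
               LinfF_norm M T (Linf_norm (primal_mesh h)) (a1 i) \<le> ereal R) \<and>
          a2 \<in> LinfF M (aug_filtration M B) T (primal_mesh h) (Lp_norm nstar h (primal_mesh h)) \<and>
          LinfF_norm M T (Lp_norm nstar h (primal_mesh h)) a2 \<le> ereal R \<and>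
          g1 \<in> L2F M (aug_filtration M B) T (primal_mesh h \<union> mesh_boundary h) (H1_norm h) \<and>
          g2 \<in> L2F M (aug_filtration M B) T (primal_mesh h \<union> mesh_boundary h) (H1_norm h) \<and>
          (\<forall>i. AE \<omega> in M. AE t in lborel. t \<in> {0<..<T} \<longrightarrow>
             (\<forall>x\<in>dual h i (primal_mesh h).
                \<bar>Dh h i (\<lambda>y. g1 t \<omega> y - g2 t \<omega> y) x\<bar>
                  \<le> C0 * \<bar>Ah h i (\<lambda>y. g1 t \<omega> y - g2 t \<omega> y) x\<bar>)) \<and>
          w0 \<in> L2Omega M (aug_filtration M B 0) (primal_mesh h) (L2_norm h (primal_mesh h)) \<and>
          is_solution M B T h \<gamma> a1 a2 g1 w0 w1 \<and>
          is_solution M B T h \<gamma> a1 a2 g2 w0 w2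
          \<longrightarrow>
          L2F_norm M T (L2_norm h (primal_mesh h)) (\<lambda>t \<omega> x. g1 t \<omega> x - g2 t \<omega> x)
            \<le> C * X1_norm M T h G0 (Lambda1 T h G0 w1 - Lambda1 T h G0 w2)))"
proof -
  obtain x0 e where e: "0 < e" "cball x0 e \<subseteq> G0"
    using assms(3,4) open_contains_cball by blast
  \<comment> \<open>Halving \<open>e\<close> leaves room for the stencil around the support of the
    bump; the cap 1 keeps the bump at most 1.\<close>
  define r where "r = min (e / 2) 1"
  have r: "0 < r" "r \<le> 1" "cball x0 (2 * r) \<subseteq> G0"
  proof -
    have "cball x0 (2 * r) \<subseteq> cball x0 e" by (rule subset_cball) (simp add: r_def)
    then show "cball x0 (2 * r) \<subseteq> G0" using e by blast
  qed (use e in \<open>auto simp: r_def\<close>)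
  have nstar: "2 \<le> nstar" "real CARD('n) \<le> nstar" using assms(1,7,8) by (cases "CARD('n) = 2"; force)+
  define \<kappa> where "\<kappa> = (r / (2 * CARD('n))) ^ CARD('n) * (r / 2)\<^sup>2"
  define \<theta> where "\<theta> = \<kappa>\<^sup>2 * exp (- 4 * (2 * C0 * CARD('n))) / 2"
  define R' where "R' = max R 1"
  define K where "K = 1 + R' powr nstar"
  define Kc where "Kc = 2 * (CARD('n) * (2 * c0\<^sup>2 / (\<theta> / (4 * c0)) + R'\<^sup>2 / (\<theta> / (4 * c0))) + K + 1) +
      2 * \<theta> * (CARD('n) * (c0\<^sup>2 / (1 / (8 * c0)) + R'\<^sup>2 / (1 / (8 * c0)))
        + K * (2 * (1 / (8 * c0 * K)) + 1 / (1 / (8 * c0 * K))))"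
  have \<theta>0: "0 < \<theta>" using r by (simp add: \<theta>_def \<kappa>_def)
  have K1: "1 \<le> K" by (simp add: K_def)
  have Kc0: "0 \<le> Kc" unfolding Kc_def using \<theta>0 K1 assms(6) by (intro add_nonneg_nonneg mult_nonneg_nonneg) auto
  \<comment> \<open>The last three summands yield \<open>C0 * h \<le> 1\<close> for Harnack,
    \<open>h \<le> r\<close> for the stencil and \<open>h \<le> r / (2 * n)\<close> for the cutoff
    volume.\<close>
  obtain N0 :: nat where N0: "1 + C0 + 1 / r + 2 * CARD('n) / r \<le> real N0" using real_arch_simple by blast
  have small: "0 < N" "C0 * h \<le> 1" "h \<le> r" "h \<le> r / (2 * CARD('n))" if "N0 \<le> N" "h = 1 / (real N + 1)" for N h
  proof -
    have pos: "0 < C0" "0 < 1 / r" "0 < 2 * CARD('n) / r" using assms(9) r by auto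
    have N: "1 + C0 + 1 / r + 2 * CARD('n) / r \<le> real N" using N0 that(1) by linarith
    then show "0 < N" using pos by (intro gr0I) auto
    have "C0 \<le> real N + 1" using N pos by linarith
    then show "C0 * h \<le> 1" unfolding that(2) by simp
    have "1 / r \<le> real N + 1" using N pos by linarith
    then show "h \<le> r" unfolding that(2) using r by (simp add: field_simps)
    have "2 * CARD('n) / r \<le> real N + 1" using N pos by linarith
    then show "h \<le> r / (2 * CARD('n))" unfolding that(2) using r by (simp add: field_simps)
  qed
  show ?thesis
  proof (intro exI[of _ "sqrt ((1 + Kc) / \<theta>)"] conjI exI[of _ N0] allI impI)
    show "0 < sqrt ((1 + Kc) / \<theta>)" using \<theta>0 Kc0 by simp
  qed (unfold Kc_def K_def R'_def \<theta>_def \<kappa>_def, elim conjE,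
      rule localized_stability[OF assms(1,2,5,6) nstar assms(9) r], use small in auto)
qed

end
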